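(* Consider the queue $M(t)\,|\,M[k,B]\,|\,1$ with arrival intensity $\lambda(t)$, service rate $\mu$, service threshold $k$ and maximal batch size $B$, with state probabilities $p_{r,0}(t)$ ($0\le r<k$) and densities $p_{n,1}(x,t)$ ($n\ge 0$). For $t,x\ge 0$ the following equations hold: $$\frac{dp_{0,0}(t)}{dt} = -\lambda(t)\,p_{0,0}(t) + \mu\int_{(0,\infty)}p_{0,1}(x,t)\,dx,$$ $$\frac{dp_{r,0}(t)}{dt} = -\lambda(t)\,p_{r,0}(t) + \lambda(t)\,p_{r-1,0}(t) + \mu\int_{(0,\infty)}p_{r,1}(x,t)\,dx,\qquad 1\le r<k,$$ $$\frac{\partial p_{0,1}(x,t)}{\partial t}+\frac{\partial p_{0,1}(x,t)}{\partial x} = -(\lambda(t)+\mu)\,p_{0,1}(x,t),$$ $$\frac{\partial p_{n,1}(x,t)}{\partial t}+\frac{\partial p_{n,1}(x,t)}{\partial x} = -(\lambda(t)+\mu)\,p_{n,1}(x,t)+\lambda(t)\,p_{n-1,1}(x,t),\qquad n\ge 1.$$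
   Context: The queue $M(t)\,|\,M[k,B]\,|\,1$ is the following single-server system, with integers $1\le k\le B$. Customers arrive one at a time according to a non-stationary Poisson process of intensity $\lambda(t)$, $t\ge 0$. The server serves customers in batches: when it is free, it starts a service as soon as there are at least $k$ customers in the queue, and it can serve at most $B$ customers simultaneously. Thus, if a service ends with $n$ customers waiting, the server becomes idle if $n<k$, takes all $n$ customers if $k\le n\le B$, and takes $B$ customers (leaving $n-B$ waiting) if $n>B$; if the server is idle with $k-1$ customers waiting and a customer arrives, a service of these $k$ customers starts at once and no customer is left waiting. A customer arriving while the server is busy joins the queue. The service time of a batch is exponentially distributed with parameter $\mu$. The time $t\in[0,\infty)$ is the time of evolution of the whole system; $x\in[0,\infty)$ is the elapsed service time of the current service, reset to $0$ whenever a new service starts. The state of the queue is a pair $(n_1,n_2)$, where $n_1$ is the number of customers waiting in the queue (not including those in service), $n_2=1$ if the server is busy and $n_2=0$ if it is idle. For $0\le r<k$, $p_{r,0}(t)$ is the probability that at time $t$ there are $r$ customers waiting and the server is idle. For $n\ge 0$, $p_{n,1}(x,t)$ is the density, in the elapsed service time $x$, of the event that at time $t$ there are $n$ customers waiting and the server is busy; thus $\int_{(0,\infty)}p_{n,1}(x,t)\,dx$ is the probability that at time $t$ there are $n$ customers waiting and the server is busy, and $\sum_{r=0}^{k-1}p_{r,0}(t)+\sum_{n=0}^{\infty}\int_{(0,\infty)}p_{n,1}(x,t)\,dx=1$ for all $t\ge 0$.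
   Formalization: λ(t) is assumed continuous on [0,∞); the two partial differential equations are claimed only at points (x,t) near which p_{0,1},…,p_{n,1} are continuous and where p_{n,1} is differentiable in (x,t) jointly (e.g. an idle start gives a jump along x=t); boundary derivatives are one-sided. *)

theory Defs
  imports "HOL-Probability.Probability"
begin

text \<open>
  A Poisson process of intensity \<open>lam\<close>, given by its counting process: \<open>N t\<close> is the number of
  arrivals in \<open>(0, t]\<close>. That customers arrive one at a time is a consequence (almost surely),
  since the mean of \<open>N t - N s\<close> is continuous in \<open>s\<close> and \<open>t\<close>.
\<close>

locale poisson_arrivals = prob_space M
  for M :: "'a measure" +
  fixes lam :: "real \<Rightarrow> real" and N :: "real \<Rightarrow> 'a \<Rightarrow> nat"
  assumes lam_continuous: "continuous_on {0..} lam"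
    and lam_nonneg: "\<And>t. 0 \<le> t \<Longrightarrow> 0 \<le> lam t"
    and N_measurable: "\<And>t. 0 \<le> t \<Longrightarrow> N t \<in> measurable M (count_space UNIV)"
    and N_zero: "\<And>\<omega>. \<omega> \<in> space M \<Longrightarrow> N 0 \<omega> = 0"
    and N_mono: "\<And>\<omega> s t. \<omega> \<in> space M \<Longrightarrow> 0 \<le> s \<Longrightarrow> s \<le> t \<Longrightarrow> N s \<omega> \<le> N t \<omega>"
    and N_right_continuous:
      "\<And>\<omega> t. \<omega> \<in> space M \<Longrightarrow> 0 \<le> t \<Longrightarrow> eventually (\<lambda>u. N u \<omega> = N t \<omega>) (at_right t)"
    and N_indep_increments:
      "\<And>\<tau> :: nat \<Rightarrow> real. 0 \<le> \<tau> 0 \<Longrightarrow> incseq \<tau> \<Longrightarrow>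
         indep_vars (\<lambda>_. count_space UNIV) (\<lambda>i \<omega>. N (\<tau> (Suc i)) \<omega> - N (\<tau> i) \<omega>) UNIV"
    and N_increment_distribution:
      "\<And>s t n. 0 \<le> s \<Longrightarrow> s \<le> t \<Longrightarrow>
         prob {\<omega> \<in> space M. N t \<omega> - N s \<omega> = n} =
           exp (- integral {s..t} lam) * integral {s..t} lam ^ n / fact n"

text \<open>
  The initial state is random: \<open>Q0\<close> customers are waiting, and if \<open>busy0\<close> holds then a service
  with elapsed time \<open>X0\<close> is in progress. The arrivals, the service times and the initial state
  are independent, that is, the sigma-algebras they generate are.

  If the server is busy at time 0, then \<open>S 0\<close> is the remaining time of the service in progress;
  by the lack of memory it is exponential, whatever the elapsed time. The
  services started later last \<open>S 1\<close>, \<open>S 2\<close>, and so on. If the server is idle at time 0,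
  then \<open>S 0\<close> is not used.
\<close>

locale bulk_service_queue = poisson_arrivals M lam N
  for M :: "'a measure" and lam :: "real \<Rightarrow> real" and N :: "real \<Rightarrow> 'a \<Rightarrow> nat" +
  fixes mu :: real and k B :: nat
    and S :: "nat \<Rightarrow> 'a \<Rightarrow> real"
    and Q0 :: "'a \<Rightarrow> nat" and busy0 :: "'a \<Rightarrow> bool" and X0 :: "'a \<Rightarrow> real"
  assumes k_ge_1: "1 \<le> k" and k_le_B: "k \<le> B" and mu_pos: "0 < mu"
    and S_pos: "\<And>j \<omega>. \<omega> \<in> space M \<Longrightarrow> 0 < S j \<omega>"
    and S_exponential: "\<And>j. distributed M lborel (S j) (exponential_density mu)"
    and S_indep: "indep_vars (\<lambda>_. borel) S UNIV"
    and idle0_below_threshold: "\<And>\<omega>. \<omega> \<in> space M \<Longrightarrow> \<not> busy0 \<omega> \<Longrightarrow> Q0 \<omega> < k"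
    and X0_nonneg: "\<And>\<omega>. \<omega> \<in> space M \<Longrightarrow> 0 \<le> X0 \<omega>"
    and independence:
      "indep_sets (\<lambda>i. sets
         ([vimage_algebra (space M) (\<lambda>\<omega>. \<lambda>t\<in>{0..}. N t \<omega>)
             (Pi\<^sub>M {0..} (\<lambda>_. count_space UNIV)),
           vimage_algebra (space M) (\<lambda>\<omega> j. S j \<omega>)
             (Pi\<^sub>M UNIV (\<lambda>_. borel)),
           vimage_algebra (space M) (\<lambda>\<omega>. (Q0 \<omega>, busy0 \<omega>, X0 \<omega>))
             (count_space UNIV \<Otimes>\<^sub>M count_space UNIV \<Otimes>\<^sub>M borel)] ! i)) {..<3}"
begin

text \<open>
  If \<open>c\<close> customers have been taken into service since time 0 and the server is free
  from time \<open>f\<close> on, then \<open>Q0 + N u - c\<close> customers wait at a time \<open>u \<ge> f\<close> before the next service,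
  and that service starts as soon as this number is at least \<open>k\<close>. It
  is infinite if the threshold is never reached.
\<close>

definition next_start :: "ereal \<times> nat \<Rightarrow> 'a \<Rightarrow> ereal" where
  "next_start = (\<lambda>(f, c) \<omega>. INF u \<in> {u. f \<le> ereal u \<and> k \<le> Q0 \<omega> + N u \<omega> - c}. ereal u)"

text \<open>
  \<open>freed j \<omega>\<close> consists of the time at which the server becomes free for the service
  number \<open>j + 1\<close> started after time 0 (which is 0 if \<open>j = 0\<close> and the server is idle at
  time 0), and of the number of customers taken into service since time 0 before that
  service. When a service starts, \<open>min B\<close> of the number of waiting customers
  are taken. Once a start is infinite, so are all later times, and the counts have no meaning.
\<close>

primrec freed :: "nat \<Rightarrow> 'a \<Rightarrow> ereal \<times> nat" where
  "freed 0 \<omega> = (if busy0 \<omega> then ereal (S 0 \<omega>) else 0, 0)"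
| "freed (Suc j) \<omega> =
    (let c = snd (freed j \<omega>); \<sigma> = next_start (freed j \<omega>) \<omega> in
      (\<sigma> + ereal (S (Suc j) \<omega>), c + min B (Q0 \<omega> + N (real_of_ereal \<sigma>) \<omega> - c)))"

definition free_time :: "nat \<Rightarrow> 'a \<Rightarrow> ereal" where
  "free_time j \<omega> = fst (freed j \<omega>)"

definition taken :: "nat \<Rightarrow> 'a \<Rightarrow> nat" where
  "taken j \<omega> = snd (freed j \<omega>)"

definition service_start :: "nat \<Rightarrow> 'a \<Rightarrow> ereal" where
  "service_start j \<omega> = next_start (freed j \<omega>) \<omega>"

text \<open>State \<open>(r, 0)\<close> at time \<open>t\<close>.\<close>

definition idle_with :: "real \<Rightarrow> nat \<Rightarrow> 'a \<Rightarrow> bool" where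
  "idle_with t r \<omega> \<longleftrightarrow>
    (\<exists>j. free_time j \<omega> \<le> ereal t \<and> ereal t < service_start j \<omega> \<and>
         r = Q0 \<omega> + N t \<omega> - taken j \<omega>)"

text \<open>State \<open>(n, 1)\<close> at time \<open>t\<close> with elapsed service time \<open>x\<close>.\<close>

definition busy_with :: "real \<Rightarrow> nat \<Rightarrow> real \<Rightarrow> 'a \<Rightarrow> bool" where
  "busy_with t n x \<omega> \<longleftrightarrow>
    (busy0 \<omega> \<and> ereal t < free_time 0 \<omega> \<and> n = Q0 \<omega> + N t \<omega> \<and> x = X0 \<omega> + t) \<or>
    (\<exists>j. service_start j \<omega> \<le> ereal t \<and> ereal t < free_time (Suc j) \<omega> \<and>
         n = Q0 \<omega> + N t \<omega> - taken (Suc j) \<omega> \<and> x = t - real_of_ereal (service_start j \<omega>))"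

definition idle_prob :: "nat \<Rightarrow> real \<Rightarrow> real" where
  "idle_prob r t = prob {\<omega> \<in> space M. idle_with t r \<omega>}"

definition busy_density :: "nat \<Rightarrow> real \<Rightarrow> (real \<Rightarrow> real) \<Rightarrow> bool" where
  "busy_density n t g \<longleftrightarrow>
    (\<forall>x>0. 0 \<le> g x) \<and> set_integrable lborel {0<..} g \<and>
    (\<forall>A\<in>sets borel. prob {\<omega> \<in> space M. \<exists>x\<in>A. busy_with t n x \<omega>} =
                     (LINT x:A \<inter> {0<..}|lborel. g x))"

end

text \<open>
  A density is determined only up to null sets and need not be smooth (an initially idle
  server, for instance, in general produces a jump along \<open>x = t\<close>), so its partial derivatives
  are meaningful only for a locally continuous version, at points of differentiability. On the
  boundary of the quadrant, derivatives are one-sided.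
\<close>

definition regular_at :: "(nat \<Rightarrow> real \<Rightarrow> real \<Rightarrow> real) \<Rightarrow> nat \<Rightarrow> real \<Rightarrow> real \<Rightarrow> bool" where
  "regular_at p n x t \<longleftrightarrow>
    (\<exists>U. open U \<and> (x, t) \<in> U \<and>
      (\<forall>m\<le>n. continuous_on (U \<inter> {0..} \<times> {0..}) (\<lambda>(y, s). p m y s))) \<and>
    (\<lambda>(y, s). p n y s) differentiable (at (x, t) within {0..} \<times> {0..})"

end

theory Submission
  imports Defs
begin

text \<open>
  Given the initial state, the service times before the \<open>j\<close>-th one and the whole arrival process, the
  \<open>j\<close>-th service time is still exponential, so it has no memory; and the state at time \<open>t\<close> is not
  changed when the arrivals are stopped at \<open>t\<close>, so it is independent of the arrivals after \<open>t\<close>.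
  Every service takes a customer, so only finitely many services start before \<open>t\<close>, and summing over
  the service in progress gives the transition probabilities from \<open>t\<close> to \<open>v\<close>.

  For the idle states, two arrivals, two ends of services, or one of each between \<open>t\<close> and \<open>v\<close> have
  probability at most \<open>(\<Lambda> + \<mu> (v - t))\<^sup>2\<close>, where \<open>\<Lambda>\<close> is the integral of the intensity over \<open>[t, v]\<close>; this
  bound does not depend on which of \<open>t\<close> and \<open>v\<close> is kept fixed, so it yields both one-sided derivatives.

  For the busy states the transition is exact as long as the service lasts: up to null sets,
  \<open>p\<^sub>n (x + h, t + h) = exp (- \<mu> h) (\<Sum>i\<le>n. \<pi>\<^sub>i p\<^sub>n\<^sub>-\<^sub>i (x, t))\<close> with Poisson weights \<open>\<pi>\<^sub>i\<close> of mean
  \<open>\<Lambda>\<close>. Where the densities are continuous this holds pointwise, and its derivative in \<open>h\<close>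
  at \<open>0\<close> is the derivative of \<open>p\<^sub>n\<close> in the direction \<open>(1, 1)\<close>.
\<close>

section \<open>Paths of the queue\<close>

text \<open>The number of services begun before \<open>t\<close> is random, so every event is split
  by the index \<open>j\<close> of the current cycle, that is, a service together with the idle
  period after it. For fixed \<open>j\<close> two pasts are needed, neither of which covers the
  other: all arrivals with the services before \<open>j\<close>, which leave \<open>S j\<close>
  fresh, and the arrivals up to \<open>t\<close> with all services, which leave the later arrivals
  fresh. The factor of the service is extracted with the first and that of the arrivals with the
  second. Neither factor depends on \<open>j\<close>, so both survive the sum over the disjoint
  cycles.

  A left derivative of an idle probability comes from an expansion that starts at the earlier,
  moving time; hence the state probabilities must also be shown to be continuous. The busy equations
  need no estimate of double events, because an elapsed time above \<open>h\<close> at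
  \<open>t + h\<close> says that the service was already running at \<open>t\<close>. What remains
  there is the passage from integrals to points, including the edge \<open>x = 0\<close>, where only
  intervals to the right of the point are available.\<close>

text \<open>
  The recursion of \<open>freed\<close> for a single path, so that it also applies to stopped arrivals and to
  altered service times.
\<close>

definition first_start :: "nat \<Rightarrow> nat \<Rightarrow> (real \<Rightarrow> nat) \<Rightarrow> ereal \<times> nat \<Rightarrow> ereal" where
  "first_start k q n fc = (INF u \<in> {u. fst fc \<le> ereal u \<and> k \<le> q + n u - snd fc}. ereal u)"

primrec cyc :: "nat \<Rightarrow> nat \<Rightarrow> nat \<Rightarrow> bool \<Rightarrow> (real \<Rightarrow> nat) \<Rightarrow> (nat \<Rightarrow> real) \<Rightarrow> nat \<Rightarrow> ereal \<times> nat" where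
  "cyc k B q b n s 0 = (if b then ereal (s 0) else 0, 0)"
| "cyc k B q b n s (Suc j) =
    (first_start k q n (cyc k B q b n s j) + ereal (s (Suc j)),
     snd (cyc k B q b n s j)
       + min B (q + n (real_of_ereal (first_start k q n (cyc k B q b n s j))) - snd (cyc k B q b n s j)))"

text \<open>Cycle 0 starts at time 0 by convention, whether it opens with the service in progress or
  with an idle server. The index is therefore one ahead of \<open>service_start\<close>.\<close>

definition cyc_start :: "nat \<Rightarrow> nat \<Rightarrow> nat \<Rightarrow> bool \<Rightarrow> (real \<Rightarrow> nat) \<Rightarrow> (nat \<Rightarrow> real) \<Rightarrow> nat \<Rightarrow> ereal" where
  "cyc_start k B q b n s j = (case j of 0 \<Rightarrow> 0 | Suc i \<Rightarrow> first_start k q n (cyc k B q b n s i))"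

lemma cyc_start_simps [simp]:
  "cyc_start k B q b n s 0 = 0"
  "cyc_start k B q b n s (Suc i) = first_start k q n (cyc k B q b n s i)"
  by (simp_all add: cyc_start_def)

lemma fst_cyc:
  "fst (cyc k B q b n s j) =
    (if j = 0 \<and> \<not> b then 0 else cyc_start k B q b n s j + ereal (s j))"
  by (cases j) auto

text \<open>Start and count of a cycle are settled before its own service time enters; only its end
  involves \<open>s j\<close>. This later makes the \<open>j\<close>-th service time independent of
  the moment at which that service begins.\<close>

lemma cyc_cong:
  assumes "\<And>i. i < j \<Longrightarrow> s i = s' i"
  shows "cyc_start k B q b n s j = cyc_start k B q b n s' j \<and>
    snd (cyc k B q b n s j) = snd (cyc k B q b n s' j)"
  using assms
proof (induction j)
  case (Suc j)
  then have e: "cyc_start k B q b n s j = cyc_start k B q b n s' j" "s j = s' j"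
    "snd (cyc k B q b n s j) = snd (cyc k B q b n s' j)"
    by simp_all
  then have "cyc k B q b n s j = cyc k B q b n s' j"
    by (simp only: prod_eq_iff fst_cyc simp_thms)
  then show ?case by simp
qed simp

lemma first_start_ge: "fst fc \<le> first_start k q n fc"
  unfolding first_start_def by (rule INF_greatest) auto

section \<open>Counting paths and first passage times\<close>

locale counting_path =
  fixes n :: "real \<Rightarrow> nat"
  assumes mono: "\<And>x y. 0 \<le> x \<Longrightarrow> x \<le> y \<Longrightarrow> n x \<le> n y"
    and right_continuous: "\<And>x. 0 \<le> x \<Longrightarrow> eventually (\<lambda>y. n y = n x) (at_right x)"
begin

lemma constant_right:
  assumes "0 \<le> x" obtains z where "x < z" "\<And>y. x \<le> y \<Longrightarrow> y < z \<Longrightarrow> n y = n x"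
proof -
  obtain z where z: "x < z" "\<And>y. x < y \<Longrightarrow> y < z \<Longrightarrow> n y = n x"
    using right_continuous[OF assms] by (auto simp: eventually_at_right_field)
  show thesis
    by (rule that[OF z(1)]) (metis z(2) order_le_less)
qed

text \<open>By right-continuity the infimum is attained: a time just after \<open>u\<close> that
  meets the threshold has no larger count than \<open>u\<close> itself. Events about a start time
  thus become events about the count at one fixed time.\<close>

lemma first_start_le_iff:
  assumes "0 \<le> fst fc"
  shows "first_start k q n fc \<le> ereal u \<longleftrightarrow> fst fc \<le> ereal u \<and> k \<le> q + n u - snd fc"
proof
  assume "fst fc \<le> ereal u \<and> k \<le> q + n u - snd fc"
  then show "first_start k q n fc \<le> ereal u"
    unfolding first_start_def by (intro INF_lower) auto
next
  assume le: "first_start k q n fc \<le> ereal u"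
  then have fu: "fst fc \<le> ereal u" using first_start_ge order_trans by blast
  with assms have "0 \<le> u" by (metis ereal_less_eq(5) order_trans)
  then obtain z where z: "u < z" "\<And>y. u \<le> y \<Longrightarrow> y < z \<Longrightarrow> n y = n u"
    using constant_right by blast
  from le z(1) have "first_start k q n fc < ereal z"
    by (meson le_less_trans ereal_less(2) less_ereal.simps(1))
  then obtain v where v: "fst fc \<le> ereal v" "k \<le> q + n v - snd fc" "v < z"
    unfolding first_start_def INF_less_iff by auto
  have "0 \<le> v" using assms v(1) by (metis ereal_less_eq(5) order_trans)
  have "n v \<le> n u"
    using mono[OF \<open>0 \<le> v\<close>, of u] z(2)[of v] v(3) by linarith
  with v(2) fu show "fst fc \<le> ereal u \<and> k \<le> q + n u - snd fc" by linarith
qed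

end

section \<open>Idle and busy periods of a single path\<close>

locale service_path = counting_path n for n :: "real \<Rightarrow> nat" +
  fixes k B q :: nat and b :: bool and s :: "nat \<Rightarrow> real"
  assumes s_pos: "\<And>j. 0 < s j" and k_pos: "1 \<le> k" and k_le: "k \<le> B"
begin

abbreviation "cy j \<equiv> cyc k B q b n s j"
abbreviation "fr j \<equiv> fst (cyc k B q b n s j)"
abbreviation "tk j \<equiv> snd (cyc k B q b n s j)"
abbreviation "st j \<equiv> cyc_start k B q b n s j"

lemma start_nonneg_le_free: "0 \<le> st j \<and> st j \<le> fr j"
proof (induction j)
  case 0
  then show ?case using s_pos[of 0] by (simp add: fst_cyc)
next
  case (Suc j)
  have "fr j \<le> st (Suc j)" using first_start_ge by simp
  with Suc have 0: "0 \<le> st (Suc j)" by (meson order_trans)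
  have "st (Suc j) + 0 \<le> st (Suc j) + ereal (s (Suc j))"
    using s_pos[of "Suc j"] by (intro add_left_mono) simp
  then show ?case unfolding fst_cyc using 0 by simp
qed

lemma start_nonneg: "0 \<le> st j" and start_le_free: "st j \<le> fr j" and free_nonneg: "0 \<le> fr j"
  using start_nonneg_le_free[of j] by auto

lemma free_le_start: "fr j \<le> st (Suc j)"
  using first_start_ge by simp

lemma start_mono: "i \<le> j \<Longrightarrow> st i \<le> st j"
  using lift_Suc_mono_le[of "cyc_start k B q b n s"] start_le_free free_le_start order_trans by blast

lemma start_Suc_le_iff: "st (Suc j) \<le> ereal u \<longleftrightarrow> fr j \<le> ereal u \<and> k \<le> q + n u - tk j"
  using first_start_le_iff[OF free_nonneg, of k q j u] by simp

text \<open>A service starts with at least \<open>k\<close> customers present and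
  \<open>1 \<le> k \<le> B\<close>, so it takes at least one and never more than are there. The
  lower bound leaves only finitely many starts before \<open>u\<close>; the upper bound makes the
  truncated subtraction in the queue length exact.\<close>

lemma taken_bounds:
  "st j \<le> ereal u \<Longrightarrow> j \<le> tk j \<and> tk j \<le> q + n u"
proof (induction j arbitrary: u)
  case (Suc j)
  define v where "v = real_of_ereal (st (Suc j))"
  have v: "ereal v = st (Suc j)"
    using Suc.prems start_nonneg[of "Suc j"] unfolding v_def
    by (intro ereal_real') auto
  have "ereal 0 \<le> ereal v" "ereal v \<le> ereal u" using Suc.prems start_nonneg[of "Suc j"] v by (simp_all only: zero_ereal_def)
  then have "0 \<le> v" "v \<le> u" by simp_all
  then have nv: "n v \<le> n u" using mono by auto
  have "st j \<le> ereal v" using start_mono[of j "Suc j"] v by simp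
  from Suc.IH[OF this] have IH: "j \<le> tk j" "tk j \<le> q + n v" by auto
  have kv: "k \<le> q + n v - tk j" using start_Suc_le_iff[of j v] v by simp
  have "tk (Suc j) = tk j + min B (q + n v - tk j)" using v_def by simp
  with IH kv nv k_pos k_le show ?case by (auto simp: min_def)
qed simp

lemma taken_le: "st j \<le> ereal u \<Longrightarrow> tk j \<le> q + n u"
  using taken_bounds by blast

lemma ex_index:
  assumes "0 \<le> u" shows "\<exists>j. st j \<le> ereal u \<and> ereal u < st (Suc j)"
proof -
  have ex: "\<not> st (Suc (q + n u)) \<le> ereal u" using taken_bounds[of "Suc (q + n u)" u] by linarith
  define j where "j = (LEAST j. \<not> st (Suc j) \<le> ereal u)"
  have 1: "\<not> st (Suc j) \<le> ereal u" unfolding j_def by (rule LeastI[of _ "q + n u"]) (fact ex)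
  have "st j \<le> ereal u"
  proof (cases j)
    case 0 then show ?thesis using assms by simp
  next
    case (Suc i)
    then show ?thesis using not_less_Least[of i "\<lambda>j. \<not> st (Suc j) \<le> ereal u"] j_def by simp
  qed
  with 1 show ?thesis by force
qed

lemma index_unique:
  assumes "st i \<le> ereal u" "ereal u < st (Suc i)" "st j \<le> ereal u" "ereal u < st (Suc j)"
  shows "i = j"
  using assms start_mono[of "Suc i" j] start_mono[of "Suc j" i]
  by (meson leD less_le_not_le linorder_cases not_less_eq_eq order_trans Suc_leI)

lemma start_real: "st j \<le> ereal u \<Longrightarrow> ereal (real_of_ereal (st j)) = st j"
  using start_nonneg[of j] by (intro ereal_real') auto

definition idle :: "nat \<Rightarrow> real \<Rightarrow> nat \<Rightarrow> bool" where
  "idle j u r \<longleftrightarrow> fr j \<le> ereal u \<and> ereal u < st (Suc j) \<and> r = q + n u - tk j"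

text \<open>If the server is idle at time 0, then \<open>st 0 = fr 0 = 0\<close> and the busy part
  of cycle 0 is empty, so the value \<open>s 0\<close> has no effect.\<close>

definition busy :: "nat \<Rightarrow> real \<Rightarrow> nat \<Rightarrow> bool" where
  "busy j u r \<longleftrightarrow> st j \<le> ereal u \<and> ereal u < fr j \<and> r = q + n u - tk j"

lemma idle_index: "idle j u r \<Longrightarrow> st j \<le> ereal u \<and> ereal u < st (Suc j)"
  using start_le_free[of j] by (auto simp: idle_def intro: order_trans)

lemma busy_index: "busy j u r \<Longrightarrow> st j \<le> ereal u \<and> ereal u < st (Suc j)"
  using free_le_start[of j] by (auto simp: busy_def intro: less_le_trans)

lemma idle_less: "idle j u r \<Longrightarrow> r < k"
  using start_Suc_le_iff[of j u] unfolding idle_def by (meson leD linorder_not_le)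

lemma idle_unique: "idle i u r \<Longrightarrow> idle j u r' \<Longrightarrow> i = j \<and> r = r'"
  using idle_index index_unique by (metis idle_def)

lemma busy_unique: "busy i u r \<Longrightarrow> busy j u r' \<Longrightarrow> i = j \<and> r = r'"
  using busy_index index_unique by (metis busy_def)

lemma idle_not_busy: "idle i u r \<Longrightarrow> \<not> busy j u r'"
  using busy_index idle_index index_unique unfolding idle_def busy_def by (metis leD)

lemma idle_or_busy: "0 \<le> u \<Longrightarrow> (\<exists>j r. idle j u r) \<or> (\<exists>j r. busy j u r)"
  using ex_index unfolding idle_def busy_def by (metis not_le)

section \<open>Transitions of a path between two times\<close>

lemma idle_later:
  assumes "idle i v r" "st j \<le> ereal t" "ereal t \<le> ereal v" "st (Suc j) \<le> ereal v"
  shows "fr (Suc j) \<le> ereal v"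
proof -
  have "\<not> i < Suc j"
    using idle_index[OF assms(1)] start_mono[of "Suc i" "Suc j"] assms(4)
    by (meson Suc_leI leD order_trans)
  then have "Suc j \<le> i" by simp
  then show ?thesis
  proof (cases "Suc j = i")
    case True then show ?thesis using assms(1) by (simp add: idle_def)
  next
    case False
    then have "Suc (Suc j) \<le> i" using \<open>Suc j \<le> i\<close> by simp
    then show ?thesis using start_mono[of "Suc (Suc j)" i] free_le_start[of "Suc j"] idle_index[OF assms(1)]
      by (meson order_trans)
  qed
qed

lemma service_le:
  assumes "ereal t < st (Suc j)" "fr (Suc j) \<le> ereal v"
  shows "s (Suc j) \<le> v - t"
proof -
  have "ereal t + ereal (s (Suc j)) \<le> st (Suc j) + ereal (s (Suc j))"
    using assms(1) by (intro add_right_mono) simp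
  also have "\<dots> \<le> ereal v" using assms(2) by simp
  finally show ?thesis by simp
qed

lemma idle_step_idle:
  assumes "idle j t w" "t \<le> v" "0 \<le> t" "w + (n v - n t) < k"
  shows "idle j v (w + (n v - n t))"
proof -
  have nt: "n t \<le> n v" using mono assms by auto
  have tk: "tk j \<le> q + n t" using idle_index[OF assms(1)] taken_le by auto
  have w: "w + (n v - n t) = q + n v - tk j" using assms(1) nt tk by (simp add: idle_def)
  have "fr j \<le> ereal v" using assms(1,2) by (auto simp: idle_def intro: order_trans)
  moreover have "\<not> st (Suc j) \<le> ereal v" using start_Suc_le_iff[of j v] w assms(4) by simp
  ultimately show ?thesis using w by (auto simp: idle_def)
qed

text \<open>The arrivals reach the threshold, so a service starts after \<open>t\<close>; since the
  server is idle again at \<open>v\<close>, this service has also ended by then.\<close>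

lemma idle_step_served:
  assumes "idle j t w" "t \<le> v" "0 \<le> t" "k \<le> w + (n v - n t)" "idle i v r"
  shows "s (Suc j) \<le> v - t"
proof -
  have nt: "n t \<le> n v" using mono assms by auto
  have tk: "tk j \<le> q + n t" using idle_index[OF assms(1)] taken_le by auto
  have w: "w + (n v - n t) = q + n v - tk j" using assms(1) nt tk by (simp add: idle_def)
  have "fr j \<le> ereal v" using assms(1,2) by (auto simp: idle_def intro: order_trans)
  then have "st (Suc j) \<le> ereal v" using start_Suc_le_iff[of j v] w assms(4) by simp
  then have "fr (Suc j) \<le> ereal v"
    using idle_later[OF assms(5), of j t] idle_index[OF assms(1)] assms(2) by simp
  then show ?thesis using service_le idle_index[OF assms(1)] by blast
qed

lemma busy_step_busy:
  assumes "busy j t w" "t \<le> v" "0 \<le> t" "ereal v < fr j"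
  shows "busy j v (w + (n v - n t))"
proof -
  have nt: "n t \<le> n v" using mono assms by auto
  have tk: "tk j \<le> q + n t" using busy_index[OF assms(1)] taken_le by auto
  have w: "w + (n v - n t) = q + n v - tk j" using assms(1) nt tk by (simp add: busy_def)
  then show ?thesis using assms by (auto simp: busy_def intro: order_trans)
qed

lemma busy_step_idle:
  assumes "busy j t w" "t \<le> v" "0 \<le> t" "fr j \<le> ereal v" "n v = n t" "w < k"
  shows "idle j v w"
proof -
  have "\<not> st (Suc j) \<le> ereal v" using start_Suc_le_iff[of j v] assms by (simp add: busy_def)
  then show ?thesis using assms by (auto simp: idle_def busy_def)
qed

lemma busy_step_served:
  assumes "busy j t w" "t \<le> v" "0 \<le> t" "fr j \<le> ereal v" "n v = n t" "k \<le> w" "idle i v r"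
  shows "s (Suc j) \<le> v - t"
proof -
  have "st (Suc j) \<le> ereal v" using start_Suc_le_iff[of j v] assms by (simp add: busy_def)
  then have "fr (Suc j) \<le> ereal v"
    using idle_later[OF assms(7), of j t] busy_index[OF assms(1)] assms(2) by simp
  then show ?thesis using service_le busy_index[OF assms(1)] by blast
qed

lemma busy_back:
  assumes "busy j v r" "t \<le> v" "0 \<le> t" "st j \<le> ereal t"
  shows "busy j t (q + n t - tk j)" "r = q + n t - tk j + (n v - n t)"
proof -
  have nt: "n t \<le> n v" using mono assms by auto
  have tk: "tk j \<le> q + n t" using assms taken_le by auto
  show "r = q + n t - tk j + (n v - n t)" using nt tk assms(1) by (simp add: busy_def)
  show "busy j t (q + n t - tk j)"
    using assms le_less_trans[of "ereal t" "ereal v" "fr j"] by (simp add: busy_def)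
qed

text \<open>
  If a service that started after \<open>t\<close> ends by \<open>v\<close>, then it lasted at most \<open>v - t\<close>; its start needs
  an arrival if the server is idle at \<open>t\<close>, and the end of the current service otherwise.
\<close>

definition double_event :: "real \<Rightarrow> real \<Rightarrow> bool" where
  "double_event t v \<longleftrightarrow> 2 \<le> n v - n t \<or>
    (\<exists>j r. busy j t r \<and> fr j \<le> ereal v \<and> 1 \<le> n v - n t) \<or>
    (\<exists>j r. busy j t r \<and> fr j \<le> ereal v \<and> s (Suc j) \<le> v - t) \<or>
    (\<exists>j r. idle j t r \<and> 1 \<le> n v - n t \<and> s (Suc j) \<le> v - t)"

text \<open>From an idle state, a start in between would require an arrival and, for the server to
  be idle at \<open>v\<close>, a short service. From a busy state, the current service must end, and
  then neither an arrival nor a further short service is left. As \<open>r < k\<close>, the arrival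
  that leads from \<open>r - 1\<close> to \<open>r\<close> starts no service.\<close>

lemma idle_one_step:
  assumes "0 \<le> t" "t \<le> v" "r < k" "\<not> double_event t v"
  shows "(\<exists>j. idle j v r) \<longleftrightarrow>
    (\<exists>j. idle j t r) \<and> n v - n t = 0 \<or>
    (1 \<le> r \<and> (\<exists>j. idle j t (r - 1)) \<and> n v - n t = 1) \<or>
    (\<exists>j. busy j t r \<and> fr j \<le> ereal v \<and> n v - n t = 0)"
    (is "?L \<longleftrightarrow> ?R")
proof
  have nt: "n t \<le> n v" using mono assms by auto
  assume ?L
  then obtain i where i: "idle i v r" by blast
  show ?R
  proof (cases "\<exists>j w. idle j t w")
    case True
    then obtain j w where j: "idle j t w" by blast
    show ?thesis
    proof (cases "w + (n v - n t) < k")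
      case True
      then have "r = w + (n v - n t)" using idle_step_idle[OF j] assms idle_unique[OF i] by blast
      moreover have "n v - n t < 2" using assms(4) by (auto simp: double_event_def)
      ultimately consider "n v - n t = 0" "r = w" | "n v - n t = 1" "w = r - 1" "1 \<le> r" by linarith
      then show ?thesis using j by cases auto
    next
      case False
      then have "s (Suc j) \<le> v - t" using idle_step_served[OF j] i assms by auto
      moreover have "1 \<le> n v - n t" using False idle_less[OF j] by simp
      ultimately show ?thesis using assms(4) j unfolding double_event_def by blast
    qed
  next
    case False
    then obtain j w where j: "busy j t w" using idle_or_busy assms by blast
    have fr: "fr j \<le> ereal v"
      using busy_step_busy[OF j] idle_not_busy[OF i] assms not_le by blast
    then have n: "n v = n t" using assms(4) j nt unfolding double_event_def by force
    show ?thesis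
    proof (cases "w < k")
      case True
      then show ?thesis using busy_step_idle[OF j] fr n assms i j idle_unique by (metis diff_self_eq_0)
    next
      case False
      then have "s (Suc j) \<le> v - t" using busy_step_served[OF j] fr n assms i by auto
      then show ?thesis using assms(4) j fr unfolding double_event_def by blast
    qed
  qed
next
  have nt: "n t \<le> n v" using mono assms by auto
  assume ?R
  then consider (a) j where "idle j t r" "n v - n t = 0"
    | (b) j where "1 \<le> r" "idle j t (r - 1)" "n v - n t = 1"
    | (c) j where "busy j t r" "fr j \<le> ereal v" "n v - n t = 0" by blast
  then show ?L
  proof cases
    case a then show ?thesis using idle_step_idle[OF a(1), of v] assms(1-3) by (metis add_0_right)
  next
    case b
    have "r - 1 + (n v - n t) = r" using b by simp
    then show ?thesis using idle_step_idle[OF b(2), of v] assms(1-3) by metis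
  next
    case c
    have "n v = n t" using c(3) nt by simp
    then show ?thesis using busy_step_idle[OF c(1)] c(2) assms(1-3) by blast
  qed
qed

lemma state_eq_iff:
  shows busy_eq_iff: "busy j u w \<Longrightarrow> (\<exists>i. busy i u r) \<longleftrightarrow> r = w"
    and not_idle_if_busy: "busy j u w \<Longrightarrow> \<not> (\<exists>i. idle i u r)"
    and idle_eq_iff: "idle j u w \<Longrightarrow> (\<exists>i. idle i u r) \<longleftrightarrow> r = w"
    and not_busy_if_idle: "idle j u w \<Longrightarrow> \<not> (\<exists>i. busy i u r)"
  by (blast dest: busy_unique idle_unique idle_not_busy)+

lemma busy_unchanged:
  assumes "0 \<le> t" "t \<le> v" "n v = n t" "\<not> (\<exists>j r. busy j t r \<and> fr j \<le> ereal v)"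
  shows "(\<exists>j. busy j v r) \<longleftrightarrow> (\<exists>j. busy j t r)" "(\<exists>j. idle j v r) \<longleftrightarrow> (\<exists>j. idle j t r)"
proof -
  consider (b) j w where "busy j t w" | (i) j w where "idle j t w"
    using idle_or_busy[OF assms(1)] by blast
  then have "(\<exists>j. busy j v r) = (\<exists>j. busy j t r) \<and> (\<exists>j. idle j v r) = (\<exists>j. idle j t r)"
  proof cases
    case b
    have "ereal v < fr j" using assms(4) b not_le by blast
    then have "busy j v w" using busy_step_busy[OF b assms(2,1)] assms(3) by simp
    then show ?thesis using b busy_eq_iff not_idle_if_busy by metis
  next
    case i
    have "idle j v w" using idle_step_idle[OF i assms(2,1)] idle_less[OF i] assms(3) by simp
    then show ?thesis using i idle_eq_iff not_busy_if_idle by metis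
  qed
  then show "(\<exists>j. busy j v r) \<longleftrightarrow> (\<exists>j. busy j t r)" "(\<exists>j. idle j v r) \<longleftrightarrow> (\<exists>j. idle j t r)"
    by blast+
qed

end

section \<open>Measurability of the service cycles\<close>

text \<open>For every \<open>v \<le> t\<close> the two starts compare with \<open>v\<close> in the
  same way, because this depends only on the count at \<open>v\<close>. Two values with the same
  comparisons up to \<open>t\<close>, one of which is at most \<open>t\<close>, are equal.\<close>

lemma first_start_cong_le:
  assumes "counting_path n" "counting_path n'" "\<And>u. 0 \<le> u \<Longrightarrow> u \<le> t \<Longrightarrow> n u = n' u"
    and "0 \<le> fst fc" "first_start k q n fc \<le> ereal t"
  shows "first_start k q n' fc = first_start k q n fc"
proof -
  let ?a = "first_start k q n fc" and ?b = "first_start k q n' fc"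
  interpret n: counting_path n by fact
  interpret n': counting_path n' by fact
  have iff: "?a \<le> ereal v \<longleftrightarrow> ?b \<le> ereal v" if "v \<le> t" for v
  proof (cases "0 \<le> v")
    case True
    then show ?thesis
      using assms(3)[of v] that
      by (simp add: n.first_start_le_iff[OF assms(4)] n'.first_start_le_iff[OF assms(4)])
  next
    case False
    then have "\<not> fst fc \<le> ereal v" using assms(4) by (metis ereal_less_eq(5) order_trans)
    then show ?thesis
      by (simp add: n.first_start_le_iff[OF assms(4)] n'.first_start_le_iff[OF assms(4)])
  qed
  have nonneg: "0 \<le> ?a" "0 \<le> ?b" using assms(4) first_start_ge order_trans by blast+
  have bt: "?b \<le> ereal t" using iff[of t] assms(5) by simp
  obtain x where x: "?a = ereal x" using nonneg assms(5) by (cases ?a) auto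
  obtain y where y: "?b = ereal y" using nonneg bt by (cases ?b) auto
  show ?thesis using iff[of x] iff[of y] x y assms(5) bt by simp
qed

text \<open>The invariant has to give up equality beyond \<open>t\<close>, where the two paths may
  differ. Knowing that both starts exceed \<open>t\<close> is enough, since a state at
  \<open>t\<close> belongs to a cycle that has started by \<open>t\<close>.\<close>

lemma cyc_stopped:
  assumes "service_path n k B s" "service_path n' k B s" "\<And>u. 0 \<le> u \<Longrightarrow> u \<le> t \<Longrightarrow> n u = n' u"
  shows "(cyc_start k B q b n s j = cyc_start k B q b n' s j \<and> cyc k B q b n s j = cyc k B q b n' s j)
    \<or> (ereal t < cyc_start k B q b n s j \<and> ereal t < cyc_start k B q b n' s j)"
proof -
  interpret n: service_path n k B q b s by fact
  interpret n': service_path n' k B q b s by fact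
  note cp = n.counting_path_axioms n'.counting_path_axioms
  show ?thesis
  proof (induction j)
    case (Suc j)
    then consider (e) "n.cy j = n'.cy j" | (l) "ereal t < n.st j" "ereal t < n'.st j" by blast
    then show ?case
    proof cases
      case l
      then show ?thesis
        using n.start_mono[of j "Suc j"] n'.start_mono[of j "Suc j"] by (auto dest: less_le_trans)
    next
      case e
      show ?thesis
      proof (cases "n.st (Suc j) \<le> ereal t \<or> n'.st (Suc j) \<le> ereal t")
        case True
        then have st: "n.st (Suc j) = n'.st (Suc j)"
        proof
          assume "n.st (Suc j) \<le> ereal t"
          then show ?thesis
            using first_start_cong_le[OF cp assms(3) n.free_nonneg, of t k q j] e by simp
        next
          assume "n'.st (Suc j) \<le> ereal t"
          then show ?thesis
            using first_start_cong_le[OF cp(2,1) assms(3)[symmetric] n'.free_nonneg, of t k q j] e by simp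
        qed
        define x where "x = real_of_ereal (n.st (Suc j))"
        have "0 \<le> ereal x" "ereal x \<le> ereal t"
          using n.start_nonneg[of "Suc j"] n.start_real[of "Suc j" t] st True
          unfolding x_def by auto
        then have "n x = n' x" using assms(3) by simp
        then show ?thesis using st e x_def by simp
      qed auto
    qed
  qed simp
qed

text \<open>Monotonicity and right-continuity replace the random time by slightly later rational
  times, which leaves a countable union.\<close>

lemma measurable_random_index:
  fixes N :: "real \<Rightarrow> 'a \<Rightarrow> nat"
  assumes [measurable]: "\<And>u. 0 \<le> u \<Longrightarrow> N u \<in> measurable M (count_space UNIV)"
    and [measurable]: "g \<in> borel_measurable M"
    and path: "\<And>\<omega>. \<omega> \<in> space M \<Longrightarrow> counting_path (\<lambda>u. N u \<omega>)"
    and nonneg: "\<And>\<omega>. \<omega> \<in> space M \<Longrightarrow> 0 \<le> g \<omega>"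
  shows "(\<lambda>\<omega>. N (g \<omega>) \<omega>) \<in> measurable M (count_space UNIV)"
proof -
  \<comment> \<open>\<open>max 0\<close> keeps the rational index in the range where
    \<open>N\<close> is known to be measurable; it changes nothing once \<open>z\<close> exceeds the
    nonnegative \<open>g \<omega>\<close>.\<close>
  have le: "N (g \<omega>) \<omega> \<le> m \<longleftrightarrow> (\<exists>z::rat. g \<omega> < of_rat z \<and> N (max 0 (of_rat z)) \<omega> \<le> m)"
    if \<omega>: "\<omega> \<in> space M" for \<omega> m
  proof -
    interpret counting_path "\<lambda>u. N u \<omega>" by (rule path) fact
    show ?thesis
    proof
      assume le: "N (g \<omega>) \<omega> \<le> m"
      obtain z where z: "g \<omega> < z" "\<And>y. g \<omega> \<le> y \<Longrightarrow> y < z \<Longrightarrow> N y \<omega> = N (g \<omega>) \<omega>"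
        using constant_right[OF nonneg[OF \<omega>]] by blast
      obtain x :: rat where x: "g \<omega> < of_rat x" "of_rat x < z" using of_rat_dense[OF z(1)] by blast
      then have "max 0 (real_of_rat x) = of_rat x" using nonneg[OF \<omega>] by simp
      then have "N (max 0 (of_rat x)) \<omega> \<le> m" using z(2)[of "of_rat x"] x le by simp
      with x show "\<exists>z::rat. g \<omega> < of_rat z \<and> N (max 0 (of_rat z)) \<omega> \<le> m" by blast
    next
      assume "\<exists>z::rat. g \<omega> < of_rat z \<and> N (max 0 (of_rat z)) \<omega> \<le> m"
      then obtain z :: rat where "g \<omega> < of_rat z" "N (max 0 (of_rat z)) \<omega> \<le> m" by blast
      then show "N (g \<omega>) \<omega> \<le> m" using mono[OF nonneg[OF \<omega>], of "max 0 (of_rat z)"] by linarith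
    qed
  qed
  have [measurable]: "N (max 0 x) \<in> measurable M (count_space UNIV)" for x by measurable
  have pred: "Measurable.pred M (\<lambda>\<omega>. N (g \<omega>) \<omega> \<le> m)" for m
    by (subst measurable_cong[OF le], assumption) measurable
  have eq: "N (g \<omega>) \<omega> = m \<longleftrightarrow> N (g \<omega>) \<omega> \<le> m \<and> (\<forall>l<m. \<not> N (g \<omega>) \<omega> \<le> l)" for \<omega> m
    by (metis leD leI order_refl order_less_le)
  have "Measurable.pred M (\<lambda>\<omega>. N (g \<omega>) \<omega> = m)" for m
    unfolding eq using pred by measurable
  then have "{\<omega> \<in> space M. N (g \<omega>) \<omega> = m} \<in> sets M" for m
    unfolding pred_def .
  then show ?thesis
    by (simp add: measurable_count_space_eq2_countable vimage_def Int_def conj_commute)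
qed

text \<open>The infimum over uncountably many times is harmless: by
  \<open>first_start_le_iff\<close> its sublevel set at a real \<open>u\<close> is an event about
  the fixed time \<open>u\<close>.\<close>

lemma measurable_first_start:
  fixes N :: "real \<Rightarrow> 'a \<Rightarrow> nat"
  assumes [measurable]: "\<And>u. 0 \<le> u \<Longrightarrow> N u \<in> measurable M (count_space UNIV)"
    and [measurable]: "Q \<in> measurable M (count_space UNIV)"
    and [measurable]: "f \<in> borel_measurable M" "c \<in> measurable M (count_space UNIV)"
    and path: "\<And>\<omega>. \<omega> \<in> space M \<Longrightarrow> counting_path (\<lambda>u. N u \<omega>)"
    and nonneg: "\<And>\<omega>. \<omega> \<in> space M \<Longrightarrow> 0 \<le> f \<omega>"
  shows "(\<lambda>\<omega>. first_start k (Q \<omega>) (\<lambda>u. N u \<omega>) (f \<omega>, c \<omega>)) \<in> borel_measurable M"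
proof (subst borel_measurable_iff_Iic_ereal, intro allI)
  fix a :: ereal
  let ?g = "\<lambda>\<omega>. first_start k (Q \<omega>) (\<lambda>u. N u \<omega>) (f \<omega>, c \<omega>)"
  have ge: "0 \<le> ?g \<omega>" if "\<omega> \<in> space M" for \<omega>
    using first_start_ge[of "(f \<omega>, c \<omega>)"] nonneg[OF that] order_trans by fastforce
  consider (neg) "a < 0" | (inf) "a = \<infinity>" | (real) u where "a = ereal u" "0 \<le> u"
    by (cases a) (auto simp: not_le[symmetric])
  then show "?g -` {..a} \<inter> space M \<in> sets M"
  proof cases
    case neg
    then have "?g -` {..a} \<inter> space M = {}" using ge by (auto dest: le_less_trans simp: not_le[symmetric])
    then show ?thesis by simp
  next
    case inf
    then have "{..a} = UNIV" by auto
    then show ?thesis by simp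
  next
    case (real u)
    have "?g -` {..a} \<inter> space M = {\<omega> \<in> space M. f \<omega> \<le> ereal u \<and> k \<le> Q \<omega> + N u \<omega> - c \<omega>}"
      using counting_path.first_start_le_iff[OF path] nonneg real(1) by auto
    also have "\<dots> \<in> sets M" using real(2) by measurable
    finally show ?thesis .
  qed
qed

text \<open>The sigma-algebra, the arrivals and the service times are arbitrary, so that the lemma
  also applies to a history in which the arrivals are stopped or the later service times are
  replaced.\<close>

lemma measurable_cyc:
  fixes N :: "real \<Rightarrow> 'a \<Rightarrow> nat"
  assumes N: "\<And>u. 0 \<le> u \<Longrightarrow> N u \<in> measurable M (count_space UNIV)"
    and Q[measurable]: "Q \<in> measurable M (count_space UNIV)"
    and b[measurable]: "Measurable.pred M b"
    and S[measurable]: "\<And>j. S j \<in> borel_measurable M"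
    and path: "\<And>\<omega>. \<omega> \<in> space M \<Longrightarrow> service_path (\<lambda>u. N u \<omega>) k B (\<lambda>j. S j \<omega>)"
  shows measurable_free: "(\<lambda>\<omega>. fst (cyc k B (Q \<omega>) (b \<omega>) (\<lambda>u. N u \<omega>) (\<lambda>j. S j \<omega>) j)) \<in> borel_measurable M"
    and measurable_taken: "(\<lambda>\<omega>. snd (cyc k B (Q \<omega>) (b \<omega>) (\<lambda>u. N u \<omega>) (\<lambda>j. S j \<omega>) j)) \<in> measurable M (count_space UNIV)"
    and measurable_start: "(\<lambda>\<omega>. cyc_start k B (Q \<omega>) (b \<omega>) (\<lambda>u. N u \<omega>) (\<lambda>j. S j \<omega>) j) \<in> borel_measurable M"
proof -
  let ?c = "\<lambda>j \<omega>. cyc k B (Q \<omega>) (b \<omega>) (\<lambda>u. N u \<omega>) (\<lambda>j. S j \<omega>) j"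
  let ?st = "\<lambda>j \<omega>. cyc_start k B (Q \<omega>) (b \<omega>) (\<lambda>u. N u \<omega>) (\<lambda>j. S j \<omega>) j"
  have cp: "counting_path (\<lambda>u. N u \<omega>)" if "\<omega> \<in> space M" for \<omega>
    using path[OF that] service_path.axioms by blast
  have st_Suc: "?st (Suc j) \<in> borel_measurable M"
    if "(\<lambda>\<omega>. fst (?c j \<omega>)) \<in> borel_measurable M" "(\<lambda>\<omega>. snd (?c j \<omega>)) \<in> measurable M (count_space UNIV)" for j
    using measurable_first_start[OF N Q that cp service_path.free_nonneg[OF path], of k] by simp
  have main: "(\<lambda>\<omega>. fst (?c j \<omega>)) \<in> borel_measurable M \<and> (\<lambda>\<omega>. snd (?c j \<omega>)) \<in> measurable M (count_space UNIV)" for j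
  proof (induction j)
    case 0
    show ?case by simp
  next
    case (Suc j)
    then have st: "?st (Suc j) \<in> borel_measurable M"
      and tk: "(\<lambda>\<omega>. snd (?c j \<omega>)) \<in> measurable M (count_space UNIV)" using st_Suc by blast+
    have N': "(\<lambda>\<omega>. N (real_of_ereal (?st (Suc j) \<omega>)) \<omega>) \<in> measurable M (count_space UNIV)"
      by (rule measurable_random_index[OF N borel_measurable_real_of_ereal[OF st] cp])
        (auto intro!: real_of_ereal_pos service_path.start_nonneg path simp del: cyc_start_simps)
    have add: "(\<lambda>\<omega>. g \<omega> + ereal (h \<omega>)) \<in> borel_measurable M"
      if [measurable]: "g \<in> borel_measurable M" "h \<in> borel_measurable M" for g h
      by measurable
    have count: "(\<lambda>\<omega>. c \<omega> + min B (Q \<omega> + m \<omega> - c \<omega>)) \<in> measurable M (count_space UNIV)"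
      if [measurable]: "c \<in> measurable M (count_space UNIV)" "m \<in> measurable M (count_space UNIV)" for c m
      by measurable
    show ?case using add[OF st S] count[OF tk N']
      by (simp only: cyc.simps cyc_start_simps fst_conv snd_conv simp_thms)
  qed
  then show "(\<lambda>\<omega>. fst (?c j \<omega>)) \<in> borel_measurable M"
    "(\<lambda>\<omega>. snd (?c j \<omega>)) \<in> measurable M (count_space UNIV)" by blast+
  show "?st j \<in> borel_measurable M"
    using main st_Suc by (cases j) auto
qed

section \<open>Independence of the past\<close>

lemma measurable_enlarge:
  assumes "f \<in> measurable L K" "space L = space M" "sets L \<subseteq> sets M"
  shows "f \<in> measurable M K"
proof (rule measurableI)
  show "f x \<in> space K" if "x \<in> space M" for x
    using measurable_space[OF assms(1)] that assms(2) by simp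
  show "f -` A \<inter> space M \<in> sets M" if "A \<in> sets K" for A
    using measurable_sets[OF assms(1) that] assms(2,3) by auto
qed

context poisson_arrivals
begin

text \<open>Finite-dimensional events form a pi-system, on which independence concerns only finitely
  many increments. Taking \<open>U\<close> empty gives the whole space.\<close>

definition arrival_cylinders :: "real set \<Rightarrow> 'a set set" where
  "arrival_cylinders T =
    {{\<omega> \<in> space M. \<forall>u\<in>U. N u \<omega> \<in> C u} | U C. finite U \<and> U \<subseteq> T}"

lemma counting_path: "\<omega> \<in> space M \<Longrightarrow> counting_path (\<lambda>u. N u \<omega>)"
  using N_mono N_right_continuous by unfold_locales auto

text \<open>Along a finite grid ending in \<open>t\<close> and \<open>v\<close>, the counts up to
  \<open>t\<close> are sums of increments that all precede the last one,
  \<open>N v - N t\<close>.\<close>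

lemma prob_cylinder_increment:
  assumes "0 \<le> t" "t \<le> v" "E \<in> arrival_cylinders {0..t}"
  shows "prob (E \<inter> {\<omega> \<in> space M. N v \<omega> - N t \<omega> \<in> \<Delta>}) =
    prob E * prob {\<omega> \<in> space M. N v \<omega> - N t \<omega> \<in> \<Delta>}"
proof -
  obtain U C where E: "E = {\<omega> \<in> space M. \<forall>u\<in>U. N u \<omega> \<in> C u}" and U: "finite U" "U \<subseteq> {0..t}"
    using assms(3) unfolding arrival_cylinders_def by blast
  \<comment> \<open>Time 0 makes every count a sum of increments, as \<open>N 0 = 0\<close>; time
    \<open>t\<close> makes the next increment start exactly at \<open>t\<close>.\<close>
  define V where "V = insert 0 (insert t U)"
  have V: "finite V" "V \<subseteq> {0..t}" "0 \<in> V" "t \<in> V" using U assms by (auto simp: V_def)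
  define l where "l = sorted_list_of_set V"
  have l: "set l = V" "sorted l" using V by (simp_all add: l_def)
  define m where "m = length l - 1"
  have "l \<noteq> []" using l V by auto
  then have len: "length l = Suc m" by (simp add: m_def)
  \<comment> \<open>The independence assumption speaks of infinite sequences, so the grid is
    continued by the constant \<open>v\<close>. Increment number \<open>m\<close> is then
    \<open>N v - N t\<close>, and all later ones vanish.\<close>
  define \<tau> where "\<tau> i = (if i < length l then l ! i else v)" for i
  have \<tau>V: "\<tau> i \<in> V" if "i \<le> m" for i using that l len by (auto simp: \<tau>_def)
  have inc: "incseq \<tau>"
  proof (rule monoI)
    fix x y :: nat assume "x \<le> y"
    moreover have "l ! x \<le> v" if "x < length l"
      using \<tau>V[of x] that len V(2) assms(2) by (auto simp: \<tau>_def)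
    ultimately show "\<tau> x \<le> \<tau> y" using sorted_nth_mono[OF l(2)] by (auto simp: \<tau>_def)
  qed
  have surj: "\<exists>i\<le>m. \<tau> i = u" if "u \<in> V" for u
    using that l(1) len by (metis \<tau>_def in_set_conv_nth less_Suc_eq_le)
  have \<tau>0: "\<tau> 0 = 0"
  proof -
    obtain i where "i \<le> m" "\<tau> i = 0" using surj V by blast
    then show ?thesis using incseqD[OF inc, of 0 i] \<tau>V[of 0] V(2) by fastforce
  qed
  have \<tau>m: "\<tau> m = t"
  proof -
    obtain i where "i \<le> m" "\<tau> i = t" using surj V by blast
    then show ?thesis using incseqD[OF inc, of i m] \<tau>V[of m] V(2) by fastforce
  qed
  have \<tau>Sm: "\<tau> (Suc m) = v" using len by (simp add: \<tau>_def)
  let ?X = "\<lambda>i \<omega>. N (\<tau> (Suc i)) \<omega> - N (\<tau> i) \<omega>"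
  have "indep_vars (\<lambda>_. count_space UNIV) ?X UNIV"
    using N_indep_increments[of \<tau>] \<tau>0 inc by simp
  then have ind: "indep_var (PiM {..<m} (\<lambda>_. count_space UNIV)) (\<lambda>\<omega>. \<lambda>i\<in>{..<m}. ?X i \<omega>)
      (PiM {m} (\<lambda>_. count_space UNIV)) (\<lambda>\<omega>. \<lambda>i\<in>{m}. ?X i \<omega>)"
    by (rule indep_var_restrict) auto
  have sum: "N (\<tau> i) \<omega> = (\<Sum>l<i. ?X l \<omega>)" if "\<omega> \<in> space M" "i \<le> m" for i \<omega>
    using that(2)
  proof (induction i)
    case 0 then show ?case using \<tau>0 N_zero[OF that(1)] by simp
  next
    case (Suc i)
    have "0 \<le> \<tau> i" using \<tau>V[of i] V(2) Suc.prems by auto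
    then have "N (\<tau> i) \<omega> \<le> N (\<tau> (Suc i)) \<omega>"
      using N_mono[OF that(1)] incseqD[OF inc, of i "Suc i"] by simp
    then show ?case using Suc by simp
  qed
  define Xa where "Xa = {x \<in> space (PiM {..<m} (\<lambda>_. count_space (UNIV :: nat set))).
    \<forall>i\<le>m. \<tau> i \<in> U \<longrightarrow> (\<Sum>l<i. x l) \<in> C (\<tau> i)}"
  define Xb where "Xb = {x \<in> space (PiM {m} (\<lambda>_. count_space (UNIV :: nat set))). x m \<in> \<Delta>}"
  have Xa: "Xa \<in> sets (PiM {..<m} (\<lambda>_. count_space UNIV))"
  proof -
    have *: "{x \<in> space (PiM {..<m} (\<lambda>_. count_space (UNIV :: nat set))). \<tau> i \<in> U \<longrightarrow> (\<Sum>l<i. x l) \<in> C (\<tau> i)}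
        \<in> sets (PiM {..<m} (\<lambda>_. count_space UNIV))" if "i \<in> {..m}" for i
    proof -
      have "(\<lambda>x. \<Sum>l<i. x l) \<in> measurable (PiM {..<m} (\<lambda>_. count_space (UNIV :: nat set))) (count_space UNIV)"
        by (intro measurable_sum_nat measurable_component_singleton) (use that in auto)
      from measurable_sets[OF this, of "{y. \<tau> i \<in> U \<longrightarrow> y \<in> C (\<tau> i)}"] show ?thesis
        by (simp add: vimage_def Int_def conj_commute)
    qed
    have "Xa = (\<Inter>i\<in>{..m}. {x \<in> space (PiM {..<m} (\<lambda>_. count_space (UNIV :: nat set))). \<tau> i \<in> U \<longrightarrow> (\<Sum>l<i. x l) \<in> C (\<tau> i)})"
      unfolding Xa_def by auto
    also have "\<dots> \<in> sets (PiM {..<m} (\<lambda>_. count_space UNIV))"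
      by (rule sets.finite_INT) (use * in auto)
    finally show ?thesis .
  qed
  have Xb: "Xb \<in> sets (PiM {m} (\<lambda>_. count_space UNIV))"
    unfolding Xb_def by measurable
  have 1: "(\<lambda>\<omega>. \<lambda>i\<in>{..<m}. ?X i \<omega>) -` Xa \<inter> space M = E"
  proof -
    have "(\<lambda>i\<in>{..<m}. ?X i \<omega>) \<in> Xa \<longleftrightarrow> (\<forall>u\<in>U. N u \<omega> \<in> C u)" if w: "\<omega> \<in> space M" for \<omega>
    proof -
      have "(\<lambda>i\<in>{..<m}. ?X i \<omega>) \<in> Xa \<longleftrightarrow> (\<forall>i\<le>m. \<tau> i \<in> U \<longrightarrow> (\<Sum>l<i. ?X l \<omega>) \<in> C (\<tau> i))"
        unfolding Xa_def by (auto simp: space_PiM)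
      also have "\<dots> \<longleftrightarrow> (\<forall>i\<le>m. \<tau> i \<in> U \<longrightarrow> N (\<tau> i) \<omega> \<in> C (\<tau> i))"
        by (auto simp: sum[OF w, symmetric])
      also have "\<dots> \<longleftrightarrow> (\<forall>u\<in>U. N u \<omega> \<in> C u)" using surj by (auto simp: V_def)
      finally show ?thesis .
    qed
    then show ?thesis unfolding E by auto
  qed
  have 2: "(\<lambda>\<omega>. \<lambda>i\<in>{m}. ?X i \<omega>) -` Xb \<inter> space M = {\<omega> \<in> space M. N v \<omega> - N t \<omega> \<in> \<Delta>}"
    unfolding Xb_def by (auto simp: \<tau>m \<tau>Sm space_PiM)
  have 3: "(\<lambda>x. (\<lambda>i\<in>{..<m}. ?X i x, \<lambda>i\<in>{m}. ?X i x)) -` (Xa \<times> Xb) \<inter> space M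
      = E \<inter> {\<omega> \<in> space M. N v \<omega> - N t \<omega> \<in> \<Delta>}"
    unfolding 1[symmetric] 2[symmetric] by auto
  show ?thesis using indep_varD[OF ind Xa Xb] unfolding 1 2 3 .
qed

end

context bulk_service_queue
begin

definition service_cylinders :: "nat set \<Rightarrow> 'a set set" where
  "service_cylinders J =
    {{\<omega> \<in> space M. \<forall>i\<in>I. S i \<omega> \<in> C i} | I C. finite I \<and> I \<subseteq> J \<and> (\<forall>i\<in>I. C i \<in> sets borel)}"

abbreviation "arrival_algebra \<equiv>
  vimage_algebra (space M) (\<lambda>\<omega>. \<lambda>t\<in>{0..}. N t \<omega>) (Pi\<^sub>M {0..} (\<lambda>_. count_space UNIV))"

abbreviation "service_algebra \<equiv>
  vimage_algebra (space M) (\<lambda>\<omega> j. S j \<omega>) (Pi\<^sub>M UNIV (\<lambda>_. borel))"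

abbreviation "init_algebra \<equiv>
  vimage_algebra (space M) (\<lambda>\<omega>. (Q0 \<omega>, busy0 \<omega>, X0 \<omega>))
    (count_space UNIV \<Otimes>\<^sub>M count_space UNIV \<Otimes>\<^sub>M borel)"

lemma algebra_subset_events:
  "sets arrival_algebra \<subseteq> events" "sets service_algebra \<subseteq> events" "sets init_algebra \<subseteq> events"
proof -
  let ?F = "\<lambda>i. sets ([arrival_algebra, service_algebra, init_algebra] ! i)"
  have F: "?F i \<subseteq> events" if "i < 3" for i
    using independence that unfolding indep_sets_def by blast
  have "?F 0 \<subseteq> events" "?F 1 \<subseteq> events" "?F 2 \<subseteq> events"
    by (rule F, simp)+
  then show "sets arrival_algebra \<subseteq> events" "sets service_algebra \<subseteq> events" "sets init_algebra \<subseteq> events"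
    by (simp_all add: numeral_2_eq_2)
qed

lemma prob_product:
  assumes "E \<in> sets arrival_algebra" "F \<in> sets service_algebra" "G \<in> sets init_algebra"
  shows "prob (E \<inter> F \<inter> G) = prob E * prob F * prob G"
proof -
  let ?A = "\<lambda>i::nat. [E, F, G] ! i"
  have "prob (\<Inter>j\<in>{..<3}. ?A j) = (\<Prod>j\<in>{..<3}. prob (?A j))"
    by (rule indep_setsD[OF independence]) (use assms in \<open>auto simp: less_Suc_eq numeral_3_eq_3\<close>)
  moreover have "{..<3::nat} = {0, 1, 2}" by auto
  ultimately show ?thesis by (simp add: Int_assoc mult.assoc)
qed

lemma measurable_arrival: "0 \<le> u \<Longrightarrow> N u \<in> measurable arrival_algebra (count_space UNIV)"
proof -
  assume u: "0 \<le> u"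
  have "(\<lambda>\<omega>. \<lambda>t\<in>{0..}. N t \<omega>) \<in> measurable arrival_algebra (Pi\<^sub>M {0..} (\<lambda>_. count_space UNIV))"
    by (rule measurable_vimage_algebra1) (auto simp: space_PiM)
  then have "(\<lambda>\<omega>. (\<lambda>t\<in>{0..}. N t \<omega>) u) \<in> measurable arrival_algebra (count_space UNIV)"
    by (rule measurable_compose) (use u in \<open>auto intro!: measurable_component_singleton\<close>)
  then show ?thesis using u by simp
qed

lemma measurable_service: "S i \<in> borel_measurable service_algebra"
proof -
  have "(\<lambda>\<omega> j. S j \<omega>) \<in> measurable service_algebra (Pi\<^sub>M UNIV (\<lambda>_. borel))"
    by (rule measurable_vimage_algebra1) (auto simp: space_PiM)
  then have "(\<lambda>\<omega>. (\<lambda>j. S j \<omega>) i) \<in> borel_measurable service_algebra"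
    by (rule measurable_compose) (auto intro!: measurable_component_singleton)
  then show ?thesis by simp
qed

lemma measurable_init:
  "Q0 \<in> measurable init_algebra (count_space UNIV)"
  "Measurable.pred init_algebra busy0"
  "X0 \<in> borel_measurable init_algebra"
proof -
  have m: "(\<lambda>\<omega>. (Q0 \<omega>, busy0 \<omega>, X0 \<omega>)) \<in>
      measurable init_algebra (count_space UNIV \<Otimes>\<^sub>M count_space UNIV \<Otimes>\<^sub>M borel)"
    by (rule measurable_vimage_algebra1) (auto simp: space_pair_measure)
  show "Q0 \<in> measurable init_algebra (count_space UNIV)"
    using measurable_compose[OF m measurable_fst] by simp
  show "Measurable.pred init_algebra busy0"
    using measurable_compose[OF measurable_compose[OF m measurable_snd] measurable_fst] by simp
  show "X0 \<in> borel_measurable init_algebra"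
    using measurable_compose[OF measurable_compose[OF m measurable_snd] measurable_snd] by simp
qed

lemma arrival_cylinders_sets: "T \<subseteq> {0..} \<Longrightarrow> arrival_cylinders T \<subseteq> sets arrival_algebra"
proof
  fix E assume T: "T \<subseteq> {0..}" and "E \<in> arrival_cylinders T"
  then obtain U C where E: "E = {\<omega> \<in> space M. \<forall>u\<in>U. N u \<omega> \<in> C u}" and U: "finite U" "U \<subseteq> {0..}"
    unfolding arrival_cylinders_def by blast
  have "{\<omega> \<in> space arrival_algebra. N u \<omega> \<in> C u} \<in> sets arrival_algebra" if "u \<in> U" for u
    using measurable_sets[OF measurable_arrival, of u "C u"] that U(2)
    by (auto simp: vimage_def Int_def conj_commute)
  then have "{\<omega> \<in> space arrival_algebra. \<forall>u\<in>U. N u \<omega> \<in> C u} \<in> sets arrival_algebra"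
    using U(1) by (rule sets.sets_Collect_finite_All)
  then show "E \<in> sets arrival_algebra" unfolding E by simp
qed

lemma service_cylinders_sets: "service_cylinders J \<subseteq> sets service_algebra"
proof
  fix E assume "E \<in> service_cylinders J"
  then obtain I C where E: "E = {\<omega> \<in> space M. \<forall>i\<in>I. S i \<omega> \<in> C i}"
    and I: "finite I" "\<And>i. i \<in> I \<Longrightarrow> C i \<in> sets borel"
    unfolding service_cylinders_def by blast
  have "{\<omega> \<in> space service_algebra. S i \<omega> \<in> C i} \<in> sets service_algebra" if "i \<in> I" for i
    using measurable_sets[OF measurable_service I(2)[OF that], of i]
    by (simp add: vimage_def Int_def conj_commute)
  then have "{\<omega> \<in> space service_algebra. \<forall>i\<in>I. S i \<omega> \<in> C i} \<in> sets service_algebra"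
    using I(1) by (rule sets.sets_Collect_finite_All)
  then show "E \<in> sets service_algebra" unfolding E by simp
qed

section \<open>Sigma-algebras of the past\<close>

definition history_rects :: "real set \<Rightarrow> nat set \<Rightarrow> 'a set set" where
  "history_rects T J = {E \<inter> F \<inter> G | E F G.
    E \<in> arrival_cylinders T \<and> F \<in> service_cylinders J \<and> G \<in> sets init_algebra}"

text \<open>Two instances carry the proof: \<open>history {0..t} UNIV\<close> is independent of the
  arrivals after \<open>t\<close>, and \<open>history {0..} {..<j}\<close> is independent of
  \<open>S j\<close>. The rectangles form a pi-system, so both facts need checking only
  there.\<close>

definition history :: "real set \<Rightarrow> nat set \<Rightarrow> 'a measure" where
  "history T J = sigma (space M) (history_rects T J)"

lemma Int_stable_arrival_cylinders: "Int_stable (arrival_cylinders T)"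
proof (rule Int_stableI)
  fix a b assume "a \<in> arrival_cylinders T" "b \<in> arrival_cylinders T"
  then obtain U C U' C' where
    a: "a = {\<omega> \<in> space M. \<forall>u\<in>U. N u \<omega> \<in> C u}" "finite U" "U \<subseteq> T" and
    b: "b = {\<omega> \<in> space M. \<forall>u\<in>U'. N u \<omega> \<in> C' u}" "finite U'" "U' \<subseteq> T"
    unfolding arrival_cylinders_def by blast
  define D where "D u = {x. (u \<in> U \<longrightarrow> x \<in> C u) \<and> (u \<in> U' \<longrightarrow> x \<in> C' u)}" for u
  have "a \<inter> b = {\<omega> \<in> space M. \<forall>u\<in>U \<union> U'. N u \<omega> \<in> D u}"
    unfolding a b D_def by auto
  moreover have "finite (U \<union> U')" "U \<union> U' \<subseteq> T" using a(2,3) b(2,3) by auto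
  ultimately show "a \<inter> b \<in> arrival_cylinders T"
    unfolding arrival_cylinders_def by blast
qed

lemma Int_stable_service_cylinders: "Int_stable (service_cylinders J)"
proof (rule Int_stableI)
  fix a b assume "a \<in> service_cylinders J" "b \<in> service_cylinders J"
  then obtain U C U' C' where
    a: "a = {\<omega> \<in> space M. \<forall>u\<in>U. S u \<omega> \<in> C u}" "finite U" "U \<subseteq> J" "\<And>i. i \<in> U \<Longrightarrow> C i \<in> sets borel" and
    b: "b = {\<omega> \<in> space M. \<forall>u\<in>U'. S u \<omega> \<in> C' u}" "finite U'" "U' \<subseteq> J" "\<And>i. i \<in> U' \<Longrightarrow> C' i \<in> sets borel"
    unfolding service_cylinders_def by blast
  define D where "D u = (if u \<in> U then C u else UNIV) \<inter> (if u \<in> U' then C' u else UNIV)" for u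
  have "a \<inter> b = {\<omega> \<in> space M. \<forall>u\<in>U \<union> U'. S u \<omega> \<in> D u}"
    unfolding a b D_def by auto
  moreover have "\<forall>i\<in>U \<union> U'. D i \<in> sets borel" unfolding D_def using a(4) b(4) by auto
  moreover have "finite (U \<union> U')" "U \<union> U' \<subseteq> J" using a b by auto
  ultimately show "a \<inter> b \<in> service_cylinders J"
    unfolding service_cylinders_def by blast
qed

lemma Int_stable_history_rects: "Int_stable (history_rects T J)"
proof (rule Int_stableI)
  fix a b assume "a \<in> history_rects T J" "b \<in> history_rects T J"
  then obtain E F G E' F' G' where
    ab: "a = E \<inter> F \<inter> G" "b = E' \<inter> F' \<inter> G'" and
    m: "E \<in> arrival_cylinders T" "F \<in> service_cylinders J" "G \<in> sets init_algebra"
      "E' \<in> arrival_cylinders T" "F' \<in> service_cylinders J" "G' \<in> sets init_algebra"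
    unfolding history_rects_def by blast
  have "a \<inter> b = (E \<inter> E') \<inter> (F \<inter> F') \<inter> (G \<inter> G')" using ab by blast
  moreover have "E \<inter> E' \<in> arrival_cylinders T" "F \<inter> F' \<in> service_cylinders J" "G \<inter> G' \<in> sets init_algebra"
    using m Int_stableD[OF Int_stable_arrival_cylinders] Int_stableD[OF Int_stable_service_cylinders] by auto
  ultimately show "a \<inter> b \<in> history_rects T J" unfolding history_rects_def by blast
qed

lemma space_in_cylinders: "space M \<in> arrival_cylinders T" "space M \<in> service_cylinders J"
proof -
  show "space M \<in> arrival_cylinders T"
    unfolding arrival_cylinders_def by (rule CollectI, rule exI[of _ "{}"]) auto
  show "space M \<in> service_cylinders J"
    unfolding service_cylinders_def by (rule CollectI, rule exI[of _ "{}"]) auto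
qed

lemma space_in_init: "space M \<in> sets init_algebra"
  by (rule sets_vimage_algebra_space)

lemma arrival_subset: "E \<in> arrival_cylinders T \<Longrightarrow> E \<subseteq> space M"
  unfolding arrival_cylinders_def by auto

lemma service_subset: "E \<in> service_cylinders T \<Longrightarrow> E \<subseteq> space M"
  unfolding service_cylinders_def by auto

lemma init_subset: "E \<in> sets init_algebra \<Longrightarrow> E \<subseteq> space M"
  using sets.sets_into_space[of E init_algebra] by simp

lemma history_rects_Pow: "history_rects T J \<subseteq> Pow (space M)"
  unfolding history_rects_def using arrival_subset by blast

lemma space_history [simp]: "space (history T J) = space M"
  unfolding history_def using history_rects_Pow by (simp add: space_measure_of_conv)

lemma sets_history: "sets (history T J) = sigma_sets (space M) (history_rects T J)"
  unfolding history_def using history_rects_Pow by simp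

lemma history_rects_events: "T \<subseteq> {0..} \<Longrightarrow> history_rects T J \<subseteq> events"
proof
  fix a assume T: "T \<subseteq> {0..}" and "a \<in> history_rects T J"
  then obtain E F G where a: "a = E \<inter> F \<inter> G" and
    m: "E \<in> arrival_cylinders T" "F \<in> service_cylinders J" "G \<in> sets init_algebra"
    unfolding history_rects_def by blast
  have "E \<in> events" "F \<in> events" "G \<in> events"
    using m arrival_cylinders_sets[OF T] service_cylinders_sets[of J] algebra_subset_events by blast+
  then show "a \<in> events" unfolding a by (intro sets.Int)
qed

lemma sets_history_events: "T \<subseteq> {0..} \<Longrightarrow> sets (history T J) \<subseteq> events"
  unfolding sets_history by (rule sets.sigma_sets_subset) (rule history_rects_events)

lemma rect_in_history:
  assumes "E \<in> arrival_cylinders T" "F \<in> service_cylinders J" "G \<in> sets init_algebra"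
  shows "E \<inter> F \<inter> G \<in> sets (history T J)"
  unfolding sets_history using assms by (intro sigma_sets.Basic) (auto simp: history_rects_def)

lemma arrival_in_history: "E \<in> arrival_cylinders T \<Longrightarrow> E \<in> sets (history T J)"
  using rect_in_history[OF _ space_in_cylinders(2) space_in_init, of E T J] arrival_subset[of E T]
  by (simp add: Int_absorb2)

lemma service_in_history: "E \<in> service_cylinders J \<Longrightarrow> E \<in> sets (history T J)"
  using rect_in_history[OF space_in_cylinders(1) _ space_in_init, of E J T] service_subset[of E J]
  by (simp add: Int_absorb1 Int_absorb2)

lemma init_in_history: "E \<in> sets init_algebra \<Longrightarrow> E \<in> sets (history T J)"
  using rect_in_history[OF space_in_cylinders(1) space_in_cylinders(2), of E T J] init_subset[of E]
  by (simp add: Int_absorb1 Int_absorb2)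

lemma measurable_N_history [measurable]:
  assumes "u \<in> T" shows "N u \<in> measurable (history T J) (count_space UNIV)"
proof (rule measurableI)
  fix C :: "nat set"
  have "{\<omega> \<in> space M. \<forall>v\<in>{u}. N v \<omega> \<in> C} \<in> arrival_cylinders T"
    unfolding arrival_cylinders_def using assms
    by (intro CollectI exI[of _ "{u}"] exI[of _ "\<lambda>_. C"]) auto
  from arrival_in_history[OF this] show "N u -` C \<inter> space (history T J) \<in> sets (history T J)"
    by (simp add: vimage_def Int_def conj_commute)
qed simp

lemma measurable_S_history [measurable]:
  assumes "i \<in> J" shows "S i \<in> borel_measurable (history T J)"
proof (rule measurableI)
  fix C :: "real set" assume C: "C \<in> sets borel"
  have "{\<omega> \<in> space M. \<forall>v\<in>{i}. S v \<omega> \<in> C} \<in> service_cylinders J"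
    unfolding service_cylinders_def using assms C
    by (intro CollectI exI[of _ "{i}"] exI[of _ "\<lambda>_. C"]) auto
  from service_in_history[OF this] show "S i -` C \<inter> space (history T J) \<in> sets (history T J)"
    by (simp add: vimage_def Int_def conj_commute)
qed simp

lemma measurable_init_history [measurable]:
  "Q0 \<in> measurable (history T J) (count_space UNIV)"
  "Measurable.pred (history T J) busy0"
  "X0 \<in> borel_measurable (history T J)"
proof -
  have eq: "space init_algebra = space (history T J)" by simp
  have sub: "sets init_algebra \<subseteq> sets (history T J)" using init_in_history by blast
  note m = measurable_enlarge[OF _ eq sub]
  show "Q0 \<in> measurable (history T J) (count_space UNIV)"
    "Measurable.pred (history T J) busy0"
    "X0 \<in> borel_measurable (history T J)"
    using measurable_init by (blast intro: m)+
qed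

lemma events_history:
  assumes "T \<subseteq> {0..}" and f: "f \<in> measurable (history T J) L"
  shows "f \<in> measurable M L"
  by (rule measurable_enlarge[OF f _ sets_history_events[OF assms(1)]]) simp

lemma indep_increment:
  assumes "0 \<le> t" "t \<le> v" "E \<in> sets (history {0..t} UNIV)"
  shows "prob (E \<inter> {\<omega> \<in> space M. N v \<omega> - N t \<omega> \<in> \<Delta>}) =
    prob E * prob {\<omega> \<in> space M. N v \<omega> - N t \<omega> \<in> \<Delta>}"
proof -
  let ?D = "{\<omega> \<in> space M. N v \<omega> - N t \<omega> \<in> \<Delta>}"
  have [measurable]: "N v \<in> measurable arrival_algebra (count_space UNIV)"
    "N t \<in> measurable arrival_algebra (count_space UNIV)"
    using measurable_arrival assms by auto
  have "{\<omega> \<in> space arrival_algebra. N v \<omega> - N t \<omega> \<in> \<Delta>} \<in> sets arrival_algebra" by measurable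
  then have D: "?D \<in> sets arrival_algebra" by simp
  have "indep_set (history_rects {0..t} UNIV) {?D}"
  proof (rule indep_setI)
    show "history_rects {0..t} UNIV \<subseteq> events" by (rule history_rects_events) auto
    show "{?D} \<subseteq> events" using D algebra_subset_events by blast
    fix a b assume "a \<in> history_rects {0..t} UNIV" and b: "b \<in> {?D}"
    then obtain E F G where a: "a = E \<inter> F \<inter> G" and
      m: "E \<in> arrival_cylinders {0..t}" "F \<in> service_cylinders UNIV" "G \<in> sets init_algebra"
      unfolding history_rects_def by blast
    have E: "E \<in> sets arrival_algebra" using arrival_cylinders_sets[of "{0..t}"] m(1) by auto
    have F: "F \<in> sets service_algebra" using service_cylinders_sets m(2) by auto
    \<comment> \<open>The later increment is also an arrival event, so it joins the arrival factor
      of the rectangle and is split off inside that factor.\<close>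
    have "prob (a \<inter> b) = prob ((E \<inter> ?D) \<inter> F \<inter> G)" using a b by (intro arg_cong[of _ _ prob]) auto
    also have "\<dots> = prob (E \<inter> ?D) * prob F * prob G" using E D F m(3) by (intro prob_product) auto
    also have "\<dots> = prob a * prob b"
      unfolding a prob_cylinder_increment[OF assms(1,2) m(1)] prob_product[OF E F m(3)] using b by simp
    finally show "prob (a \<inter> b) = prob a * prob b" .
  qed
  then have "indep_set (sigma_sets (space M) (history_rects {0..t} UNIV)) (sigma_sets (space M) {?D})"
    by (rule indep_set_sigma_sets[OF _ Int_stable_history_rects]) (auto simp: Int_stable_def)
  then show ?thesis
    by (rule indep_setD) (use assms(3) in \<open>auto simp: sets_history\<close>)
qed

text \<open>On a rectangle, \<open>S j\<close> meets only the service factor, and that factor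
  involves finitely many other service times.\<close>

lemma indep_service:
  "indep_set (sets (history {0..} {..<j})) (sigma_sets (space M) {S j -` C \<inter> space M | C. C \<in> sets borel})"
proof -
  let ?B = "{S j -` C \<inter> space M | C. C \<in> sets (borel :: real measure)}"
  have "indep_set (history_rects {0..} {..<j}) ?B"
  proof (rule indep_setI)
    show "history_rects {0..} {..<j} \<subseteq> events" by (rule history_rects_events) auto
    have B: "b \<in> sets service_algebra" if b: "b \<in> ?B" for b
    proof -
      obtain C where "b = S j -` C \<inter> space M" "C \<in> sets borel" using b by blast
      then show ?thesis using measurable_sets[OF measurable_service, of C j] by simp
    qed
    then show "?B \<subseteq> events" using algebra_subset_events by blast
    fix a b assume "a \<in> history_rects {0..} {..<j}" and b: "b \<in> ?B"
    then obtain E F G where a: "a = E \<inter> F \<inter> G" and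
      m: "E \<in> arrival_cylinders {0..}" "F \<in> service_cylinders {..<j}" "G \<in> sets init_algebra"
      unfolding history_rects_def by blast
    have E: "E \<in> sets arrival_algebra" using arrival_cylinders_sets[of "{0..}"] m(1) by auto
    have F: "F \<in> sets service_algebra" using service_cylinders_sets m(2) by auto
    obtain I C where FI: "F = {\<omega> \<in> space M. \<forall>i\<in>I. S i \<omega> \<in> C i}" "finite I" "I \<subseteq> {..<j}"
      "\<And>i. i \<in> I \<Longrightarrow> C i \<in> sets borel" using m(2) unfolding service_cylinders_def by blast
    obtain D where D: "b = S j -` D \<inter> space M" "D \<in> sets borel" using b by blast
    have Fb: "prob (F \<inter> b) = prob F * prob b"
    \<comment> \<open>An intersection over the empty index set would be \<open>UNIV\<close> and not
      the sample space.\<close>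
    proof (cases "I = {}")
      case True
      then have "F = space M" using FI by auto
      then show ?thesis using D by (simp add: prob_space Int_absorb1)
    next
      case False
      have j: "j \<notin> I" using FI by auto
      have eqF: "F = (\<Inter>i\<in>I. S i -` C i \<inter> space M)" using False FI by auto
      have "prob (\<Inter>i\<in>insert j I. S i -` (C(j := D)) i \<inter> space M)
          = (\<Prod>i\<in>insert j I. prob (S i -` (C(j := D)) i \<inter> space M))"
        by (rule indep_varsD[OF S_indep]) (use FI D in auto)
      also have "\<dots> = prob b * (\<Prod>i\<in>I. prob (S i -` C i \<inter> space M))"
      proof -
        have "(\<Prod>i\<in>I. prob (S i -` (C(j := D)) i \<inter> space M)) = (\<Prod>i\<in>I. prob (S i -` C i \<inter> space M))"
          by (rule prod.cong) (use j in auto)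
        then show ?thesis using j FI D by simp
      qed
      also have "(\<Prod>i\<in>I. prob (S i -` C i \<inter> space M)) = prob F"
        unfolding eqF by (rule indep_varsD[OF S_indep, symmetric]) (use FI False in auto)
      also have "(\<Inter>i\<in>insert j I. S i -` (C(j := D)) i \<inter> space M) = F \<inter> b"
      proof -
        have "(C(j := D)) i = C i" if "i \<in> I" for i using that j by auto
        then show ?thesis unfolding FI D by (auto simp del: fun_upd_apply simp: fun_upd_same)
      qed
      finally show ?thesis by simp
    qed
    have "prob (a \<inter> b) = prob (E \<inter> (F \<inter> b) \<inter> G)" using a by (intro arg_cong[of _ _ prob]) auto
    also have "\<dots> = prob E * prob (F \<inter> b) * prob G" using E F B[OF b] m(3) by (intro prob_product) auto
    also have "\<dots> = prob a * prob b" unfolding a prob_product[OF E F m(3)] Fb by simp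
    finally show "prob (a \<inter> b) = prob a * prob b" .
  qed
  moreover have "Int_stable ?B"
  proof (rule Int_stableI)
    fix a b assume "a \<in> ?B" "b \<in> ?B"
    then obtain C C' where "a = S j -` C \<inter> space M" "b = S j -` C' \<inter> space M"
      "C \<in> sets borel" "C' \<in> sets borel" by blast
    then show "a \<inter> b \<in> ?B" by (intro CollectI exI[of _ "C \<inter> C'"]) auto
  qed
  ultimately show ?thesis
    unfolding sets_history by (intro indep_set_sigma_sets Int_stable_history_rects)
qed

end

section \<open>State events and lack of memory\<close>

text \<open>Sums out the cycle index: the state events of different cycles are disjoint, so a
  transition factor common to all cycles passes to their union.\<close>

lemma (in prob_space) prob_UN_scale:
  fixes X Y :: "nat \<Rightarrow> 'a set"
  assumes X: "\<And>j. X j \<in> events" and Y: "\<And>j. Y j \<in> events" and sub: "\<And>j. Y j \<subseteq> X j"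
    and disj: "\<And>i j \<omega>. \<omega> \<in> X i \<Longrightarrow> \<omega> \<in> X j \<Longrightarrow> i = j"
    and scale: "\<And>j. prob (Y j) = a * prob (X j)"
  shows "prob (\<Union>j. Y j) = a * prob (\<Union>j. X j)"
proof -
  have "disjoint_family X" "disjoint_family Y"
    using disj sub unfolding disjoint_family_on_def by blast+
  then have "(\<lambda>j. prob (X j)) sums prob (\<Union>j. X j)" "(\<lambda>j. prob (Y j)) sums prob (\<Union>j. Y j)"
    using X Y by (auto intro!: finite_measure_UNION)
  then show ?thesis
    using sums_mult[of "\<lambda>j. prob (X j)" _ a] sums_unique2 unfolding scale by blast
qed

lemma counting_path_stopped:
  assumes "counting_path n" "0 \<le> t"
  shows "counting_path (\<lambda>u. n (min u t))"
proof
  interpret counting_path n by fact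
  show "n (min x t) \<le> n (min y t)" if "0 \<le> x" "x \<le> y" for x y
    using mono[of "min x t" "min y t"] that assms(2) by auto
  show "eventually (\<lambda>y. n (min y t) = n (min x t)) (at_right x)" if x: "0 \<le> x" for x
  proof (cases "x < t")
    case True
    have "eventually (\<lambda>y. y < t) (at_right x)" using True by (auto simp: eventually_at_right_field)
    then show ?thesis using right_continuous[OF x] by eventually_elim (use True in auto)
  next
    case False
    have "eventually (\<lambda>y. x < y) (at_right x)" by (simp add: eventually_at_right_less)
    then show ?thesis by eventually_elim (use False in auto)
  qed
qed

section \<open>State events split by cycle\<close>

context bulk_service_queue
begin

abbreviation "fr j \<omega> \<equiv> fst (cyc k B (Q0 \<omega>) (busy0 \<omega>) (\<lambda>u. N u \<omega>) (\<lambda>i. S i \<omega>) j)"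
abbreviation "tk j \<omega> \<equiv> snd (cyc k B (Q0 \<omega>) (busy0 \<omega>) (\<lambda>u. N u \<omega>) (\<lambda>i. S i \<omega>) j)"
abbreviation "st j \<omega> \<equiv> cyc_start k B (Q0 \<omega>) (busy0 \<omega>) (\<lambda>u. N u \<omega>) (\<lambda>i. S i \<omega>) j"

lemma service_path: "\<omega> \<in> space M \<Longrightarrow> service_path (\<lambda>u. N u \<omega>) k B (\<lambda>i. S i \<omega>)"
  using counting_path S_pos k_ge_1 k_le_B
  by (simp add: service_path_def service_path_axioms_def)

lemma first_start_eq: "next_start fc \<omega> = first_start k (Q0 \<omega>) (\<lambda>u. N u \<omega>) fc"
  by (simp add: next_start_def first_start_def split_beta)

lemma freed_eq: "freed j \<omega> = cyc k B (Q0 \<omega>) (busy0 \<omega>) (\<lambda>u. N u \<omega>) (\<lambda>i. S i \<omega>) j"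
  by (induction j) (simp_all add: Let_def first_start_eq)

lemma service_start_eq: "service_start j \<omega> = st (Suc j) \<omega>"
  by (simp add: service_start_def freed_eq first_start_eq)

lemma free_time_eq: "free_time j \<omega> = fr j \<omega>" and taken_eq: "taken j \<omega> = tk j \<omega>"
  by (simp_all add: free_time_def taken_def freed_eq)

definition waiting :: "nat \<Rightarrow> real \<Rightarrow> 'a \<Rightarrow> nat" where
  "waiting j t \<omega> = Q0 \<omega> + N t \<omega> - tk j \<omega>"

text \<open>The service of cycle 0 began \<open>X0\<close> before time 0, so the conventional start
  \<open>st 0 = 0\<close> must not be used for its age.\<close>

definition elapsed :: "nat \<Rightarrow> real \<Rightarrow> 'a \<Rightarrow> real" where
  "elapsed j t \<omega> = (if j = 0 then X0 \<omega> + t else t - real_of_ereal (st j \<omega>))"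

definition busy_in :: "real \<Rightarrow> nat set \<Rightarrow> real set \<Rightarrow> nat \<Rightarrow> 'a set" where
  "busy_in t R A j = {\<omega> \<in> space M. st j \<omega> \<le> ereal t \<and> ereal t < fr j \<omega> \<and>
     waiting j t \<omega> \<in> R \<and> elapsed j t \<omega> \<in> A}"

definition idle_in :: "real \<Rightarrow> nat set \<Rightarrow> nat \<Rightarrow> 'a set" where
  "idle_in t R j = {\<omega> \<in> space M. fr j \<omega> \<le> ereal t \<and> ereal t < st (Suc j) \<omega> \<and> waiting j t \<omega> \<in> R}"

lemma idle_with_eq: "{\<omega> \<in> space M. idle_with t r \<omega>} = (\<Union>j. idle_in t {r} j)"
  unfolding idle_with_def idle_in_def waiting_def free_time_eq service_start_eq taken_eq by auto

lemma busy_with_eq: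
  assumes "0 \<le> t"
  shows "{\<omega> \<in> space M. \<exists>x\<in>A. busy_with t n x \<omega>} = (\<Union>j. busy_in t {n} A j)"
proof -
  have "(\<exists>x\<in>A. busy_with t n x \<omega>) \<longleftrightarrow> (\<exists>j. \<omega> \<in> busy_in t {n} A j)" if "\<omega> \<in> space M" for \<omega>
  proof -
    \<comment> \<open>\<open>busy_in\<close> does not mention \<open>busy0\<close>; for an initially
      idle server \<open>fr 0 = 0\<close>, so \<open>t \<ge> 0\<close> already makes the event of
      cycle 0 empty.\<close>
    have 0: "(busy0 \<omega> \<and> ereal t < fr 0 \<omega> \<and> n = Q0 \<omega> + N t \<omega> \<and> X0 \<omega> + t \<in> A) \<longleftrightarrow> \<omega> \<in> busy_in t {n} A 0"
      using assms that by (auto simp: busy_in_def waiting_def elapsed_def)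
    have 1: "(st (Suc j) \<omega> \<le> ereal t \<and> ereal t < fr (Suc j) \<omega> \<and> n = Q0 \<omega> + N t \<omega> - tk (Suc j) \<omega> \<and>
        t - real_of_ereal (st (Suc j) \<omega>) \<in> A) \<longleftrightarrow> \<omega> \<in> busy_in t {n} A (Suc j)" for j
      using that unfolding busy_in_def waiting_def elapsed_def by auto
    have "(\<exists>x\<in>A. busy_with t n x \<omega>) \<longleftrightarrow> \<omega> \<in> busy_in t {n} A 0 \<or> (\<exists>j. \<omega> \<in> busy_in t {n} A (Suc j))"
      unfolding busy_with_def free_time_eq service_start_eq taken_eq 0[symmetric] 1[symmetric] by blast
    also have "\<dots> \<longleftrightarrow> (\<exists>j. \<omega> \<in> busy_in t {n} A j)" by (metis nat.exhaust)
    finally show ?thesis .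
  qed
  moreover have "\<omega> \<in> space M" if "\<omega> \<in> busy_in t {n} A j" for \<omega> j using that by (simp add: busy_in_def)
  ultimately show ?thesis by blast
qed

lemma busy_in_index_unique:
  assumes "\<omega> \<in> busy_in t R A i" "\<omega> \<in> busy_in t R' A' j" shows "i = j"
proof -
  have w: "\<omega> \<in> space M" using assms by (simp add: busy_in_def)
  interpret p: service_path "\<lambda>u. N u \<omega>" k B "Q0 \<omega>" "busy0 \<omega>" "\<lambda>i. S i \<omega>" by (rule service_path) fact
  show ?thesis using assms p.busy_unique[of i t _ j] unfolding p.busy_def busy_in_def by blast
qed

lemma idle_in_index_unique:
  assumes "\<omega> \<in> idle_in t R i" "\<omega> \<in> idle_in t R' j" shows "i = j"
proof -
  have w: "\<omega> \<in> space M" using assms by (simp add: idle_in_def)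
  interpret p: service_path "\<lambda>u. N u \<omega>" k B "Q0 \<omega>" "busy0 \<omega>" "\<lambda>i. S i \<omega>" by (rule service_path) fact
  show ?thesis using assms p.idle_unique[of i t _ j] unfolding p.idle_def idle_in_def by blast
qed

lemma path_busy_iff:
  assumes "\<omega> \<in> space M"
  shows "(\<exists>j. service_path.busy (\<lambda>u. N u \<omega>) k B (Q0 \<omega>) (busy0 \<omega>) (\<lambda>i. S i \<omega>) j t r) \<longleftrightarrow>
    \<omega> \<in> (\<Union>j. busy_in t {r} UNIV j)"
  unfolding service_path.busy_def[OF service_path[OF assms]] using assms
  by (auto simp: busy_in_def waiting_def)

lemma path_idle_iff:
  assumes "\<omega> \<in> space M"
  shows "(\<exists>j. service_path.idle (\<lambda>u. N u \<omega>) k B (Q0 \<omega>) (busy0 \<omega>) (\<lambda>i. S i \<omega>) j t r) \<longleftrightarrow>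
    \<omega> \<in> (\<Union>j. idle_in t {r} j)"
  unfolding service_path.idle_def[OF service_path[OF assms]] using assms
  by (auto simp: idle_in_def waiting_def)

lemma measurable_st_history:
  assumes "{..<j} \<subseteq> J"
  shows "st j \<in> borel_measurable (history {0..} J)"
    and "tk j \<in> measurable (history {0..} J) (count_space UNIV)"
proof -
  \<comment> \<open>Service times outside \<open>J\<close> are not measurable for this history. Any
    positive constant may stand in for them, because start and count of cycle \<open>j\<close> see
    only the earlier services.\<close>
  define S' where "S' i = (if i \<in> J then S i else (\<lambda>_. 1))" for i
  have S': "S' i \<in> borel_measurable (history {0..} J)" for i
    unfolding S'_def by simp
  have path: "service_path (\<lambda>u. N u \<omega>) k B (\<lambda>i. S' i \<omega>)" if "\<omega> \<in> space (history {0..} J)" for \<omega>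
    using that counting_path S_pos k_ge_1 k_le_B
    by (simp add: service_path_def service_path_axioms_def S'_def)
  have N: "N u \<in> measurable (history {0..} J) (count_space UNIV)" if "0 \<le> u" for u
    by (rule measurable_N_history) (use that in auto)
  note m = measurable_init_history
  have eq: "st j \<omega> = cyc_start k B (Q0 \<omega>) (busy0 \<omega>) (\<lambda>u. N u \<omega>) (\<lambda>i. S' i \<omega>) j"
    "tk j \<omega> = snd (cyc k B (Q0 \<omega>) (busy0 \<omega>) (\<lambda>u. N u \<omega>) (\<lambda>i. S' i \<omega>) j)" for \<omega>
  proof -
    have "S i \<omega> = S' i \<omega>" if "i < j" for i using assms that by (auto simp: S'_def)
    then show "st j \<omega> = cyc_start k B (Q0 \<omega>) (busy0 \<omega>) (\<lambda>u. N u \<omega>) (\<lambda>i. S' i \<omega>) j"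
      "tk j \<omega> = snd (cyc k B (Q0 \<omega>) (busy0 \<omega>) (\<lambda>u. N u \<omega>) (\<lambda>i. S' i \<omega>) j)"
      using cyc_cong[of j "\<lambda>i. S i \<omega>" "\<lambda>i. S' i \<omega>"] by blast+
  qed
  show "st j \<in> borel_measurable (history {0..} J)"
    unfolding eq by (rule measurable_start[where N=N and Q=Q0 and b=busy0 and S=S', OF N m(1,2) S' path])
  show "tk j \<in> measurable (history {0..} J) (count_space UNIV)"
    unfolding eq by (rule measurable_taken[where N=N and Q=Q0 and b=busy0 and S=S', OF N m(1,2) S' path])
qed

lemma measurable_fr_history:
  assumes "{..j} \<subseteq> J"
  shows "fr j \<in> borel_measurable (history {0..} J)"
proof -
  have [measurable]: "st j \<in> borel_measurable (history {0..} J)"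
    by (rule measurable_st_history) (use assms in auto)
  have [measurable]: "S j \<in> borel_measurable (history {0..} J)"
    by (rule measurable_S_history) (use assms in auto)
  show ?thesis
    unfolding fst_cyc by measurable
qed

lemma measurable_waiting_history:
  assumes "{..<j} \<subseteq> J" "0 \<le> t"
  shows "waiting j t \<in> measurable (history {0..} J) (count_space UNIV)"
proof -
  have [measurable]: "tk j \<in> measurable (history {0..} J) (count_space UNIV)"
    by (rule measurable_st_history) (use assms in auto)
  have [measurable]: "N t \<in> measurable (history {0..} J) (count_space UNIV)"
    by (rule measurable_N_history) (use assms in auto)
  show ?thesis unfolding waiting_def by measurable
qed

lemma measurable_elapsed_history:
  assumes "{..<j} \<subseteq> J"
  shows "elapsed j t \<in> borel_measurable (history {0..} J)"
proof -
  have [measurable]: "st j \<in> borel_measurable (history {0..} J)"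
    by (rule measurable_st_history) (use assms in auto)
  show ?thesis unfolding elapsed_def by measurable
qed

lemma idle_in_history:
  assumes "{..j} \<subseteq> J" "0 \<le> t"
  shows "idle_in t R j \<in> sets (history {0..} J)"
proof -
  let ?H = "history {0..} J"
  have [measurable]: "fr j \<in> borel_measurable ?H" "st (Suc j) \<in> borel_measurable ?H"
    "waiting j t \<in> measurable ?H (count_space UNIV)"
    by (rule measurable_fr_history measurable_st_history measurable_waiting_history; use assms in force)+
  have "{\<omega> \<in> space ?H. fr j \<omega> \<le> ereal t \<and> ereal t < st (Suc j) \<omega> \<and> waiting j t \<omega> \<in> R} \<in> sets ?H"
    by measurable
  then show ?thesis by (simp add: idle_in_def)
qed

lemma busy_in_history:
  assumes "{..j} \<subseteq> J" "0 \<le> t" "A \<in> sets borel"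
  shows "busy_in t R A j \<in> sets (history {0..} J)"
proof -
  let ?H = "history {0..} J"
  have [measurable]: "fr j \<in> borel_measurable ?H" "st j \<in> borel_measurable ?H"
    "waiting j t \<in> measurable ?H (count_space UNIV)" "elapsed j t \<in> borel_measurable ?H"
    by (rule measurable_fr_history measurable_st_history measurable_waiting_history measurable_elapsed_history;
        use assms in force)+
  have [measurable]: "A \<in> sets borel" by fact
  have "{\<omega> \<in> space ?H. st j \<omega> \<le> ereal t \<and> ereal t < fr j \<omega> \<and> waiting j t \<omega> \<in> R \<and> elapsed j t \<omega> \<in> A} \<in> sets ?H"
    by measurable
  then show ?thesis by (simp add: busy_in_def)
qed

text \<open>Stopping the arrivals at time \<open>t\<close> does not change the state at time \<open>t\<close>.\<close>

lemma states_past: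
  assumes t: "0 \<le> t"
  shows busy_in_past: "A \<in> sets borel \<Longrightarrow> busy_in t R A j \<in> sets (history {0..t} UNIV)"
    and idle_in_past: "idle_in t R j \<in> sets (history {0..t} UNIV)"
proof -
  let ?H = "history {0..t} UNIV"
  \<comment> \<open>Every stopped count is the count at a time in \<open>{0..t}\<close>, hence
    measurable for the past of \<open>t\<close>.\<close>
  let ?N = "\<lambda>u. N (min u t)"
  let ?c = "\<lambda>j \<omega>. cyc k B (Q0 \<omega>) (busy0 \<omega>) (\<lambda>u. ?N u \<omega>) (\<lambda>i. S i \<omega>) j"
  let ?st = "\<lambda>j \<omega>. cyc_start k B (Q0 \<omega>) (busy0 \<omega>) (\<lambda>u. ?N u \<omega>) (\<lambda>i. S i \<omega>) j"
  have path: "service_path (\<lambda>u. ?N u \<omega>) k B (\<lambda>i. S i \<omega>)" if "\<omega> \<in> space ?H" for \<omega>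
    using that counting_path_stopped[OF counting_path t] S_pos k_ge_1 k_le_B
    by (simp add: service_path_def service_path_axioms_def)
  have N: "?N u \<in> measurable ?H (count_space UNIV)" if "0 \<le> u" for u
    by (rule measurable_N_history) (use that t in auto)
  have S: "S i \<in> borel_measurable ?H" for i by measurable
  note m = measurable_init_history
  have meas [measurable]: "?st j \<in> borel_measurable ?H" "(\<lambda>\<omega>. fst (?c j \<omega>)) \<in> borel_measurable ?H"
    "(\<lambda>\<omega>. snd (?c j \<omega>)) \<in> measurable ?H (count_space UNIV)" for j
    by (rule measurable_start[where N="?N" and Q=Q0 and b=busy0 and S=S, OF N m(1,2) S path]
        measurable_free[where N="?N" and Q=Q0 and b=busy0 and S=S, OF N m(1,2) S path]
        measurable_taken[where N="?N" and Q=Q0 and b=busy0 and S=S, OF N m(1,2) S path]; assumption)+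
  have [measurable]: "N t \<in> measurable ?H (count_space UNIV)"
    by (rule measurable_N_history) (use t in auto)
  have stop: "(st j \<omega> = ?st j \<omega> \<and> cyc k B (Q0 \<omega>) (busy0 \<omega>) (\<lambda>u. N u \<omega>) (\<lambda>i. S i \<omega>) j = ?c j \<omega>)
      \<or> (ereal t < st j \<omega> \<and> ereal t < ?st j \<omega>)" if "\<omega> \<in> space M" for j \<omega>
    by (rule cyc_stopped) (use that path service_path in auto)
  show "busy_in t R A j \<in> sets ?H" if [measurable]: "A \<in> sets borel"
  proof -
    have "busy_in t R A j = {\<omega> \<in> space ?H. ?st j \<omega> \<le> ereal t \<and> ereal t < fst (?c j \<omega>) \<and>
       Q0 \<omega> + N t \<omega> - snd (?c j \<omega>) \<in> R \<and> (if j = 0 then X0 \<omega> + t else t - real_of_ereal (?st j \<omega>)) \<in> A}"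
    proof -
      have eq: "st j \<omega> \<le> ereal t \<and> ereal t < fr j \<omega> \<and> Q0 \<omega> + N t \<omega> - tk j \<omega> \<in> R \<and>
          (if j = 0 then X0 \<omega> + t else t - real_of_ereal (st j \<omega>)) \<in> A \<longleftrightarrow>
        ?st j \<omega> \<le> ereal t \<and> ereal t < fst (?c j \<omega>) \<and> Q0 \<omega> + N t \<omega> - snd (?c j \<omega>) \<in> R \<and>
          (if j = 0 then X0 \<omega> + t else t - real_of_ereal (?st j \<omega>)) \<in> A"
        if w: "\<omega> \<in> space M" for \<omega>
        using stop[OF w, of j]
      proof (elim disjE conjE)
        assume e: "st j \<omega> = ?st j \<omega>" "cyc k B (Q0 \<omega>) (busy0 \<omega>) (\<lambda>u. N u \<omega>) (\<lambda>i. S i \<omega>) j = ?c j \<omega>"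
        show ?thesis unfolding e ..
      qed (simp add: not_le[symmetric])
      show ?thesis
        unfolding busy_in_def waiting_def elapsed_def space_history
        by (rule Collect_cong, rule conj_cong[OF refl], rule eq)
    qed
    also have "\<dots> \<in> sets ?H" by measurable
    finally show ?thesis .
  qed
  show "idle_in t R j \<in> sets ?H"
  proof -
    have "idle_in t R j = {\<omega> \<in> space ?H. fst (?c j \<omega>) \<le> ereal t \<and> ereal t < ?st (Suc j) \<omega> \<and>
       Q0 \<omega> + N t \<omega> - snd (?c j \<omega>) \<in> R}"
    proof -
      have eq: "fr j \<omega> \<le> ereal t \<and> ereal t < st (Suc j) \<omega> \<and> Q0 \<omega> + N t \<omega> - tk j \<omega> \<in> R \<longleftrightarrow>
        fst (?c j \<omega>) \<le> ereal t \<and> ereal t < ?st (Suc j) \<omega> \<and> Q0 \<omega> + N t \<omega> - snd (?c j \<omega>) \<in> R"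
        if w: "\<omega> \<in> space M" for \<omega>
      proof -
        have "st j \<omega> \<le> fr j \<omega>" "?st j \<omega> \<le> fst (?c j \<omega>)"
          using service_path.start_le_free[OF service_path[OF w]] service_path.start_le_free[OF path] w by auto
        note le = this
        \<comment> \<open>The next start may differ for the stopped path, but then it lies beyond
          \<open>t\<close> for both paths, so its comparison with \<open>t\<close> is the
          same.\<close>
        have a: "ereal t < st (Suc j) \<omega> \<longleftrightarrow> ereal t < ?st (Suc j) \<omega>"
          using stop[OF w, of "Suc j"] by (elim disjE conjE) (simp_all del: cyc_start_simps cyc.simps)
        show ?thesis using stop[OF w, of j]
        proof (elim disjE conjE)
          assume e: "cyc k B (Q0 \<omega>) (busy0 \<omega>) (\<lambda>u. N u \<omega>) (\<lambda>i. S i \<omega>) j = ?c j \<omega>"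
          show ?thesis unfolding a e ..
        next
          assume "ereal t < st j \<omega>" "ereal t < ?st j \<omega>"
          then have "\<not> fr j \<omega> \<le> ereal t" "\<not> fst (?c j \<omega>) \<le> ereal t"
            using le by (meson leD order_trans)+
          then show ?thesis by blast
        qed
      qed
      show ?thesis
        unfolding idle_in_def waiting_def space_history
        by (rule Collect_cong, rule conj_cong[OF refl], rule eq)
    qed
    also have "\<dots> \<in> sets ?H" by measurable
    finally show ?thesis .
  qed
qed

text \<open>Relative to this history \<open>V\<close> behaves like a constant threshold, and the
  tail of \<open>S j\<close> at \<open>V + h\<close> is \<open>exp (- mu * h)\<close> times its tail
  at \<open>V\<close>. In the application \<open>V\<close> is the age of the service at time
  \<open>t\<close>.\<close>

lemma memoryless:
  assumes E: "E \<in> sets (history {0..} {..<j})" and V: "V \<in> borel_measurable (history {0..} {..<j})"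
    and nonneg: "\<And>\<omega>. \<omega> \<in> space M \<Longrightarrow> 0 \<le> V \<omega>" and h: "0 \<le> h"
  shows "prob (E \<inter> {\<omega> \<in> space M. V \<omega> + h < S j \<omega>}) =
    exp (- (mu * h)) * prob (E \<inter> {\<omega> \<in> space M. V \<omega> < S j \<omega>})"
proof -
  let ?H = "history {0..} {..<j}"
  \<comment> \<open>The value infinity off \<open>E\<close> encodes the event and the threshold in
    one variable, so that Fubini for the independent pair \<open>W\<close>, \<open>Z\<close> handles
    both at once.\<close>
  define W where "W \<omega> = (if \<omega> \<in> E then ereal (V \<omega>) else \<infinity>)" for \<omega>
  have [measurable]: "E \<in> sets ?H" "V \<in> borel_measurable ?H" by fact+
  have WH: "W \<in> borel_measurable ?H" unfolding W_def by measurable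
  have WM[measurable]: "W \<in> borel_measurable M" by (rule events_history[OF _ WH]) simp
  have SM[measurable]: "S j \<in> borel_measurable M" using S_exponential[of j] by (simp add: distributed_def)
  define Z where "Z \<omega> = ereal (S j \<omega>)" for \<omega>
  have ZM[measurable]: "Z \<in> borel_measurable M" unfolding Z_def by measurable
  have ind: "indep_var borel W borel Z"
  proof -
    have "{W -` A \<inter> space M | A. A \<in> sets borel} \<subseteq> sets ?H"
      using measurable_sets[OF WH] by auto
    then have "sigma_sets (space M) {W -` A \<inter> space M | A. A \<in> sets borel} \<subseteq> sets ?H"
      using sets.sigma_sets_subset[of _ ?H] by simp
    moreover have "sigma_sets (space M) {Z -` A \<inter> space M | A. A \<in> sets borel}
        \<subseteq> sigma_sets (space M) {S j -` A \<inter> space M | A. A \<in> sets borel}"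
    proof (rule sigma_sets_mono', safe)
      fix A :: "ereal set" assume "A \<in> sets borel"
      then have "ereal -` A \<in> sets borel" using measurable_sets[of ereal borel borel A] by simp
      moreover have "Z -` A = S j -` (ereal -` A)" by (auto simp: Z_def)
      ultimately show "\<exists>C. Z -` A \<inter> space M = S j -` C \<inter> space M \<and> C \<in> sets borel" by blast
    qed
    ultimately have "indep_set (sigma_sets (space M) {W -` A \<inter> space M |A. A \<in> sets borel})
     (sigma_sets (space M) {Z -` A \<inter> space M |A. A \<in> sets borel})"
      using indep_service[of j] unfolding indep_sets2_eq by blast
    then show ?thesis unfolding indep_var_eq using WM ZM by blast
  qed
  let ?X = "\<lambda>h. {p :: ereal \<times> ereal. fst p + ereal h < snd p}"
  have X[measurable]: "?X h \<in> sets (borel \<Otimes>\<^sub>M borel)" for h :: real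
  proof -
    have "{p \<in> space (borel \<Otimes>\<^sub>M borel). fst p + ereal h < snd p} \<in> sets (borel \<Otimes>\<^sub>M (borel :: ereal measure))"
      by measurable
    then show ?thesis by (simp add: space_pair_measure)
  qed
  interpret dS: prob_space "distr M borel Z" by (rule prob_space_distr) simp
  have tail: "emeasure (distr M borel Z) (Pair (ereal a) -` ?X h) = ennreal (exp (- (a + h) * mu))"
    if "0 \<le> a" "0 \<le> h" for a h :: real
  proof -
    have "Pair (ereal a) -` ?X h = {ereal (a + h)<..}" by auto
    then have "emeasure (distr M borel Z) (Pair (ereal a) -` ?X h) = emeasure M {\<omega> \<in> space M. a + h < S j \<omega>}"
      by (simp add: emeasure_distr vimage_def Int_def conj_commute Z_def)
    also have "\<dots> = ennreal (exp (- (a + h) * mu))"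
      using exponential_distributedD_gt[OF S_exponential _ mu_pos, of "a + h" j] that
      by (simp add: emeasure_eq_measure)
    finally show ?thesis .
  qed
  \<comment> \<open>Outcomes outside \<open>E\<close> contribute nothing, as no service time exceeds
    infinity.\<close>
  have inf: "Pair \<infinity> -` ?X h = {}" for h by auto
  have main: "emeasure M (E \<inter> {\<omega> \<in> space M. V \<omega> + h < S j \<omega>}) =
      (\<integral>\<^sup>+\<omega>. emeasure (distr M borel Z) (Pair (W \<omega>) -` ?X h) \<partial>M)" for h
  proof -
    have "E \<subseteq> space M" using sets.sets_into_space[OF E] by simp
    then have "E \<inter> {\<omega> \<in> space M. V \<omega> + h < S j \<omega>} = (\<lambda>\<omega>. (W \<omega>, Z \<omega>)) -` ?X h \<inter> space M"
      unfolding W_def Z_def by (auto split: if_splits)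
    then have "emeasure M (E \<inter> {\<omega> \<in> space M. V \<omega> + h < S j \<omega>}) =
        emeasure (distr M (borel \<Otimes>\<^sub>M borel) (\<lambda>\<omega>. (W \<omega>, Z \<omega>))) (?X h)"
      using X by (simp add: emeasure_distr)
    also have "\<dots> = emeasure (distr M borel W \<Otimes>\<^sub>M distr M borel Z) (?X h)"
      using ind unfolding indep_var_distribution_eq by simp
    also have "\<dots> = (\<integral>\<^sup>+w. emeasure (distr M borel Z) (Pair w -` ?X h) \<partial>distr M borel W)"
      by (rule dS.emeasure_pair_measure_alt) (use X in \<open>simp cong: sets_pair_measure_cong\<close>)
    also have "\<dots> = (\<integral>\<^sup>+\<omega>. emeasure (distr M borel Z) (Pair (W \<omega>) -` ?X h) \<partial>M)"
      by (rule nn_integral_distr)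
        (auto intro!: dS.measurable_emeasure_Pair[where N=borel] simp: X cong: sets_pair_measure_cong)
    finally show ?thesis .
  qed
  have pt: "emeasure (distr M borel Z) (Pair (W \<omega>) -` ?X h) =
      ennreal (exp (- (mu * h))) * emeasure (distr M borel Z) (Pair (W \<omega>) -` ?X 0)" if "\<omega> \<in> space M" for \<omega>
  proof (cases "\<omega> \<in> E")
    case True
    then show ?thesis
      using tail[OF nonneg[OF that] h] tail[OF nonneg[OF that], of 0]
      by (simp add: W_def ennreal_mult[symmetric] exp_add[symmetric] algebra_simps)
  next
    case False then show ?thesis by (simp only: W_def if_False inf) simp
  qed
  have "emeasure M (E \<inter> {\<omega> \<in> space M. V \<omega> + h < S j \<omega>}) =
      (\<integral>\<^sup>+\<omega>. ennreal (exp (- (mu * h))) * emeasure (distr M borel Z) (Pair (W \<omega>) -` ?X 0) \<partial>M)"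
    unfolding main by (rule nn_integral_cong) (rule pt)
  also have "\<dots> = ennreal (exp (- (mu * h))) * emeasure M (E \<inter> {\<omega> \<in> space M. V \<omega> + 0 < S j \<omega>})"
    unfolding main[of 0]
    by (rule nn_integral_cmult, rule measurable_compose[OF WM])
      (auto intro!: dS.measurable_emeasure_Pair[where N=borel] simp: X cong: sets_pair_measure_cong)
  finally show ?thesis
    by (simp add: emeasure_eq_measure ennreal_mult[symmetric])
qed

end

section \<open>Idle and busy probabilities after a short time\<close>

text \<open>Quadratic errors of the factors for no arrival, for one arrival, and for an end of
  service without arrival; \<open>L\<close> is the Poisson mean and \<open>x\<close> is
  \<open>mu\<close> times the length of the interval.\<close>

lemma exp_bounds:
  fixes L x :: real
  assumes "0 \<le> L" "0 \<le> x"
  shows "\<bar>exp (- L) - 1 + L\<bar> \<le> L\<^sup>2" "\<bar>exp (- L) * L - L\<bar> \<le> L\<^sup>2"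
    "\<bar>exp (- L) * (1 - exp (- x)) - x\<bar> \<le> x\<^sup>2 + L * x"
proof -
  have low: "1 - y \<le> exp (- y)" for y :: real using exp_ge_add_one_self[of "- y"] by simp
  have up: "exp (- y) \<le> 1 - y + y\<^sup>2" if y: "0 \<le> y" for y :: real
  proof -
    have "exp (- y) * (1 + y) \<le> exp (- y) * exp y" using exp_ge_add_one_self[of y] by (intro mult_left_mono) auto
    also have "\<dots> = 1" by (simp flip: exp_add)
    \<comment> \<open>The product equals \<open>1 + y^3\<close>.\<close>
    also have "1 \<le> (1 - y + y\<^sup>2) * (1 + y)" using y by (simp add: algebra_simps power2_eq_square)
    finally show ?thesis using y by (simp add: mult_le_cancel_right)
  qed
  show "\<bar>exp (- L) - 1 + L\<bar> \<le> L\<^sup>2" using low[of L] up[OF assms(1)] by simp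
  have "exp (- L) * L \<le> L" using assms by (simp add: mult_left_le_one_le)
  moreover have "(1 - L) * L \<le> exp (- L) * L" using low assms by (intro mult_right_mono) auto
  ultimately show "\<bar>exp (- L) * L - L\<bar> \<le> L\<^sup>2" by (simp add: algebra_simps power2_eq_square)
  have x: "0 \<le> 1 - exp (- x)" "1 - exp (- x) \<le> x" "x - x\<^sup>2 \<le> 1 - exp (- x)"
    using low[of x] up[OF assms(2)] assms by auto
  have "exp (- L) * (1 - exp (- x)) \<le> 1 * (1 - exp (- x))" using x assms by (intro mult_right_mono) auto
  moreover have "(1 - L) * (1 - exp (- x)) \<le> exp (- L) * (1 - exp (- x))" using x low by (intro mult_right_mono) auto
  moreover have "L * (1 - exp (- x)) \<le> L * x" using x assms by (intro mult_left_mono) auto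
  moreover have "0 \<le> L * x" "0 \<le> x\<^sup>2" using assms by auto
  ultimately show "\<bar>exp (- L) * (1 - exp (- x)) - x\<bar> \<le> x\<^sup>2 + L * x"
    using x by (simp add: algebra_simps)
qed

lemma (in prob_space) prob_diff_le:
  assumes "A \<in> events" "B \<in> events" "E \<in> events"
    and "\<And>\<omega>. \<omega> \<in> space M \<Longrightarrow> \<omega> \<notin> E \<Longrightarrow> \<omega> \<in> A \<longleftrightarrow> \<omega> \<in> B"
  shows "\<bar>prob A - prob B\<bar> \<le> prob E"
proof -
  have "prob A \<le> prob (B \<union> E)" "prob B \<le> prob (A \<union> E)"
    using assms sets.sets_into_space by (intro finite_measure_mono; blast)+
  then show ?thesis
    using measure_Un_le[OF assms(2,3)] measure_Un_le[OF assms(1,3)] by linarith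
qed

context poisson_arrivals
begin

definition increment :: "real \<Rightarrow> real \<Rightarrow> nat set \<Rightarrow> 'a set" where
  "increment t v \<Delta> = {\<omega> \<in> space M. N v \<omega> - N t \<omega> \<in> \<Delta>}"

abbreviation mean :: "real \<Rightarrow> real \<Rightarrow> real" where
  "mean t v \<equiv> integral {t..v} lam"

lemma lam_integrable: "0 \<le> t \<Longrightarrow> lam integrable_on {t..v}"
  by (rule integrable_continuous_real) (rule continuous_on_subset[OF lam_continuous], auto)

lemma mean_nonneg: "0 \<le> t \<Longrightarrow> 0 \<le> mean t v"
  using lam_nonneg by (intro integral_nonneg lam_integrable) auto

lemma increment_event [measurable]:
  assumes "0 \<le> t" "0 \<le> v" shows "increment t v \<Delta> \<in> events"
proof -
  have [measurable]: "N t \<in> measurable M (count_space UNIV)" "N v \<in> measurable M (count_space UNIV)"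
    using N_measurable assms by auto
  show ?thesis unfolding increment_def by measurable
qed

lemma prob_increment:
  assumes "0 \<le> t" "t \<le> v"
  shows "prob (increment t v {d}) = exp (- mean t v) * mean t v ^ d / fact d"
  using N_increment_distribution[OF assms, of d] by (simp add: increment_def)

lemma prob_increment_ge_1:
  assumes "0 \<le> t" "t \<le> v" shows "prob (increment t v {1..}) \<le> mean t v"
proof -
  have "increment t v {1..} = space M - increment t v {0}" by (auto simp: increment_def)
  then have "prob (increment t v {1..}) = 1 - exp (- mean t v)"
    using prob_compl[OF increment_event, of t v "{0}"] assms by (simp add: prob_increment)
  also have "\<dots> \<le> mean t v" using exp_ge_add_one_self[of "- mean t v"] by simp
  finally show ?thesis .
qed

lemma prob_increment_ge_2:
  assumes "0 \<le> t" "t \<le> v" shows "prob (increment t v {2..}) \<le> (mean t v)\<^sup>2"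
proof -
  let ?L = "mean t v"
  have ev: "increment t v {d} \<in> events" for d using assms by simp
  have "increment t v {2..} = space M - (increment t v {0} \<union> increment t v {1})"
    by (auto simp: increment_def)
  then have "prob (increment t v {2..}) = 1 - prob (increment t v {0} \<union> increment t v {1})"
    using prob_compl[of "increment t v {0} \<union> increment t v {1}"] ev by auto
  also have "prob (increment t v {0} \<union> increment t v {1}) = exp (- ?L) + exp (- ?L) * ?L"
  proof -
    have "increment t v {0} \<inter> increment t v {1} = {}" by (auto simp: increment_def)
    then show ?thesis
      using finite_measure_Union[OF ev ev, of 0 1] prob_increment[OF assms, of 0] prob_increment[OF assms, of 1]
      by simp
  qed
  also have "1 - (exp (- ?L) + exp (- ?L) * ?L) \<le> ?L\<^sup>2"
  proof -
    have "(1 - ?L) * (1 + ?L) \<le> exp (- ?L) * (1 + ?L)"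
      using exp_ge_add_one_self[of "- ?L"] mean_nonneg[OF assms(1), of v] by (intro mult_right_mono) auto
    then show ?thesis by (simp add: algebra_simps power2_eq_square)
  qed
  finally show ?thesis .
qed

end

section \<open>Survival and end of the current service\<close>

context bulk_service_queue
begin

lemma state_events [measurable]:
  assumes "0 \<le> t"
  shows busy_in_event: "A \<in> sets borel \<Longrightarrow> busy_in t R A j \<in> events"
    and idle_in_event: "idle_in t R j \<in> events"
proof -
  have sub: "sets (history {0..t} UNIV) \<subseteq> events" by (rule sets_history_events) auto
  show "A \<in> sets borel \<Longrightarrow> busy_in t R A j \<in> events" "idle_in t R j \<in> events"
    using subsetD[OF sub busy_in_past[OF assms]] subsetD[OF sub idle_in_past[OF assms]] by blast+
qed

lemma measurable_fr [measurable]: "fr j \<in> borel_measurable M"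
  by (rule events_history[OF _ measurable_fr_history[of j UNIV]]) auto

lemma measurable_S [measurable]: "S j \<in> borel_measurable M"
  using S_exponential[of j] by (simp add: distributed_def)

lemma increment_history:
  assumes "0 \<le> t" "0 \<le> v" shows "increment t v \<Delta> \<in> sets (history {0..} J)"
proof -
  have [measurable]: "N t \<in> measurable (history {0..} J) (count_space UNIV)"
    "N v \<in> measurable (history {0..} J) (count_space UNIV)"
    by (rule measurable_N_history; use assms in simp)+
  have "{\<omega> \<in> space (history {0..} J). N v \<omega> - N t \<omega> \<in> \<Delta>} \<in> sets (history {0..} J)" by measurable
  then show ?thesis by (simp add: increment_def)
qed

lemma prob_past_increment:
  assumes "0 \<le> t" "t \<le> v" "E \<in> sets (history {0..t} UNIV)"
  shows "prob (E \<inter> increment t v \<Delta>) = prob E * prob (increment t v \<Delta>)"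
  unfolding increment_def by (rule indep_increment[OF assms])

text \<open>The order of the two independence arguments matters. With all arrivals known, lack of
  memory removes the survival condition. What remains is the busy event at \<open>t\<close>, which
  involves \<open>S j\<close> but no later arrival, and so it is independent of the
  increment.\<close>

lemma busy_survives_cycle:
  assumes t: "0 \<le> t" "t \<le> v" and A: "A \<in> sets borel"
  shows "prob (busy_in t R A j \<inter> increment t v \<Delta> \<inter> {\<omega> \<in> space M. ereal v < fr j \<omega>}) =
    exp (- (mu * (v - t))) * (prob (busy_in t R A j) * prob (increment t v \<Delta>))"
proof -
  let ?H = "history {0..} {..<j}"
  \<comment> \<open>The condition that the service still runs at \<open>t\<close> is left out, since
    it involves \<open>S j\<close>; it returns as \<open>V \<omega> < S j \<omega>\<close>. The
    clause on \<open>busy0\<close> ensures \<open>fr j = st j + S j\<close> also for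
    \<open>j = 0\<close>.\<close>
  define E where "E = {\<omega> \<in> space M. st j \<omega> \<le> ereal t \<and> waiting j t \<omega> \<in> R \<and> elapsed j t \<omega> \<in> A \<and>
    (j = 0 \<longrightarrow> busy0 \<omega>)} \<inter> increment t v \<Delta>"
  \<comment> \<open>On \<open>E\<close> this is the time from the start of the cycle to
    \<open>t\<close>; \<open>max 0\<close> makes it nonnegative everywhere, as
    \<open>memoryless\<close> demands.\<close>
  define V where "V \<omega> = max 0 (t - real_of_ereal (st j \<omega>))" for \<omega>
  have m[measurable]: "st j \<in> borel_measurable ?H" "waiting j t \<in> measurable ?H (count_space UNIV)"
    "elapsed j t \<in> borel_measurable ?H" "Measurable.pred ?H busy0" "A \<in> sets borel"
    "increment t v \<Delta> \<in> sets ?H"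
    using measurable_st_history(1)[of j "{..<j}"] measurable_waiting_history[of j "{..<j}" t]
      measurable_elapsed_history[of j "{..<j}" t] measurable_init_history(2) A t
      increment_history[of t v \<Delta> "{..<j}"]
    by auto
  have "{\<omega> \<in> space ?H. st j \<omega> \<le> ereal t \<and> waiting j t \<omega> \<in> R \<and> elapsed j t \<omega> \<in> A \<and> (j = 0 \<longrightarrow> busy0 \<omega>)}
      \<inter> increment t v \<Delta> \<in> sets ?H"
    by measurable
  then have E: "E \<in> sets ?H" unfolding E_def space_history .
  have V: "V \<in> borel_measurable ?H" unfolding V_def by measurable
  have V0: "0 \<le> V \<omega>" for \<omega> by (simp add: V_def)
  have fr: "ereal (t + h) < fr j \<omega> \<longleftrightarrow> V \<omega> + h < S j \<omega>" if w: "\<omega> \<in> E" for \<omega> h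
  proof -
    have "\<omega> \<in> space M" "st j \<omega> \<le> ereal t" using w by (auto simp: E_def)
    then have r: "ereal (real_of_ereal (st j \<omega>)) = st j \<omega>" "real_of_ereal (st j \<omega>) \<le> t"
      using service_path.start_real[OF service_path] by (auto, metis ereal_less_eq(3))
    have "fr j \<omega> = ereal (real_of_ereal (st j \<omega>) + S j \<omega>)"
    proof -
      have "\<not> (j = 0 \<and> \<not> busy0 \<omega>)" using w by (auto simp: E_def)
      then have "fr j \<omega> = ereal (real_of_ereal (st j \<omega>)) + ereal (S j \<omega>)"
        unfolding fst_cyc r(1) by (rule if_not_P)
      then show ?thesis by (simp only: plus_ereal.simps)
    qed
    then show ?thesis using r(2) by (auto simp: V_def)
  qed
  have "E \<subseteq> space M" by (auto simp: E_def)
  have busy_E: "busy_in t R A j \<inter> increment t v \<Delta> = E \<inter> {\<omega> \<in> space M. V \<omega> < S j \<omega>}"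
  proof -
    \<comment> \<open>An initially idle server has \<open>fr 0 = 0 \<le> t\<close>.\<close>
    have "j = 0 \<longrightarrow> busy0 \<omega>" if "ereal t < fr j \<omega>" for \<omega>
      using that t by (auto simp: zero_ereal_def split: if_splits)
    then have "busy_in t R A j \<inter> increment t v \<Delta> = E \<inter> {\<omega>. ereal t < fr j \<omega>}"
      unfolding busy_in_def E_def by blast
    also have "\<dots> = E \<inter> {\<omega> \<in> space M. V \<omega> < S j \<omega>}" using fr[of _ 0] \<open>E \<subseteq> space M\<close> by auto
    finally show ?thesis .
  qed
  have "busy_in t R A j \<inter> increment t v \<Delta> \<inter> {\<omega> \<in> space M. ereal v < fr j \<omega>} =
      E \<inter> {\<omega> \<in> space M. V \<omega> + (v - t) < S j \<omega>}"
    unfolding busy_E using fr[of _ "v - t"] t by auto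
  then have "prob (busy_in t R A j \<inter> increment t v \<Delta> \<inter> {\<omega> \<in> space M. ereal v < fr j \<omega>}) =
      exp (- (mu * (v - t))) * prob (busy_in t R A j \<inter> increment t v \<Delta>)"
    unfolding busy_E using memoryless[OF E V V0, of "v - t"] t by simp
  then show ?thesis using prob_past_increment[OF t busy_in_past[OF t(1) A]] by simp
qed

lemma busy_survives:
  assumes t: "0 \<le> t" "t \<le> v" and A: "A \<in> sets borel"
  shows "prob (\<Union>j. busy_in t R A j \<inter> increment t v \<Delta> \<inter> {\<omega> \<in> space M. ereal v < fr j \<omega>}) =
    exp (- (mu * (v - t))) * prob (increment t v \<Delta>) * prob (\<Union>j. busy_in t R A j)"
proof (rule prob_UN_scale)
  have [measurable]: "increment t v \<Delta> \<in> events" "busy_in t R A j \<in> events" for j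
    using t A by (auto intro: busy_in_event)
  show "busy_in t R A j \<in> events" for j by measurable
  show "busy_in t R A j \<inter> increment t v \<Delta> \<inter> {\<omega> \<in> space M. ereal v < fr j \<omega>} \<in> events" for j by measurable
  show "i = j" if "\<omega> \<in> busy_in t R A i" "\<omega> \<in> busy_in t R A j" for i j \<omega>
    by (rule busy_in_index_unique[OF that])
  show "prob (busy_in t R A j \<inter> increment t v \<Delta> \<inter> {\<omega> \<in> space M. ereal v < fr j \<omega>}) =
      exp (- (mu * (v - t))) * prob (increment t v \<Delta>) * prob (busy_in t R A j)" for j
    unfolding busy_survives_cycle[OF assms] by simp
qed blast

lemma busy_ends_cycle:
  assumes t: "0 \<le> t" "t \<le> v" and A: "A \<in> sets borel"
  shows "prob (busy_in t R A j \<inter> increment t v \<Delta> \<inter> {\<omega> \<in> space M. fr j \<omega> \<le> ereal v}) =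
    (1 - exp (- (mu * (v - t)))) * (prob (busy_in t R A j) * prob (increment t v \<Delta>))"
proof -
  have [measurable]: "increment t v \<Delta> \<in> events" "busy_in t R A j \<in> events"
    using t A by (auto intro: busy_in_event)
  let ?X = "busy_in t R A j \<inter> increment t v \<Delta>" and ?Y = "{\<omega> \<in> space M. ereal v < fr j \<omega>}"
  have "?X \<inter> {\<omega> \<in> space M. fr j \<omega> \<le> ereal v} = ?X - ?X \<inter> ?Y"
    by (auto simp: increment_def)
  then have "prob (?X \<inter> {\<omega> \<in> space M. fr j \<omega> \<le> ereal v}) = prob ?X - prob (?X \<inter> ?Y)"
    using finite_measure_Diff[of ?X "?X \<inter> ?Y"] by auto
  then show ?thesis
    using busy_survives_cycle[OF assms, of R j \<Delta>] prob_past_increment[OF t busy_in_past[OF t(1) A]]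
    by (simp add: algebra_simps)
qed

lemma busy_ends:
  assumes t: "0 \<le> t" "t \<le> v" and A: "A \<in> sets borel"
  shows "prob (\<Union>j. busy_in t R A j \<inter> increment t v \<Delta> \<inter> {\<omega> \<in> space M. fr j \<omega> \<le> ereal v}) =
    (1 - exp (- (mu * (v - t)))) * prob (increment t v \<Delta>) * prob (\<Union>j. busy_in t R A j)"
proof (rule prob_UN_scale)
  have [measurable]: "increment t v \<Delta> \<in> events" "busy_in t R A j \<in> events" for j
    using t A by (auto intro: busy_in_event)
  show "busy_in t R A j \<in> events" for j by measurable
  show "busy_in t R A j \<inter> increment t v \<Delta> \<inter> {\<omega> \<in> space M. fr j \<omega> \<le> ereal v} \<in> events" for j by measurable
  show "i = j" if "\<omega> \<in> busy_in t R A i" "\<omega> \<in> busy_in t R A j" for i j \<omega>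
    by (rule busy_in_index_unique[OF that])
  show "prob (busy_in t R A j \<inter> increment t v \<Delta> \<inter> {\<omega> \<in> space M. fr j \<omega> \<le> ereal v}) =
      (1 - exp (- (mu * (v - t)))) * prob (increment t v \<Delta>) * prob (busy_in t R A j)" for j
    unfolding busy_ends_cycle[OF assms] by simp
qed blast

lemma prob_service_le:
  assumes "E \<in> sets (history {0..} {..<j})" "0 \<le> h"
  shows "prob (E \<inter> {\<omega> \<in> space M. S j \<omega> \<le> h}) = (1 - exp (- (mu * h))) * prob E"
proof -
  have "prob (E \<inter> (S j -` {..h} \<inter> space M)) = prob E * prob (S j -` {..h} \<inter> space M)"
    by (rule indep_setD[OF indep_service assms(1)]) (intro sigma_sets.Basic CollectI exI[of _ "{..h}"], simp)
  moreover have "S j -` {..h} \<inter> space M = {\<omega> \<in> space M. S j \<omega> \<le> h}" by auto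
  ultimately show ?thesis
    using exponential_distributedD_le[OF S_exponential assms(2) mu_pos, of j] by (simp add: mult.commute)
qed

text \<open>The end of service \<open>j\<close> is decided by the arrivals and the services up to
  \<open>j\<close>, so the shortness of service \<open>Suc j\<close> contributes an independent
  second factor.\<close>

lemma busy_ends_twice:
  assumes t: "0 \<le> t" "t \<le> v"
  shows "prob (\<Union>j. busy_in t UNIV UNIV j \<inter> {\<omega> \<in> space M. fr j \<omega> \<le> ereal v} \<inter> {\<omega> \<in> space M. S (Suc j) \<omega> \<le> v - t})
    = (1 - exp (- (mu * (v - t))))\<^sup>2 * prob (\<Union>j. busy_in t UNIV UNIV j)"
proof (rule prob_UN_scale)
  have [measurable]: "busy_in t UNIV UNIV j \<in> events" for j using t by (auto intro: busy_in_event)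
  show "busy_in t UNIV UNIV j \<in> events" for j by measurable
  show "busy_in t UNIV UNIV j \<inter> {\<omega> \<in> space M. fr j \<omega> \<le> ereal v} \<inter> {\<omega> \<in> space M. S (Suc j) \<omega> \<le> v - t} \<in> events" for j
    by measurable
  show "prob (busy_in t UNIV UNIV j \<inter> {\<omega> \<in> space M. fr j \<omega> \<le> ereal v} \<inter> {\<omega> \<in> space M. S (Suc j) \<omega> \<le> v - t})
    = (1 - exp (- (mu * (v - t))))\<^sup>2 * prob (busy_in t UNIV UNIV j)" for j
  proof -
    let ?H = "history {0..} {..<Suc j}"
    have [measurable]: "busy_in t UNIV UNIV j \<in> sets ?H" "fr j \<in> borel_measurable ?H"
      using t by (auto intro!: busy_in_history measurable_fr_history)
    have "busy_in t UNIV UNIV j \<inter> {\<omega> \<in> space ?H. fr j \<omega> \<le> ereal v} \<in> sets ?H" by measurable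
    then have "prob (busy_in t UNIV UNIV j \<inter> {\<omega> \<in> space M. fr j \<omega> \<le> ereal v} \<inter> {\<omega> \<in> space M. S (Suc j) \<omega> \<le> v - t})
      = (1 - exp (- (mu * (v - t)))) * prob (busy_in t UNIV UNIV j \<inter> {\<omega> \<in> space M. fr j \<omega> \<le> ereal v})"
      by (intro prob_service_le) (use t in auto)
    \<comment> \<open>With \<open>UNIV\<close> the condition on arrivals is void, and
      \<open>busy_ends_cycle\<close> supplies the first factor.\<close>
    moreover have "busy_in t UNIV UNIV j \<inter> increment t v UNIV = busy_in t UNIV UNIV j"
      "increment t v UNIV = space M"
      by (auto simp: busy_in_def increment_def)
    ultimately show ?thesis
      using busy_ends_cycle[OF t, of UNIV UNIV j UNIV] by (simp add: prob_space power2_eq_square)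
  qed
  show "i = j" if "\<omega> \<in> busy_in t UNIV UNIV i" "\<omega> \<in> busy_in t UNIV UNIV j" for i j \<omega>
    by (rule busy_in_index_unique[OF that])
qed blast

lemma idle_starts_and_ends:
  assumes t: "0 \<le> t" "t \<le> v"
  shows "prob (\<Union>j. idle_in t UNIV j \<inter> increment t v \<Delta> \<inter> {\<omega> \<in> space M. S (Suc j) \<omega> \<le> v - t})
    = (1 - exp (- (mu * (v - t)))) * prob (increment t v \<Delta>) * prob (\<Union>j. idle_in t UNIV j)"
proof (rule prob_UN_scale)
  have [measurable]: "idle_in t UNIV j \<in> events" "increment t v \<Delta> \<in> events" for j
    using t by (auto intro: idle_in_event)
  show "idle_in t UNIV j \<in> events" for j by measurable
  show "idle_in t UNIV j \<inter> increment t v \<Delta> \<inter> {\<omega> \<in> space M. S (Suc j) \<omega> \<le> v - t} \<in> events" for j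
    by measurable
  show "prob (idle_in t UNIV j \<inter> increment t v \<Delta> \<inter> {\<omega> \<in> space M. S (Suc j) \<omega> \<le> v - t})
    = (1 - exp (- (mu * (v - t)))) * prob (increment t v \<Delta>) * prob (idle_in t UNIV j)" for j
  proof -
    let ?H = "history {0..} {..<Suc j}"
    have "idle_in t UNIV j \<inter> increment t v \<Delta> \<in> sets ?H"
      using t by (auto intro!: idle_in_history increment_history)
    then have "prob (idle_in t UNIV j \<inter> increment t v \<Delta> \<inter> {\<omega> \<in> space M. S (Suc j) \<omega> \<le> v - t})
      = (1 - exp (- (mu * (v - t)))) * prob (idle_in t UNIV j \<inter> increment t v \<Delta>)"
      by (intro prob_service_le) (use t in auto)
    then show ?thesis using prob_past_increment[OF t idle_in_past[OF t(1)]] by simp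
  qed
  show "i = j" if "\<omega> \<in> idle_in t UNIV i" "\<omega> \<in> idle_in t UNIV j" for i j \<omega>
    by (rule idle_in_index_unique[OF that])
qed blast

text \<open>The further service is only required to be short, not to have started. This enlarges the
  event but lets each piece factor into independent conditions.\<close>

definition double_events :: "real \<Rightarrow> real \<Rightarrow> 'a set" where
  "double_events t v = increment t v {2..}
    \<union> (\<Union>j. busy_in t UNIV UNIV j \<inter> increment t v {1..} \<inter> {\<omega> \<in> space M. fr j \<omega> \<le> ereal v})
    \<union> (\<Union>j. busy_in t UNIV UNIV j \<inter> {\<omega> \<in> space M. fr j \<omega> \<le> ereal v} \<inter> {\<omega> \<in> space M. S (Suc j) \<omega> \<le> v - t})
    \<union> (\<Union>j. idle_in t UNIV j \<inter> increment t v {1..} \<inter> {\<omega> \<in> space M. S (Suc j) \<omega> \<le> v - t})"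

lemma double_events_event:
  assumes t: "0 \<le> t" "t \<le> v" shows "double_events t v \<in> events"
proof -
  have [measurable]: "busy_in t UNIV UNIV j \<in> events" "idle_in t UNIV j \<in> events"
    "increment t v \<Delta> \<in> events" for j \<Delta>
    using t by (auto intro: idle_in_event busy_in_event)
  show ?thesis unfolding double_events_def by measurable
qed

lemma prob_double_events:
  assumes t: "0 \<le> t" "t \<le> v"
  shows "prob (double_events t v) \<le> (mean t v + mu * (v - t))\<^sup>2"
proof -
  have [measurable]: "busy_in t UNIV UNIV j \<in> events" "idle_in t UNIV j \<in> events"
    "increment t v \<Delta> \<in> events" for j \<Delta>
    using t by (auto intro: idle_in_event busy_in_event)
  let ?a = "1 - exp (- (mu * (v - t)))" and ?L = "mean t v"
  have a: "0 \<le> ?a" "?a \<le> mu * (v - t)"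
    using exp_ge_add_one_self[of "- (mu * (v - t))"] mu_pos t by auto
  have L: "0 \<le> ?L" by (rule mean_nonneg[OF t(1)])
  let ?A = "increment t v {2..}"
  let ?B = "\<Union>j. busy_in t UNIV UNIV j \<inter> increment t v {1..} \<inter> {\<omega> \<in> space M. fr j \<omega> \<le> ereal v}"
  let ?C = "\<Union>j. busy_in t UNIV UNIV j \<inter> {\<omega> \<in> space M. fr j \<omega> \<le> ereal v} \<inter> {\<omega> \<in> space M. S (Suc j) \<omega> \<le> v - t}"
  let ?D = "\<Union>j. idle_in t UNIV j \<inter> increment t v {1..} \<inter> {\<omega> \<in> space M. S (Suc j) \<omega> \<le> v - t}"
  have ev: "?A \<in> events" "?B \<in> events" "?C \<in> events" "?D \<in> events" by measurable
  have "prob (double_events t v) \<le> prob ?A + prob ?B + prob ?C + prob ?D"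
    unfolding double_events_def
    using measure_Un_le[OF ev(1,2)] measure_Un_le[OF sets.Un[OF ev(1,2)] ev(3)]
      measure_Un_le[OF sets.Un[OF sets.Un[OF ev(1,2)] ev(3)] ev(4)]
    by linarith
  moreover have "prob ?A \<le> ?L\<^sup>2" by (rule prob_increment_ge_2[OF t])
  moreover have "prob ?B \<le> ?a * ?L"
  proof -
    have "prob ?B = ?a * prob (increment t v {1..}) * prob (\<Union>j. busy_in t UNIV UNIV j)"
      by (rule busy_ends[OF t]) simp
    also have "\<dots> \<le> ?a * ?L * 1"
      using a L prob_increment_ge_1[OF t] by (intro mult_mono) auto
    finally show ?thesis by simp
  qed
  moreover have "prob ?C \<le> ?a\<^sup>2"
    unfolding busy_ends_twice[OF t] by (rule mult_left_le) auto
  moreover have "prob ?D \<le> ?a * ?L"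
  proof -
    have "prob ?D = ?a * prob (increment t v {1..}) * prob (\<Union>j. idle_in t UNIV j)"
      by (rule idle_starts_and_ends[OF t])
    also have "\<dots> \<le> ?a * ?L * 1"
      using a L prob_increment_ge_1[OF t] by (intro mult_mono) auto
    finally show ?thesis by simp
  qed
  \<comment> \<open>The four bounds \<open>L^2\<close>, \<open>a L\<close>, \<open>a^2\<close>,
    \<open>a L\<close> add up to the square of \<open>L + a\<close>, where \<open>a\<close> is the
    probability that an exponential service ends within \<open>v - t\<close>.\<close>
  ultimately have "prob (double_events t v) \<le> (?L + ?a)\<^sup>2"
    by (simp add: power2_eq_square algebra_simps)
  also have "\<dots> \<le> (?L + mu * (v - t))\<^sup>2" using a L by (intro power_mono) auto
  finally show ?thesis .
qed

definition busy_prob :: "nat \<Rightarrow> real \<Rightarrow> real" where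
  "busy_prob r t = prob (\<Union>j. busy_in t {r} UNIV j)"

lemma idle_prob_eq: "idle_prob r t = prob (\<Union>j. idle_in t {r} j)"
  unfolding idle_prob_def idle_with_eq ..

lemma idle_one_step_outside:
  assumes t: "0 \<le> t" "t \<le> v" and r: "r < k" and w: "\<omega> \<in> space M" "\<omega> \<notin> double_events t v"
  shows "\<omega> \<in> (\<Union>j. idle_in v {r} j) \<longleftrightarrow>
    \<omega> \<in> (\<Union>j. idle_in t {r} j) \<inter> increment t v {0} \<or>
    (1 \<le> r \<and> \<omega> \<in> (\<Union>j. idle_in t {r - 1} j) \<inter> increment t v {1}) \<or>
    \<omega> \<in> (\<Union>j. busy_in t {r} UNIV j \<inter> increment t v {0} \<inter> {\<omega> \<in> space M. fr j \<omega> \<le> ereal v})"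
proof -
  interpret p: service_path "\<lambda>u. N u \<omega>" k B "Q0 \<omega>" "busy0 \<omega>" "\<lambda>i. S i \<omega>" by (rule service_path) fact
  have busy: "p.busy j t x \<longleftrightarrow> \<omega> \<in> busy_in t {x} UNIV j" for j x
    using w by (auto simp: p.busy_def busy_in_def waiting_def)
  have idle: "p.idle j u x \<longleftrightarrow> \<omega> \<in> idle_in u {x} j" for j x u
    using w by (auto simp: p.idle_def idle_in_def waiting_def)
  have "\<not> p.double_event t v"
  proof
    assume "p.double_event t v"
    then consider "2 \<le> N v \<omega> - N t \<omega>"
      | j x where "p.busy j t x" "fr j \<omega> \<le> ereal v" "1 \<le> N v \<omega> - N t \<omega>"
      | j x where "p.busy j t x" "fr j \<omega> \<le> ereal v" "S (Suc j) \<omega> \<le> v - t"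
      | j x where "p.idle j t x" "1 \<le> N v \<omega> - N t \<omega>" "S (Suc j) \<omega> \<le> v - t"
      unfolding p.double_event_def by blast
    then show False
    proof cases
      case 1
      then show ?thesis using w by (auto simp: double_events_def increment_def)
    next
      case (2 j)
      then have "\<omega> \<in> busy_in t UNIV UNIV j \<inter> increment t v {1..} \<inter> {\<omega> \<in> space M. fr j \<omega> \<le> ereal v}"
        using w(1) unfolding busy by (auto simp: busy_in_def increment_def)
      then show ?thesis using w(2) unfolding double_events_def by blast
    next
      case (3 j)
      then have "\<omega> \<in> busy_in t UNIV UNIV j \<inter> {\<omega> \<in> space M. fr j \<omega> \<le> ereal v} \<inter> {\<omega> \<in> space M. S (Suc j) \<omega> \<le> v - t}"
        using w(1) unfolding busy by (auto simp: busy_in_def)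
      then show ?thesis using w(2) unfolding double_events_def by blast
    next
      case (4 j)
      then have "\<omega> \<in> idle_in t UNIV j \<inter> increment t v {1..} \<inter> {\<omega> \<in> space M. S (Suc j) \<omega> \<le> v - t}"
        using w(1) unfolding idle by (auto simp: idle_in_def increment_def)
      then show ?thesis using w(2) unfolding double_events_def by blast
    qed
  qed
  from p.idle_one_step[OF t r this] show ?thesis
    unfolding busy idle using w(1) by (simp add: increment_def) blast
qed

text \<open>The three one-event transitions are disjoint and their probabilities factor exactly; all
  error comes from the double events. The term with \<open>r - 1\<close> drops out at
  \<open>r = 0\<close>, so one statement covers both kinds of idle equation.\<close>

lemma idle_one_step_prob:
  assumes t: "0 \<le> t" "t \<le> v" and r: "r < k"
  shows "\<bar>idle_prob r v - exp (- mean t v) * (idle_prob r t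
      + (if 1 \<le> r then mean t v * idle_prob (r - 1) t else 0)
      + (1 - exp (- (mu * (v - t)))) * busy_prob r t)\<bar> \<le> (mean t v + mu * (v - t))\<^sup>2"
proof -
  have ev[measurable]: "busy_in t R UNIV j \<in> events" "idle_in t R j \<in> events"
    "increment t v \<Delta> \<in> events" "idle_in v R j \<in> events" for j \<Delta> R
    using t by (auto intro: idle_in_event busy_in_event)
  let ?A = "(\<Union>j. idle_in t {r} j) \<inter> increment t v {0}"
  let ?B = "if 1 \<le> r then (\<Union>j. idle_in t {r - 1} j) \<inter> increment t v {1} else {}"
  let ?C = "\<Union>j. busy_in t {r} UNIV j \<inter> increment t v {0} \<inter> {\<omega> \<in> space M. fr j \<omega> \<le> ereal v}"
  have U: "(\<Union>j. idle_in t R j) \<in> events" for R by measurable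
  have "?A \<in> events" "?B \<in> events" using sets.Int[OF U ev(3)] by simp_all
  moreover have "?C \<in> events" by measurable
  ultimately have evs: "?A \<in> events" "?B \<in> events" "?C \<in> events" by blast+
  have disj: "?A \<inter> ?B = {}" "(?A \<union> ?B) \<inter> ?C = {}"
  proof -
    show "?A \<inter> ?B = {}" by (auto simp: increment_def)
    have "\<omega> \<notin> busy_in t {r} UNIV j" if "\<omega> \<in> idle_in t R i" for \<omega> i j R
    proof -
      have w: "\<omega> \<in> space M" using that by (simp add: idle_in_def)
      interpret p: service_path "\<lambda>u. N u \<omega>" k B "Q0 \<omega>" "busy0 \<omega>" "\<lambda>i. S i \<omega>" by (rule service_path) fact
      show ?thesis using that p.idle_not_busy[of i t _ j]
        unfolding p.idle_def p.busy_def busy_in_def idle_in_def by blast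
    qed
    then show "(?A \<union> ?B) \<inter> ?C = {}" by (auto split: if_splits)
  qed
  have "\<bar>idle_prob r v - prob (?A \<union> ?B \<union> ?C)\<bar> \<le> prob (double_events t v)"
    unfolding idle_prob_eq
  proof (rule prob_diff_le)
    show "(\<Union>j. idle_in v {r} j) \<in> events" by measurable
    show "?A \<union> ?B \<union> ?C \<in> events" using evs by blast
    show "double_events t v \<in> events" by (rule double_events_event[OF t])
    show "\<omega> \<in> (\<Union>j. idle_in v {r} j) \<longleftrightarrow> \<omega> \<in> ?A \<union> ?B \<union> ?C" if "\<omega> \<in> space M" "\<omega> \<notin> double_events t v" for \<omega>
      using idle_one_step_outside[OF t r that] by simp
  qed
  also have "\<dots> \<le> (mean t v + mu * (v - t))\<^sup>2" by (rule prob_double_events[OF t])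
  also have "prob (?A \<union> ?B \<union> ?C) = prob ?A + prob ?B + prob ?C"
    using finite_measure_Union[OF sets.Un[OF evs(1,2)] evs(3) disj(2)] finite_measure_Union[OF evs(1,2) disj(1)]
    by simp
  also have "prob ?A = exp (- mean t v) * idle_prob r t"
  proof -
    have "(\<Union>j. idle_in t {r} j) \<in> sets (history {0..t} UNIV)" using idle_in_past[OF t(1)] by blast
    then show ?thesis unfolding idle_prob_eq by (simp add: prob_past_increment[OF t] prob_increment[OF t])
  qed
  also have "prob ?B = exp (- mean t v) * (if 1 \<le> r then mean t v * idle_prob (r - 1) t else 0)"
  proof -
    have "(\<Union>j. idle_in t {r - 1} j) \<in> sets (history {0..t} UNIV)" using idle_in_past[OF t(1)] by blast
    then show ?thesis unfolding idle_prob_eq by (simp add: prob_past_increment[OF t] prob_increment[OF t])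
  qed
  also have "prob ?C = exp (- mean t v) * ((1 - exp (- (mu * (v - t)))) * busy_prob r t)"
    unfolding busy_prob_def by (subst busy_ends[OF t]) (simp_all add: prob_increment[OF t])
  finally show ?thesis by (simp add: algebra_simps)
qed

text \<open>The constant 4 counts four errors, each at most \<open>(L + x)^2\<close>: the double
  events and the linearizations of the three transition factors.\<close>

lemma idle_prob_expansion:
  assumes t: "0 \<le> t" "t \<le> v" and r: "r < k"
  shows "\<bar>idle_prob r v - idle_prob r t - (- mean t v * idle_prob r t
      + mean t v * (if 1 \<le> r then idle_prob (r - 1) t else 0)
      + mu * (v - t) * busy_prob r t)\<bar> \<le> 4 * (mean t v + mu * (v - t))\<^sup>2"
proof -
  define L where "L = mean t v"
  define x where "x = mu * (v - t)"
  have L: "0 \<le> L" unfolding L_def by (rule mean_nonneg[OF t(1)])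
  have x: "0 \<le> x" unfolding x_def using mu_pos t by simp
  define p where "p = idle_prob r t"
  define q where "q = (if 1 \<le> r then idle_prob (r - 1) t else 0)"
  define b where "b = busy_prob r t"
  have pqb: "0 \<le> p" "p \<le> 1" "0 \<le> q" "q \<le> 1" "0 \<le> b" "b \<le> 1"
    by (auto simp: p_def q_def b_def idle_prob_eq busy_prob_def)
  note e = exp_bounds[OF L x]
  have s: "\<bar>a * y\<bar> \<le> c" if "\<bar>a\<bar> \<le> c" "0 \<le> y" "y \<le> 1" for a y c :: real
    using mult_mono[of "\<bar>a\<bar>" c "\<bar>y\<bar>" 1] that by (simp add: abs_mult)
  have "\<bar>idle_prob r v - exp (- L) * (p + L * q + (1 - exp (- x)) * b)\<bar> \<le> (L + x)\<^sup>2"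
    using idle_one_step_prob[OF assms] unfolding L_def x_def p_def q_def b_def by (cases "1 \<le> r") auto
  moreover have "\<bar>(exp (- L) - 1 + L) * p\<bar> \<le> L\<^sup>2" using e(1) pqb by (intro s)
  moreover have "\<bar>(exp (- L) * L - L) * q\<bar> \<le> L\<^sup>2" using e(2) pqb by (intro s)
  moreover have "\<bar>(exp (- L) * (1 - exp (- x)) - x) * b\<bar> \<le> x\<^sup>2 + L * x" using e(3) pqb by (intro s)
  moreover have "idle_prob r v - p - (- L * p + L * q + x * b) =
    (idle_prob r v - exp (- L) * (p + L * q + (1 - exp (- x)) * b)) + (exp (- L) - 1 + L) * p
     + (exp (- L) * L - L) * q + (exp (- L) * (1 - exp (- x)) - x) * b"
    by (simp add: algebra_simps)
  ultimately have "\<bar>idle_prob r v - p - (- L * p + L * q + x * b)\<bar> \<le> (L + x)\<^sup>2 + L\<^sup>2 + L\<^sup>2 + (x\<^sup>2 + L * x)"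
    by linarith
  also have "\<dots> \<le> 4 * (L + x)\<^sup>2" using L x by (simp add: algebra_simps power2_eq_square)
  finally show ?thesis unfolding L_def x_def p_def q_def b_def .
qed

text \<open>The state can change only by an arrival or by the end of the current service, and both
  have first-order probability. The resulting continuity is what a derivative from the left
  requires.\<close>

lemma state_prob_change:
  assumes t: "0 \<le> t" "t \<le> v"
  shows "\<bar>idle_prob r v - idle_prob r t\<bar> \<le> mean t v + mu * (v - t)" (is ?I)
    and "\<bar>busy_prob r v - busy_prob r t\<bar> \<le> mean t v + mu * (v - t)" (is ?B)
proof -
  have ev[measurable]: "busy_in t R UNIV j \<in> events" "idle_in t R j \<in> events"
    "increment t v \<Delta> \<in> events" "idle_in v R j \<in> events" "busy_in v R UNIV j \<in> events" for j \<Delta> R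
    using t by (auto intro: idle_in_event busy_in_event)
  let ?X = "\<Union>j. busy_in t UNIV UNIV j \<inter> increment t v UNIV \<inter> {\<omega> \<in> space M. fr j \<omega> \<le> ereal v}"
  let ?E = "increment t v {1..} \<union> ?X"
  have X: "?X \<in> events" by measurable
  then have E: "?E \<in> events" by measurable
  have out: "(\<omega> \<in> (\<Union>j. busy_in v {r} UNIV j) \<longleftrightarrow> \<omega> \<in> (\<Union>j. busy_in t {r} UNIV j)) \<and>
      (\<omega> \<in> (\<Union>j. idle_in v {r} j) \<longleftrightarrow> \<omega> \<in> (\<Union>j. idle_in t {r} j))"
    if w: "\<omega> \<in> space M" "\<omega> \<notin> ?E" for \<omega>
  proof -
    interpret p: service_path "\<lambda>u. N u \<omega>" k B "Q0 \<omega>" "busy0 \<omega>" "\<lambda>i. S i \<omega>" by (rule service_path) fact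
    have n: "N v \<omega> = N t \<omega>"
      using w N_mono[OF w(1) t] by (auto simp: increment_def)
    have "\<not> (\<exists>j x. p.busy j t x \<and> fr j \<omega> \<le> ereal v)"
    proof
      assume "\<exists>j x. p.busy j t x \<and> fr j \<omega> \<le> ereal v"
      then obtain j x where "p.busy j t x" "fr j \<omega> \<le> ereal v" by blast
      then have "\<omega> \<in> busy_in t UNIV UNIV j \<inter> increment t v UNIV \<inter> {\<omega> \<in> space M. fr j \<omega> \<le> ereal v}"
        using w(1) by (auto simp: p.busy_def busy_in_def increment_def)
      then show False using w(2) by blast
    qed
    from p.busy_unchanged[OF t n this, of r] show ?thesis
      using path_busy_iff[OF w(1)] path_idle_iff[OF w(1)] by simp
  qed
  have "prob ?E \<le> prob (increment t v {1..}) + prob ?X"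
    by (rule measure_Un_le) (use X in auto)
  also have "prob ?X \<le> mu * (v - t)"
  proof -
    have "prob ?X = (1 - exp (- (mu * (v - t)))) * prob (increment t v UNIV) * prob (\<Union>j. busy_in t UNIV UNIV j)"
      by (rule busy_ends[OF t]) simp
    also have "\<dots> \<le> (mu * (v - t)) * 1 * 1"
      using exp_ge_add_one_self[of "- (mu * (v - t))"] mu_pos t by (intro mult_mono) auto
    finally show ?thesis by simp
  qed
  finally have PE: "prob ?E \<le> mean t v + mu * (v - t)" using prob_increment_ge_1[OF t] by simp
  have U: "(\<Union>j. busy_in t {r} UNIV j) \<in> events" "(\<Union>j. busy_in v {r} UNIV j) \<in> events"
    "(\<Union>j. idle_in t {r} j) \<in> events" "(\<Union>j. idle_in v {r} j) \<in> events"
    by measurable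
  show ?I unfolding idle_prob_eq
    by (rule order_trans[OF prob_diff_le[OF U(4,3) E] PE], rule out[THEN conjunct2])
  show ?B unfolding busy_prob_def
    by (rule order_trans[OF prob_diff_le[OF U(2,1) E] PE], rule out[THEN conjunct1])
qed

end

section \<open>Derivatives\<close>

text \<open>Ordering the endpoints by \<open>min\<close> and \<open>max\<close> and dividing by the
  distance changes two signs or none, so the usual difference quotient is recovered on both sides of
  \<open>t\<close>.\<close>

lemma integral_quotient_tendsto:
  fixes f :: "real \<Rightarrow> real"
  assumes cont: "continuous_on {0..} f" and t: "0 \<le> t"
  shows "((\<lambda>y. integral {min t y..max t y} f / \<bar>y - t\<bar>) \<longlongrightarrow> f t) (at t within {0..})"
proof -
  have int: "f integrable_on {a..b}" if "0 \<le> a" for a b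
    by (rule integrable_continuous_real) (rule continuous_on_subset[OF cont], use that in auto)
  have "((\<lambda>x. integral {0..x} f) has_real_derivative f t) (at t within {0..t + 1})"
    by (rule integral_has_real_derivative) (use t in \<open>auto intro: continuous_on_subset[OF cont]\<close>)
  moreover have "at t within {0..t + 1} = at t within {0..}"
    by (rule at_within_nhd[of _ "{..<t + 1}"]) (use t in auto)
  ultimately have lim: "((\<lambda>y. (integral {0..y} f - integral {0..t} f) / (y - t)) \<longlongrightarrow> f t) (at t within {0..})"
    by (simp add: has_field_derivative_iff)
  have "integral {min t y..max t y} f / \<bar>y - t\<bar> = (integral {0..y} f - integral {0..t} f) / (y - t)"
    if "y \<noteq> t" "y \<in> {0..}" for y
  proof (cases "t \<le> y")
    case True
    have "integral {0..t} f + integral {t..y} f = integral {0..y} f"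
      by (rule Henstock_Kurzweil_Integration.integral_combine) (use True t int in auto)
    then show ?thesis using True by (simp add: field_simps)
  next
    case False
    have "integral {0..y} f + integral {y..t} f = integral {0..t} f"
      by (rule Henstock_Kurzweil_Integration.integral_combine) (use False that int in auto)
    then have "integral {0..y} f - integral {0..t} f = - integral {y..t} f" by simp
    then show ?thesis
      using False minus_divide_divide[of "integral {y..t} f" "t - y"] by (simp add: min_def max_def)
  qed
  then show ?thesis using lim by (subst Lim_cong_within[OF refl refl refl]) auto
qed

text \<open>The integral from a fixed left end vanishes identically, and \<open>f x\<close> is its
  derivative.\<close>

lemma continuous_zero_if_integrals_zero:
  fixes f :: "real \<Rightarrow> real"
  assumes cont: "continuous_on {a<..<b} f" and x: "x \<in> {a<..<b}"
    and zero: "\<And>c d. a < c \<Longrightarrow> c < d \<Longrightarrow> d < b \<Longrightarrow> (LINT y:{c..d}|lborel. f y) = 0"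
  shows "f x = 0"
proof -
  obtain c d where cd: "a < c" "c < x" "x < d" "d < b" using x dense[of a x] dense[of x b] by auto
  have sub: "continuous_on {c..u} f" if "u \<le> d" for u
    by (rule continuous_on_subset[OF cont]) (use cd that in auto)
  have int0: "integral {c..u} f = 0" if u: "u \<in> {c..d}" for u
  proof (cases "u = c")
    case False
    have "(LINT y:{c..u}|lborel. f y) = integral {c..u} f"
      by (rule set_borel_integral_eq_integral(2), rule borel_integrable_atLeastAtMost', rule sub) (use u in auto)
    then show ?thesis using zero[of c u] u cd False by auto
  qed simp
  have "((\<lambda>u. integral {c..u} f) has_real_derivative f x) (at x within {c..d})"
    by (rule integral_has_real_derivative) (use sub[of d] cd in auto)
  then have "((\<lambda>u. 0) has_real_derivative f x) (at x within {c..d})"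
    by (rule has_field_derivative_transform_within[where d=1]) (use int0 cd in auto)
  moreover have "at x within {c..d} = at x"
    by (rule at_within_Icc_at) (use cd in auto)
  ultimately have "((\<lambda>u. 0) has_real_derivative f x) (at x)" by simp
  from DERIV_unique[OF this DERIV_const] show ?thesis .
qed

section \<open>Differential equations of the idle states\<close>

context bulk_service_queue
begin

text \<open>Both one-sided quotients are treated at once by expanding from \<open>min t y\<close> to
  \<open>max t y\<close>. For \<open>y < t\<close> the probabilities on the right are taken at
  \<open>y\<close>, so they still have to converge to their values at \<open>t\<close>.\<close>

lemma idle_prob_derivative:
  assumes t: "0 \<le> t" and r: "r < k"
  shows "(idle_prob r has_real_derivative
    - lam t * idle_prob r t + lam t * (if 1 \<le> r then idle_prob (r - 1) t else 0) + mu * busy_prob r t)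
    (at t within {0..})"
proof -
  let ?F = "at t within {0..}"
  define q where "q s = (if 1 \<le> r then idle_prob (r - 1) s else 0)" for s
  define h where "h y = \<bar>y - t\<bar>" for y
  define L where "L y = mean (min t y) (max t y)" for y
  define R where "R y = L y / h y" for y
  have R: "(R \<longlongrightarrow> lam t) ?F"
    unfolding R_def L_def h_def by (rule integral_quotient_tendsto[OF lam_continuous t])
  have h: "(h \<longlongrightarrow> 0) ?F"
    unfolding h_def by (intro tendsto_rabs_zero LIM_zero tendsto_ident_at)
  have ev: "eventually (\<lambda>y. y \<noteq> t \<and> 0 \<le> y) ?F"
    by (simp add: eventually_at_filter)
  have RL: "R y * h y = L y" if "y \<noteq> t" for y using that by (simp add: R_def h_def)
  have "((\<lambda>y. R y * h y + mu * h y) \<longlongrightarrow> lam t * 0 + mu * 0) ?F"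
    by (intro tendsto_intros R h)
  then have bound: "((\<lambda>y. R y * h y + mu * h y) \<longlongrightarrow> 0) ?F" by simp
  \<comment> \<open>There is something to prove only for \<open>y < t\<close>, where the change from
    \<open>y\<close> to \<open>t\<close> is bounded by a quantity that tends to 0.\<close>
  have cont: "((\<lambda>y. f (min t y)) \<longlongrightarrow> f t) ?F"
    if f: "\<And>s v. 0 \<le> s \<Longrightarrow> s \<le> v \<Longrightarrow> \<bar>f v - f s\<bar> \<le> mean s v + mu * (v - s)" for f :: "real \<Rightarrow> real"
  proof (rule LIM_zero_cancel, rule Lim_null_comparison[OF _ bound])
    show "eventually (\<lambda>y. norm (f (min t y) - f t) \<le> R y * h y + mu * h y) ?F"
      using ev
    proof eventually_elim
      case (elim y)
      show ?case
      proof (cases "t \<le> y")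
        case True
        then show ?thesis using mean_nonneg[OF t, of y] mu_pos elim
          by (simp add: RL) (simp add: L_def h_def)
      next
        case False
        then show ?thesis using f[of y t] elim by (simp add: RL) (simp add: L_def h_def abs_minus_commute)
      qed
    qed
  qed
  have ci: "((\<lambda>y. idle_prob m (min t y)) \<longlongrightarrow> idle_prob m t) ?F" for m
    by (rule cont) (rule state_prob_change)
  have cb: "((\<lambda>y. busy_prob r (min t y)) \<longlongrightarrow> busy_prob r t) ?F"
    by (rule cont) (rule state_prob_change)
  have cq: "((\<lambda>y. q (min t y)) \<longlongrightarrow> q t) ?F" using ci unfolding q_def by (cases "1 \<le> r") auto
  \<comment> \<open>The first-order part of the expansion divided by the distance, with the
    probabilities frozen at the earlier time.\<close>
  define G where "G y = - R y * idle_prob r (min t y) + R y * q (min t y) + mu * busy_prob r (min t y)" for y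
  have G: "(G \<longlongrightarrow> - lam t * idle_prob r t + lam t * q t + mu * busy_prob r t) ?F"
    unfolding G_def by (intro tendsto_intros R ci cb cq)
  let ?Q = "\<lambda>y. (idle_prob r y - idle_prob r t) / (y - t)"
  have "((\<lambda>y. 4 * (R y + mu)\<^sup>2 * h y) \<longlongrightarrow> 4 * (lam t + mu)\<^sup>2 * 0) ?F"
    by (intro tendsto_intros R h)
  then have b2: "((\<lambda>y. 4 * (R y + mu)\<^sup>2 * h y) \<longlongrightarrow> 0) ?F" by simp
  have "((\<lambda>y. ?Q y - G y) \<longlongrightarrow> 0) ?F"
  proof (rule Lim_null_comparison[OF _ b2])
    show "eventually (\<lambda>y. norm (?Q y - G y) \<le> 4 * (R y + mu)\<^sup>2 * h y) ?F"
      using ev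
    proof eventually_elim
      case (elim y)
      let ?s = "min t y" and ?v = "max t y"
      have RLy: "L y = R y * h y" using RL elim by simp
      have hp: "0 < h y" "?v - ?s = h y" using elim by (auto simp: h_def)
      have Q: "?Q y = (idle_prob r ?v - idle_prob r ?s) / h y"
      proof (cases "t \<le> y")
        case False
        then show ?thesis
          using minus_divide_divide[of "idle_prob r t - idle_prob r y" "t - y"]
          by (simp add: min_def max_def h_def)
      qed (simp add: h_def)
      have "\<bar>idle_prob r ?v - idle_prob r ?s - (- L y * idle_prob r ?s + L y * q ?s + mu * h y * busy_prob r ?s)\<bar>
          \<le> 4 * (L y + mu * h y)\<^sup>2"
        using idle_prob_expansion[of ?s ?v r] t elim r hp(2) unfolding L_def q_def by auto
      moreover have "idle_prob r ?v - idle_prob r ?s - (- L y * idle_prob r ?s + L y * q ?s + mu * h y * busy_prob r ?s)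
          = (?Q y - G y) * h y"
      proof -
        have "?Q y * h y = idle_prob r ?v - idle_prob r ?s" unfolding Q using hp(1) by simp
        moreover have "G y * h y = - L y * idle_prob r ?s + L y * q ?s + mu * h y * busy_prob r ?s"
          unfolding G_def RLy by (simp add: algebra_simps)
        ultimately show ?thesis by (simp add: left_diff_distrib)
      qed
      moreover have "4 * (L y + mu * h y)\<^sup>2 = 4 * (R y + mu)\<^sup>2 * h y * h y"
        unfolding RLy by (simp add: algebra_simps power2_eq_square)
      ultimately have "\<bar>?Q y - G y\<bar> * h y \<le> 4 * (R y + mu)\<^sup>2 * h y * h y"
        using hp(1) by (simp add: abs_mult)
      then show ?case using hp(1) by simp
    qed
  qed
  from tendsto_add[OF this G] show ?thesis by (simp add: has_field_derivative_iff q_def)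
qed

section \<open>Transport of the densities along the diagonal\<close>

lemma busy_in_later:
  assumes t: "0 \<le> t" "0 \<le> h" and A: "A \<subseteq> {0<..}"
  shows "\<omega> \<in> busy_in (t + h) {n} {y. y - h \<in> A} j \<longleftrightarrow>
    (\<exists>i\<le>n. \<omega> \<in> busy_in t {n - i} A j \<inter> increment t (t + h) {i} \<inter> {\<omega> \<in> space M. ereal (t + h) < fr j \<omega>})"
    (is "?l \<longleftrightarrow> ?r")
proof (cases "\<omega> \<in> space M")
  case w: True
  interpret p: service_path "\<lambda>u. N u \<omega>" k B "Q0 \<omega>" "busy0 \<omega>" "\<lambda>i. S i \<omega>" by (rule service_path) fact
  have el: "elapsed j (t + h) \<omega> - h = elapsed j t \<omega>" by (simp add: elapsed_def)
  show ?thesis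
  proof
    assume l: ?l
    then have b: "p.busy j (t + h) n" by (auto simp: busy_in_def waiting_def p.busy_def)
    have e: "elapsed j t \<omega> \<in> A" using l el by (simp add: busy_in_def)
    \<comment> \<open>This is where \<open>A \<subseteq> {0<..}\<close> enters: the age at
      \<open>t + h\<close> exceeds \<open>h\<close>, so the service began before \<open>t\<close>,
      and services started later do not contribute.\<close>
    have "st j \<omega> \<le> ereal t"
    proof (cases "j = 0")
      case True then show ?thesis using t by simp
    next
      case False
      then have "real_of_ereal (st j \<omega>) < t" using e A by (auto simp: elapsed_def)
      then show ?thesis using p.start_real[of j "t + h"] b by (metis p.busy_def less_imp_le ereal_less_eq(3))
    qed
    with p.busy_back[OF b, of t] t have
      "p.busy j t (waiting j t \<omega>)" "n = waiting j t \<omega> + (N (t + h) \<omega> - N t \<omega>)"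
      by (auto simp: waiting_def)
    then show ?r using b e w
      by (intro exI[of _ "N (t + h) \<omega> - N t \<omega>"]) (auto simp: busy_in_def p.busy_def increment_def waiting_def)
  next
    assume ?r
    then obtain i where i: "i \<le> n" "\<omega> \<in> busy_in t {n - i} A j" "N (t + h) \<omega> - N t \<omega> = i" "ereal (t + h) < fr j \<omega>"
      by (auto simp: increment_def)
    then have "p.busy j t (n - i)" by (auto simp: busy_in_def waiting_def p.busy_def)
    from p.busy_step_busy[OF this _ t(1) i(4)] t i(1,3) have "p.busy j (t + h) n" by simp
    then show ?l using w el i(2) by (auto simp: busy_in_def waiting_def p.busy_def)
  qed
qed (simp add: busy_in_def)

lemma busy_prob_later:
  assumes t: "0 \<le> t" "0 \<le> h" and A: "A \<subseteq> {0<..}" "A \<in> sets borel"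
  shows "prob (\<Union>j. busy_in (t + h) {n} {y. y - h \<in> A} j) =
    (\<Sum>i\<le>n. exp (- (mu * h)) * prob (increment t (t + h) {i}) * prob (\<Union>j. busy_in t {n - i} A j))"
proof -
  define X where "X i = (\<Union>j. busy_in t {n - i} A j \<inter> increment t (t + h) {i} \<inter> {\<omega> \<in> space M. ereal (t + h) < fr j \<omega>})" for i
  have [measurable]: "busy_in t R A j \<in> events" "increment t (t + h) \<Delta> \<in> events" for R j \<Delta>
    using t A by (auto intro: busy_in_event)
  have X: "X i \<in> events" for i unfolding X_def by measurable
  have "(\<Union>j. busy_in (t + h) {n} {y. y - h \<in> A} j) = (\<Union>i\<in>{..n}. X i)"
    unfolding X_def using busy_in_later[OF t A(1), of _ n] by blast
  then have "prob (\<Union>j. busy_in (t + h) {n} {y. y - h \<in> A} j) = prob (\<Union>i\<in>{..n}. X i)" by simp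
  also have "\<dots> = (\<Sum>i\<le>n. prob (X i))"
  proof (rule finite_measure_finite_Union)
    show "disjoint_family_on X {..n}"
      unfolding disjoint_family_on_def X_def by (auto simp: increment_def)
  qed (use X in auto)
  finally have *: "prob (\<Union>j. busy_in (t + h) {n} {y. y - h \<in> A} j) = (\<Sum>i\<le>n. prob (X i))" .
  have "prob (X i) = exp (- (mu * h)) * prob (increment t (t + h) {i}) * prob (\<Union>j. busy_in t {n - i} A j)" for i
    unfolding X_def using busy_survives[OF t(1) _ A(2), of "t + h"] t(2) by simp
  then show ?thesis unfolding * by simp
qed

lemma density_later:
  assumes dens: "\<And>m s. 0 \<le> s \<Longrightarrow> busy_density m s (\<lambda>x. p m x s)"
    and t: "0 \<le> t" "0 \<le> h" and A: "A \<subseteq> {0<..}" "A \<in> sets borel"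
  shows "set_integrable lborel A (\<lambda>x. p n (x + h) (t + h) -
      (\<Sum>i\<le>n. exp (- (mu * h)) * prob (increment t (t + h) {i}) * p (n - i) x t))" (is ?I)
    and "(LINT x:A|lborel. p n (x + h) (t + h) -
      (\<Sum>i\<le>n. exp (- (mu * h)) * prob (increment t (t + h) {i}) * p (n - i) x t)) = 0" (is ?E)
proof -
  define c where "c i = exp (- (mu * h)) * prob (increment t (t + h) {i})" for i
  have AA: "A \<inter> {0<..} = A" using A by blast
  have int: "set_integrable lborel A (\<lambda>x. p m x t)" for m
    by (rule set_integrable_subset[of _ "{0<..}"]) (use dens[OF t(1), of m] A in \<open>auto simp: busy_density_def\<close>)
  have P: "prob (\<Union>j. busy_in t {m} A j) = (LINT x:A|lborel. p m x t)" for m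
    using dens[OF t(1), of m] A(2) AA unfolding busy_density_def busy_with_eq[OF t(1)] by metis
  let ?A = "{y. y - h \<in> A}"
  have "?A = (\<lambda>y. y - h) -` A" by auto
  then have Ab: "?A \<in> sets borel" using measurable_sets[of "\<lambda>y. y - h" borel borel A] A(2) by simp
  \<comment> \<open>Both \<open>A\<close> and its shift by \<open>h\<close> lie in
    \<open>{0<..}\<close>, so the restriction in \<open>busy_density\<close> disappears.\<close>
  have A0: "?A \<inter> {0<..} = ?A" using A(1) t(2) by fastforce
  have th: "0 \<le> t + h" using t by simp
  have int': "set_integrable lborel ?A (\<lambda>x. p n x (t + h))"
    by (rule set_integrable_subset[of _ "{0<..}"])
      (use dens[OF th, of n] Ab A0 in \<open>auto simp: busy_density_def\<close>)
  have P': "prob (\<Union>j. busy_in (t + h) {n} ?A j) = (LINT x:?A|lborel. p n x (t + h))"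
    using dens[OF th, of n] Ab A0 unfolding busy_density_def busy_with_eq[OF th] by metis
  \<comment> \<open>Written as \<open>h + 1 * x\<close> to match the affine substitution that moves
    both integrals onto \<open>A\<close>.\<close>
  have ind: "indicator ?A (h + 1 * x) = (indicator A x :: real)" for x by (simp add: indicator_def)
  have shift_int: "set_integrable lborel A (\<lambda>x. p n (x + h) (t + h))"
    using lborel_integrable_real_affine[OF int'[unfolded set_integrable_def], of 1 h]
    unfolding set_integrable_def ind by (simp add: add.commute)
  have shift: "(LINT x:?A|lborel. p n x (t + h)) = (LINT x:A|lborel. p n (x + h) (t + h))"
    unfolding set_lebesgue_integral_def
    by (subst lborel_integral_real_affine[of 1 _ h]) (simp_all add: ind[simplified] ind[simplified, unfolded add.commute[of h]] add.commute)
  have int_sum: "set_integrable lborel A (\<lambda>x. \<Sum>i\<le>n. c i * p (n - i) x t)"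
    using int by (auto simp: set_integrable_def sum_distrib_left mult.left_commute scaleR_sum_right)
  have sum: "(LINT x:A|lborel. (\<Sum>i\<le>n. c i * p (n - i) x t)) = (\<Sum>i\<le>n. c i * (LINT x:A|lborel. p (n - i) x t))"
    using int unfolding set_lebesgue_integral_def set_integrable_def
    by (simp add: sum_distrib_left mult.left_commute)
  show ?I using set_integral_diff(1)[OF shift_int int_sum] unfolding c_def .
  have "(LINT x:A|lborel. p n (x + h) (t + h)) = (\<Sum>i\<le>n. c i * (LINT x:A|lborel. p (n - i) x t))"
    using busy_prob_later[OF t A, of n] unfolding P P' shift c_def .
  then show ?E using set_integral_diff(2)[OF shift_int int_sum] sum unfolding c_def by simp
qed

text \<open>The difference of the two sides integrates to 0 over every small interval, hence
  vanishes where it is continuous. Continuity is used only near the two end points of the diagonal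
  segment.\<close>

lemma density_flow:
  assumes dens: "\<And>m s. 0 \<le> s \<Longrightarrow> busy_density m s (\<lambda>x. p m x s)"
    and U: "open U" "\<And>m. m \<le> n \<Longrightarrow> continuous_on (U \<inter> {0..} \<times> {0..}) (\<lambda>(y, s). p m y s)"
    and x: "0 \<le> x" "0 \<le> t" "0 \<le> h" "(x, t) \<in> U" "(x + h, t + h) \<in> U"
  shows "p n (x + h) (t + h) = (\<Sum>i\<le>n. exp (- (mu * h)) * prob (increment t (t + h) {i}) * p (n - i) x t)"
proof -
  define \<phi> where "\<phi> y = p n (y + h) (t + h) -
    (\<Sum>i\<le>n. exp (- (mu * h)) * prob (increment t (t + h) {i}) * p (n - i) y t)" for y
  define V where "V = (\<lambda>y. (y, t)) -` U \<inter> (\<lambda>y. (y + h, t + h)) -` U"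
  have "open V" unfolding V_def
    by (intro open_Int open_vimage U(1) continuous_intros)
  moreover have "x \<in> V" using x by (simp add: V_def)
  ultimately obtain e where e: "0 < e" "cball x e \<subseteq> V" using open_contains_cball by blast
  \<comment> \<open>The interval is cut off at 0 so as to stay in the quadrant; for
    \<open>x = 0\<close> the point is therefore its left end.\<close>
  define a where "a = max 0 (x - e)"
  define b where "b = x + e"
  have ab: "a < b" "a \<le> x" "x \<le> b" "0 \<le> a" using e(1) x(1) by (auto simp: a_def b_def)
  have sub: "{a..b} \<subseteq> V \<inter> {0..}" using e(2) by (auto simp: a_def b_def cball_def dist_real_def subset_iff)
  have c1: "continuous_on {a..b} (\<lambda>y. p m y t)" if "m \<le> n" for m
  proof -
    have c: "continuous_on {a..b} (\<lambda>y. (y, t))" by (intro continuous_intros)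
    have img: "(\<lambda>y. (y, t)) ` {a..b} \<subseteq> U \<inter> {0..} \<times> {0..}" using sub x by (auto simp: V_def)
    from continuous_on_compose2[OF U(2)[OF that] c img] show ?thesis by simp
  qed
  have c2: "continuous_on {a..b} (\<lambda>y. p n (y + h) (t + h))"
  proof -
    have c: "continuous_on {a..b} (\<lambda>y. (y + h, t + h))" by (intro continuous_intros)
    have img: "(\<lambda>y. (y + h, t + h)) ` {a..b} \<subseteq> U \<inter> {0..} \<times> {0..}" using sub x by (auto simp: V_def)
    from continuous_on_compose2[OF U(2)[OF order_refl] c img] show ?thesis by simp
  qed
  have cont: "continuous_on {a..b} \<phi>"
    unfolding \<phi>_def by (intro continuous_intros c1 c2) auto
  have "\<phi> y = 0" if "y \<in> {a<..<b}" for y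
  proof (rule continuous_zero_if_integrals_zero[OF _ that])
    show "continuous_on {a<..<b} \<phi>" by (rule continuous_on_subset[OF cont]) auto
    show "(LINT y:{c..d}|lborel. \<phi> y) = 0" if "a < c" "c < d" "d < b" for c d
      unfolding \<phi>_def by (rule density_later(2)[OF dens x(2,3)]) (use that ab in auto)
  qed
  \<comment> \<open>The integrals decide only interior points; continuity extends the identity to an
    end point.\<close>
  moreover have "x \<in> closure {a<..<b}" "closure {a<..<b} = {a..b}" using ab by auto
  ultimately have "\<phi> x = 0"
    using continuous_constant_on_closure[of "{a<..<b}" \<phi> 0 x] cont by auto
  then show ?thesis by (simp add: \<phi>_def)
qed

end

text \<open>Since \<open>L 0 = 0\<close>, the weights with \<open>i \<ge> 2\<close> vanish to second
  order, and only no arrival and one arrival leave a trace in the derivative.\<close>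

lemma poisson_weight_derivative:
  fixes L :: "real \<Rightarrow> real"
  assumes L: "(L has_real_derivative l) (at 0 within A)" and L0: "L 0 = 0"
  shows "((\<lambda>h. exp (- (m * h)) * (exp (- L h) * L h ^ i / fact i) * c) has_real_derivative
    (if i = 0 then - (l + m) else if i = 1 then l else 0) * c) (at 0 within A)"
proof -
  have 1: "((\<lambda>h. exp (- (m * h))) has_real_derivative - m) (at 0 within A)"
    by (auto intro!: derivative_eq_intros)
  have 2: "((\<lambda>h. exp (- L h)) has_real_derivative - l) (at 0 within A)"
    by (auto intro!: derivative_eq_intros L simp: L0)
  have 3: "((\<lambda>h. L h ^ i) has_real_derivative real i * 0 ^ (i - 1) * l) (at 0 within A)"
    by (auto intro!: derivative_eq_intros L simp: L0)
  let ?D = "- m * (exp (- L 0) * L 0 ^ i) +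
    (- l * L 0 ^ i + real i * 0 ^ (i - 1) * l * exp (- L 0)) * exp (- (m * 0))"
  have "((\<lambda>h. c / fact i * (exp (- (m * h)) * (exp (- L h) * L h ^ i))) has_real_derivative c / fact i * ?D)
      (at 0 within A)"
    by (rule DERIV_cmult[OF DERIV_mult[OF 1 DERIV_mult[OF 2 3]]])
  \<comment> \<open>The power \<open>0 ^ (i - 1)\<close> is 1 for \<open>i = 0\<close> and
    \<open>i = 1\<close>; in the first case the factor \<open>real i\<close> removes the
    term.\<close>
  moreover have "c / fact i * ?D = (if i = 0 then - (l + m) else if i = 1 then l else 0) * c"
    by (cases "i = 0"; cases "i = 1") (auto simp: L0 power_0_left algebra_simps)
  ultimately show ?thesis by (simp add: mult_ac)
qed

section \<open>The transport equation\<close>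

context bulk_service_queue
begin

lemma flow_derivative:
  assumes t: "0 \<le> t"
  shows "((\<lambda>h. \<Sum>i\<le>n. exp (- (mu * h)) * prob (increment t (t + h) {i}) * c i) has_real_derivative
    - (lam t + mu) * c 0 + (if 1 \<le> n then lam t * c 1 else 0)) (at 0 within {0..})"
proof -
  have lim: "((\<lambda>h. mean t (t + h) / h) \<longlongrightarrow> lam t) (at 0 within {0..})"
  proof -
    let ?F = "at 0 within {0..} :: real filter"
    have "((\<lambda>h. t + h) \<longlongrightarrow> t + 0) ?F" by (intro tendsto_intros)
    moreover have "eventually (\<lambda>h. h \<noteq> 0 \<and> 0 \<le> h) ?F" by (simp add: eventually_at_filter)
    then have ev: "eventually (\<lambda>h. t + h \<in> {0..} \<and> t + h \<noteq> t) ?F"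
      by eventually_elim (use t in simp)
    \<comment> \<open>For \<open>h \<ge> 0\<close> the point \<open>t + h\<close> approaches
      \<open>t\<close> from the right within \<open>{0..}\<close>, so the two-sided quotient
      specializes to the present one.\<close>
    ultimately have "filterlim (\<lambda>h. t + h) (at t within {0..}) ?F"
      unfolding filterlim_at by simp
    from filterlim_compose[OF integral_quotient_tendsto[OF lam_continuous t] this]
    show ?thesis
      by (rule Lim_transform_eventually) (simp add: eventually_at_filter)
  qed
  then have mean: "((\<lambda>h. mean t (t + h)) has_real_derivative lam t) (at 0 within {0..})"
    by (simp add: has_field_derivative_iff)
  define d where "d i = (if i = 0 then - (lam t + mu) else if i = 1 then lam t else 0)" for i :: nat
  have summand: "((\<lambda>h. exp (- (mu * h)) * (exp (- mean t (t + h)) * mean t (t + h) ^ i / fact i) * c i)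
      has_real_derivative d i * c i) (at 0 within {0..})" for i
    unfolding d_def by (rule poisson_weight_derivative[OF mean]) simp
  have "((\<lambda>h. \<Sum>i\<le>n. exp (- (mu * h)) * (exp (- mean t (t + h)) * mean t (t + h) ^ i / fact i) * c i)
      has_real_derivative (\<Sum>i\<le>n. d i * c i)) (at 0 within {0..})"
    by (intro DERIV_sum summand)
  moreover have "(\<Sum>i\<le>n. d i * c i) = - (lam t + mu) * c 0 + (if 1 \<le> n then lam t * c 1 else 0)"
  proof -
    have "(\<Sum>i\<le>n. d i * c i) = (\<Sum>i\<in>(if 1 \<le> n then {0, 1} else {0}). d i * c i)"
      by (rule sum.mono_neutral_right) (auto simp: d_def)
    then show ?thesis by (simp add: d_def)
  qed
  ultimately have "((\<lambda>h. \<Sum>i\<le>n. exp (- (mu * h)) * (exp (- mean t (t + h)) * mean t (t + h) ^ i / fact i) * c i)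
      has_real_derivative - (lam t + mu) * c 0 + (if 1 \<le> n then lam t * c 1 else 0)) (at 0 within {0..})"
    by simp
  then show ?thesis
    by (rule has_field_derivative_transform_within[where d=1]) (use t in \<open>auto simp: prob_increment\<close>)
qed

text \<open>Differentiability turns the sum of the two partial derivatives into the derivative in
  direction \<open>(1, 1)\<close>, and along the diagonal the density is known explicitly from
  \<open>density_flow\<close>.\<close>

lemma transport_equation:
  assumes dens: "\<And>m s. 0 \<le> s \<Longrightarrow> busy_density m s (\<lambda>x. p m x s)"
    and x: "0 \<le> x" "0 \<le> t" and reg: "regular_at p n x t"
  shows "\<exists>Dt Dx. ((\<lambda>s. p n x s) has_real_derivative Dt) (at t within {0..}) \<and>
    ((\<lambda>y. p n y t) has_real_derivative Dx) (at x within {0..}) \<and>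
    Dt + Dx = - (lam t + mu) * p n x t + (if 1 \<le> n then lam t * p (n - 1) x t else 0)"
proof -
  let ?Q = "{0..} \<times> {0..} :: (real \<times> real) set" and ?f = "\<lambda>(y, s). p n y s"
  obtain U where U: "open U" "(x, t) \<in> U"
    "\<And>m. m \<le> n \<Longrightarrow> continuous_on (U \<inter> ?Q) (\<lambda>(y, s). p m y s)"
    using reg unfolding regular_at_def by blast
  obtain f' where f': "(?f has_derivative f') (at (x, t) within ?Q)"
    using reg unfolding regular_at_def differentiable_def by blast
  have lin: "linear f'" using f' has_derivative_linear by blast
  \<comment> \<open>One chain rule for the vertical, the horizontal and the diagonal line through
    \<open>(x, t)\<close>; the last condition keeps the line in the quadrant, where
    \<open>f'\<close> is the derivative.\<close>
  have along: "((\<lambda>h. p n (a + h * u) (b + h * v)) has_real_derivative f' (u, v)) (at h0 within {0..})"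
    if "a + h0 * u = x" "b + h0 * v = t" "\<And>h. 0 \<le> h \<Longrightarrow> 0 \<le> a + h * u \<and> 0 \<le> b + h * v" for a b u v h0
  proof -
    let ?c = "\<lambda>h. (a + h * u, b + h * v)"
    have c: "(?c has_derivative (\<lambda>h. (h * u, h * v))) (at h0 within {0..})"
      by (auto intro!: derivative_eq_intros)
    have "(?f has_derivative f') (at (?c h0) within ?c ` {0..})"
      by (rule has_derivative_subset[of _ _ _ ?Q]) (use f' that in auto)
    from diff_chain_within[OF c this]
    have "((\<lambda>h. p n (a + h * u) (b + h * v)) has_derivative (\<lambda>h. f' (h * u, h * v))) (at h0 within {0..})"
      by (simp add: o_def)
    then show ?thesis
      by (rule has_derivative_imp_has_field_derivative)
        (use linear_scale[OF lin, of _ "(u, v)"] in simp)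
  qed
  have Dt: "((\<lambda>s. p n x s) has_real_derivative f' (0, 1)) (at t within {0..})"
    using along[of x t 0 0 1] x by simp
  have Dx: "((\<lambda>y. p n y t) has_real_derivative f' (1, 0)) (at x within {0..})"
    using along[of 0 x 1 t 0] x by simp
  have diag: "((\<lambda>h. p n (x + h) (t + h)) has_real_derivative f' (1, 1)) (at 0 within {0..})"
    using along[of x 0 1 t 1] x by simp
  have sum: "f' (0, 1) + f' (1, 0) = f' (1, 1)" using linear_add[OF lin, of "(0, 1)" "(1, 0)"] by simp
  have "open ((\<lambda>h. (x + h, t + h)) -` U)" by (intro open_vimage U(1) continuous_intros)
  moreover have "0 \<in> (\<lambda>h. (x + h, t + h)) -` U" using U(2) by simp
  ultimately obtain e where e: "0 < e" "ball 0 e \<subseteq> (\<lambda>h. (x + h, t + h)) -` U"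
    using open_contains_ball by blast
  let ?c = "\<lambda>i. p (n - i) x t"
  have "((\<lambda>h. p n (x + h) (t + h)) has_real_derivative
    - (lam t + mu) * ?c 0 + (if 1 \<le> n then lam t * ?c 1 else 0)) (at 0 within {0..})"
  proof (rule has_field_derivative_transform_within[OF flow_derivative[OF x(2), where n=n and c="?c"] e(1)])
    show "(\<Sum>i\<le>n. exp (- (mu * h)) * prob (increment t (t + h) {i}) * ?c i) = p n (x + h) (t + h)"
      if "h \<in> {0..}" "dist h 0 < e" for h
    proof -
      have "h \<in> ball 0 e" using that by (simp add: dist_commute)
      then have "(x + h, t + h) \<in> U" using e(2) by blast
      then show ?thesis using density_flow[OF dens U(1,3) x _ U(2), of n h] that by simp
    qed
  qed simp
  then have "f' (1, 1) = - (lam t + mu) * ?c 0 + (if 1 \<le> n then lam t * ?c 1 else 0)"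
    \<comment> \<open>The filter at 0 within \<open>{0..}\<close> is the nontrivial filter from the
      right, so the one-sided derivative is unique.\<close>
    by (intro tendsto_unique[OF _ diag[unfolded has_field_derivative_iff]])
      (simp_all add: at_within_Ici_at_right has_field_derivative_iff)
  with sum have "f' (0, 1) + f' (1, 0) = - (lam t + mu) * p n x t + (if 1 \<le> n then lam t * p (n - 1) x t else 0)"
    by simp
  with Dt Dx show ?thesis by blast
qed

end

theorem theorem1:
  fixes M :: "'a measure" and lam :: "real \<Rightarrow> real" and N :: "real \<Rightarrow> 'a \<Rightarrow> nat"
    and mu :: real and k B :: nat and S :: "nat \<Rightarrow> 'a \<Rightarrow> real"
    and Q0 :: "'a \<Rightarrow> nat" and busy0 :: "'a \<Rightarrow> bool" and X0 :: "'a \<Rightarrow> real"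
    and p0 :: "nat \<Rightarrow> real \<Rightarrow> real" and p1 :: "nat \<Rightarrow> real \<Rightarrow> real \<Rightarrow> real"
  assumes queue: "bulk_service_queue M lam N mu k B S Q0 busy0 X0"
    and p0: "\<And>r t. r < k \<Longrightarrow> 0 \<le> t \<Longrightarrow>
      p0 r t = bulk_service_queue.idle_prob M N k B S Q0 busy0 r t"
    and p1: "\<And>n t. 0 \<le> t \<Longrightarrow>
      bulk_service_queue.busy_density M N k B S Q0 busy0 X0 n t (\<lambda>x. p1 n x t)"
  shows
    "(\<forall>t\<ge>0. (p0 0 has_real_derivative
        - lam t * p0 0 t + mu * (LINT x:{0<..}|lborel. p1 0 x t)) (at t within {0..}))
    \<and> (\<forall>t\<ge>0. \<forall>r. 1 \<le> r \<and> r < k \<longrightarrow> (p0 r has_real_derivative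
        - lam t * p0 r t + lam t * p0 (r - 1) t + mu * (LINT x:{0<..}|lborel. p1 r x t))
        (at t within {0..}))
    \<and> (\<forall>t\<ge>0. \<forall>x\<ge>0. regular_at p1 0 x t \<longrightarrow> (\<exists>Dt Dx.
        ((\<lambda>s. p1 0 x s) has_real_derivative Dt) (at t within {0..}) \<and>
        ((\<lambda>y. p1 0 y t) has_real_derivative Dx) (at x within {0..}) \<and>
        Dt + Dx = - (lam t + mu) * p1 0 x t))
    \<and> (\<forall>t\<ge>0. \<forall>x\<ge>0. \<forall>n\<ge>1. regular_at p1 n x t \<longrightarrow> (\<exists>Dt Dx.
        ((\<lambda>s. p1 n x s) has_real_derivative Dt) (at t within {0..}) \<and>
        ((\<lambda>y. p1 n y t) has_real_derivative Dx) (at x within {0..}) \<and>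
        Dt + Dx = - (lam t + mu) * p1 n x t + lam t * p1 (n - 1) x t))"
proof -
  interpret bulk_service_queue M lam N mu k B S Q0 busy0 X0 by (rule queue)
  have busy: "busy_prob r t = (LINT x:{0<..}|lborel. p1 r x t)" if "0 \<le> t" for r t
  proof -
    have "\<forall>A\<in>sets borel. prob {\<omega> \<in> space M. \<exists>x\<in>A. busy_with t r x \<omega>} =
        (LINT x:A \<inter> {0<..}|lborel. p1 r x t)"
      using p1[OF that, of r] unfolding busy_density_def by (elim conjE)
    \<comment> \<open>With \<open>A = UNIV\<close> the density condition also says that elapsed time
      0 carries no mass, so the integral over \<open>{0<..}\<close> is the full busy
      probability.\<close>
    from bspec[OF this, of UNIV]
    have "prob {\<omega> \<in> space M. \<exists>x\<in>UNIV. busy_with t r x \<omega>} = (LINT x:{0<..}|lborel. p1 r x t)"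
      by simp
    then show ?thesis unfolding busy_with_eq[OF that] busy_prob_def by simp
  qed
  have ode: "(p0 r has_real_derivative
      - lam t * p0 r t + lam t * (if 1 \<le> r then p0 (r - 1) t else 0) + mu * (LINT x:{0<..}|lborel. p1 r x t))
      (at t within {0..})" if t: "0 \<le> t" and r: "r < k" for r t
  proof -
    have "(idle_prob r has_real_derivative
      - lam t * p0 r t + lam t * (if 1 \<le> r then p0 (r - 1) t else 0) + mu * (LINT x:{0<..}|lborel. p1 r x t))
      (at t within {0..})"
      using idle_prob_derivative[OF t r] p0[OF r t] p0[of "r - 1" t] busy[OF t, of r] t r
      by (cases "1 \<le> r") auto
    \<comment> \<open>\<open>p0 r\<close> is known to agree with \<open>idle_prob r\<close> only at
      nonnegative times, which suffices for a derivative within \<open>{0..}\<close>.\<close>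
    then show ?thesis
      by (rule has_field_derivative_transform_within[where d=1]) (use p0 r t in auto)
  qed
  have pde: "\<exists>Dt Dx. ((\<lambda>s. p1 n x s) has_real_derivative Dt) (at t within {0..}) \<and>
      ((\<lambda>y. p1 n y t) has_real_derivative Dx) (at x within {0..}) \<and>
      Dt + Dx = - (lam t + mu) * p1 n x t + (if 1 \<le> n then lam t * p1 (n - 1) x t else 0)"
    if "0 \<le> t" "0 \<le> x" "regular_at p1 n x t" for t x n
    by (rule transport_equation[OF p1 that(2,1,3)])
  show ?thesis
  proof (intro conjI allI impI)
    fix t :: real assume "0 \<le> t"
    then show "(p0 0 has_real_derivative - lam t * p0 0 t + mu * (LINT x:{0<..}|lborel. p1 0 x t)) (at t within {0..})"
      using ode[of t 0] k_ge_1 by simp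
  next
    fix t :: real and r assume "0 \<le> t" "1 \<le> r \<and> r < k"
    then show "(p0 r has_real_derivative - lam t * p0 r t + lam t * p0 (r - 1) t +
        mu * (LINT x:{0<..}|lborel. p1 r x t)) (at t within {0..})"
      using ode[of t r] by simp
  next
    fix t x :: real assume "0 \<le> t" "0 \<le> x" "regular_at p1 0 x t"
    from pde[OF this] show "\<exists>Dt Dx. ((\<lambda>s. p1 0 x s) has_real_derivative Dt) (at t within {0..}) \<and>
        ((\<lambda>y. p1 0 y t) has_real_derivative Dx) (at x within {0..}) \<and>
        Dt + Dx = - (lam t + mu) * p1 0 x t"
      by simp
  next
    fix t x :: real and n :: nat assume "0 \<le> t" "0 \<le> x" and n: "1 \<le> n" and "regular_at p1 n x t"
    from pde[OF this(1,2,4)] show "\<exists>Dt Dx. ((\<lambda>s. p1 n x s) has_real_derivative Dt) (at t within {0..}) \<and>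
        ((\<lambda>y. p1 n y t) has_real_derivative Dx) (at x within {0..}) \<and>
        Dt + Dx = - (lam t + mu) * p1 n x t + lam t * p1 (n - 1) x t"
      using n by simp
  qed
qed

end
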